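(* Let $S$ be a quotient of a polynomial ring in finitely many variables over a perfect field of characteristic $p>0$, and suppose that $S$ is Cohen-Macaulay and generically Gorenstein. Let $\epsilon$ be a nonnegative integer which is an upper bound for the set $\{\operatorname{HSL}(\mathrm{H}^{\dim S_{\mathfrak{m}}}_{\mathfrak{m}}(S))\mid \mathfrak{m}\subset S \text{ a maximal ideal}\}$. If $J\subseteq S$ is an ideal which is locally a parameter ideal, i.e. for every maximal ideal $\mathfrak{m}\supseteq J$ the ideal $J_{\mathfrak{m}}\subseteq S_{\mathfrak{m}}$ is a parameter ideal, then $$(J^F)^{[p^\epsilon]}=J^{[p^\epsilon]}.$$
   Context: A ring is generically Gorenstein if its localisation at each minimal prime is Gorenstein. A parameter ideal of a local ring is an ideal generated by a system of parameters. For an ideal $J$ of a ring $S$ of characteristic $p$, $J^{[p^e]}$ is the ideal generated by $\{a^{p^e}\mid a\in J\}$, and the Frobenius closure of $J$ is $J^F=\{a\in S\mid a^{p^e}\in J^{[p^e]}\text{ for some }e>0\}$. The local cohomology modules $\mathrm{H}^i_{\mathfrak m}(S)$ carry the natural Frobenius map $\theta$ (additive, $\theta(sm)=s^p\theta(m)$), induced by the $S$-linear map $S\to F_*S$, $s\mapsto s^p$, where $F_*S$ is the abelian group $S$ with module structure $r\cdot s=r^ps$, together with $\mathrm{H}^i_{\mathfrak m}(F_*S)\cong F_*\mathrm{H}^i_{\mathfrak m}(S)$. For a module $M$ with such a map $\theta$, $\operatorname{Nil}(M)=\bigcup_{i\ge0}\{m\in M\mid \theta^i(m)=0\}$, and $\operatorname{HSL}(M)$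 is the smallest integer $e\ge 0$ with $\theta^e(\operatorname{Nil}(M))=0$. *)

theory Defs
  imports
    "HOL-Algebra.Algebra"
    "HOL-Algebra.Algebraic_Closure_Type"
    "HOL-Library.Poly_Mapping"
    "HOL-Library.Extended_Nat"
begin

section \<open>Localisation\<close>

text \<open>
  For a multiplicative subset \<open>W\<close> of a commutative ring \<open>S\<close>, a fraction \<open>a/s\<close> is the class of
  all pairs \<open>(b, t)\<close> with \<open>w (a t - b s) = 0\<close> for some \<open>w \<in> W\<close>. Operations on classes are unions
  over representatives; all members of such a union coincide.
\<close>

definition loc_frac :: "('a, 'm) ring_scheme \<Rightarrow> 'a set \<Rightarrow> 'a \<Rightarrow> 'a \<Rightarrow> ('a \<times> 'a) set"
  where "loc_frac S W a s =
    {(b, t). b \<in> carrier S \<and> t \<in> W \<and>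
       (\<exists>w\<in>W. w \<otimes>\<^bsub>S\<^esub> (a \<otimes>\<^bsub>S\<^esub> t \<ominus>\<^bsub>S\<^esub> b \<otimes>\<^bsub>S\<^esub> s) = \<zero>\<^bsub>S\<^esub>)}"

definition localization :: "('a, 'm) ring_scheme \<Rightarrow> 'a set \<Rightarrow> ('a \<times> 'a) set ring"
  where "localization S W = \<lparr>
    carrier = {loc_frac S W a s | a s. a \<in> carrier S \<and> s \<in> W},
    monoid.mult = (\<lambda>U V. \<Union>x\<in>U. \<Union>y\<in>V.
              loc_frac S W (fst x \<otimes>\<^bsub>S\<^esub> fst y) (snd x \<otimes>\<^bsub>S\<^esub> snd y)),
    monoid.one = loc_frac S W \<one>\<^bsub>S\<^esub> \<one>\<^bsub>S\<^esub>,
    ring.zero = loc_frac S W \<zero>\<^bsub>S\<^esub> \<one>\<^bsub>S\<^esub>,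
    ring.add = (\<lambda>U V. \<Union>x\<in>U. \<Union>y\<in>V.
             loc_frac S W (fst x \<otimes>\<^bsub>S\<^esub> snd y \<oplus>\<^bsub>S\<^esub> fst y \<otimes>\<^bsub>S\<^esub> snd x) (snd x \<otimes>\<^bsub>S\<^esub> snd y)) \<rparr>"

text \<open>The canonical map from a localisation at a smaller set to the one at \<open>W\<close>.\<close>

definition loc_map :: "('a, 'm) ring_scheme \<Rightarrow> 'a set \<Rightarrow> ('a \<times> 'a) set \<Rightarrow> ('a \<times> 'a) set"
  where "loc_map S W U = (\<Union>x\<in>U. loc_frac S W (fst x) (snd x))"

definition loc_at :: "('a, 'm) ring_scheme \<Rightarrow> 'a set \<Rightarrow> ('a \<times> 'a) set ring"
  where "loc_at S P = localization S (carrier S - P)"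

definition ideal_at :: "('a, 'm) ring_scheme \<Rightarrow> 'a set \<Rightarrow> 'a set \<Rightarrow> ('a \<times> 'a) set set"
  where "ideal_at S P J =
    genideal (loc_at S P) ((\<lambda>a. loc_frac S (carrier S - P) a \<one>\<^bsub>S\<^esub>) ` J)"


section \<open>Dimension, parameters, Cohen-Macaulay rings\<close>

definition krull_dim :: "('a, 'm) ring_scheme \<Rightarrow> enat"
  where "krull_dim R = Sup {enat n | n. \<exists>P :: nat \<Rightarrow> 'a set.
    (\<forall>i\<le>n. primeideal (P i) R) \<and> (\<forall>i<n. P i \<subset> P (Suc i))}"

definition minimal_prime :: "'a set \<Rightarrow> ('a, 'm) ring_scheme \<Rightarrow> bool"
  where "minimal_prime P R \<longleftrightarrow>
    primeideal P R \<and> (\<forall>Q. primeideal Q R \<and> Q \<subseteq> P \<longrightarrow> Q = P)"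

definition noetherian_local :: "('a, 'm) ring_scheme \<Rightarrow> bool"
  where "noetherian_local R \<longleftrightarrow>
    cring R \<and> noetherian_ring R \<and> (\<exists>!M. maximalideal M R)"

definition the_maximal :: "('a, 'm) ring_scheme \<Rightarrow> 'a set"
  where "the_maximal R = (THE M. maximalideal M R)"

definition radical_of :: "('a, 'm) ring_scheme \<Rightarrow> 'a set \<Rightarrow> 'a set"
  where "radical_of R I = {r \<in> carrier R. \<exists>n::nat. r [^]\<^bsub>R\<^esub> n \<in> I}"

definition system_of_parameters :: "('a, 'm) ring_scheme \<Rightarrow> 'a list \<Rightarrow> bool"
  where "system_of_parameters R xs \<longleftrightarrow>
    set xs \<subseteq> the_maximal R \<and> enat (length xs) = krull_dim R \<and>
    radical_of R (genideal R (set xs)) = the_maximal R"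

definition parameter_ideal :: "('a, 'm) ring_scheme \<Rightarrow> 'a set \<Rightarrow> bool"
  where "parameter_ideal R I \<longleftrightarrow>
    (\<exists>xs. system_of_parameters R xs \<and> I = genideal R (set xs))"

definition regular_sequence :: "('a, 'm) ring_scheme \<Rightarrow> 'a list \<Rightarrow> bool"
  where "regular_sequence R xs \<longleftrightarrow>
    set xs \<subseteq> carrier R \<and> genideal R (set xs) \<noteq> carrier R \<and>
    (\<forall>i<length xs. \<forall>r\<in>carrier R.
       xs ! i \<otimes>\<^bsub>R\<^esub> r \<in> genideal R (set (take i xs)) \<longrightarrow>
       r \<in> genideal R (set (take i xs)))"

definition depth :: "('a, 'm) ring_scheme \<Rightarrow> enat"
  where "depth R =
    Sup {enat (length xs) | xs. regular_sequence R xs \<and> set xs \<subseteq> the_maximal R}"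

definition cohen_macaulay_local :: "('a, 'm) ring_scheme \<Rightarrow> bool"
  where "cohen_macaulay_local R \<longleftrightarrow> noetherian_local R \<and> depth R = krull_dim R"

definition cohen_macaulay :: "('a, 'm) ring_scheme \<Rightarrow> bool"
  where "cohen_macaulay S \<longleftrightarrow>
    cring S \<and> noetherian_ring S \<and>
    (\<forall>M. maximalideal M S \<longrightarrow> cohen_macaulay_local (loc_at S M))"


section \<open>Gorenstein rings\<close>

definition module_homs ::
    "('r, 'k) ring_scheme \<Rightarrow> ('r, 'm, 'x) module_scheme \<Rightarrow> ('r, 'n, 'y) module_scheme \<Rightarrow> ('m \<Rightarrow> 'n) set"
  where "module_homs R M N =
    {f \<in> carrier M \<rightarrow> carrier N.
       (\<forall>x\<in>carrier M. \<forall>y\<in>carrier M. f (x \<oplus>\<^bsub>M\<^esub> y) = f x \<oplus>\<^bsub>N\<^esub> f y) \<and>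
       (\<forall>r\<in>carrier R. \<forall>x\<in>carrier M. f (r \<odot>\<^bsub>M\<^esub> x) = r \<odot>\<^bsub>N\<^esub> f x)}"

definition ring_as_module :: "('r, 'k) ring_scheme \<Rightarrow> ('r, 'r) module"
  where "ring_as_module R = \<lparr> carrier = carrier R, monoid.mult = monoid.mult R, monoid.one = monoid.one R,
    ring.zero = ring.zero R, ring.add = ring.add R, module.smult = monoid.mult R \<rparr>"

text \<open>
  HOL cannot quantify over the modules on all types, so modules over a ring on the type \<open>'r\<close> are
  taken on the type \<open>'r list\<close>. This loses nothing: the ideals of the ring have copies on that type,
  so by Baer's criterion the extension property below is injectivity with respect to all
  modules; and over a Noetherian ring every term of the minimal injective resolution of the ring
  has at most as many elements as \<open>'r list\<close>.
\<close>

definition injective_module :: "('r, 'k) ring_scheme \<Rightarrow> ('r, 'r list) module \<Rightarrow> bool"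
  where "injective_module R E \<longleftrightarrow> module R E \<and>
    (\<forall>(A :: ('r, 'r list) module) (B :: ('r, 'r list) module) f g.
       module R A \<and> module R B \<and>
       f \<in> module_homs R A B \<and> inj_on f (carrier A) \<and> g \<in> module_homs R A E \<longrightarrow>
       (\<exists>h \<in> module_homs R B E. \<forall>x\<in>carrier A. h (f x) = g x))"

definition injective_resolution ::
    "('r, 'k) ring_scheme \<Rightarrow> ('r, 'm) module \<Rightarrow> (nat \<Rightarrow> ('r, 'r list) module) \<Rightarrow>
     ('m \<Rightarrow> 'r list) \<Rightarrow> (nat \<Rightarrow> 'r list \<Rightarrow> 'r list) \<Rightarrow> bool"
  where "injective_resolution R M E \<iota> d \<longleftrightarrow>
    (\<forall>i. injective_module R (E i)) \<and>
    \<iota> \<in> module_homs R M (E 0) \<and> inj_on \<iota> (carrier M) \<and>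
    (\<forall>i. d i \<in> module_homs R (E i) (E (Suc i))) \<and>
    \<iota> ` carrier M = a_kernel (E 0) (E 1) (d 0) \<and>
    (\<forall>i. d i ` carrier (E i) = a_kernel (E (Suc i)) (E (Suc (Suc i))) (d (Suc i)))"

definition finite_injective_dimension :: "('r, 'k) ring_scheme \<Rightarrow> ('r, 'm) module \<Rightarrow> bool"
  where "finite_injective_dimension R M \<longleftrightarrow>
    (\<exists>E \<iota> d n. injective_resolution R M E \<iota> d \<and> (\<forall>i>n. carrier (E i) = {\<zero>\<^bsub>E i\<^esub>}))"

definition gorenstein_local :: "('r, 'k) ring_scheme \<Rightarrow> bool"
  where "gorenstein_local R \<longleftrightarrow>
    noetherian_local R \<and> finite_injective_dimension R (ring_as_module R)"

definition generically_gorenstein :: "('a, 'm) ring_scheme \<Rightarrow> bool"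
  where "generically_gorenstein S \<longleftrightarrow>
    (\<forall>P. minimal_prime P S \<longrightarrow> gorenstein_local (loc_at S P))"


section \<open>Local cohomology and its Frobenius map\<close>

text \<open>
  Local cohomology is the cohomology of the Cech complex
  \<open>0 \<rightarrow> S \<rightarrow> \<Oplus>\<^sub>i S\<^bsub>x\<^sub>i\<^esub> \<rightarrow> \<Oplus>\<^bsub>i<j\<^esub> S\<^bsub>x\<^sub>i x\<^sub>j\<^esub> \<rightarrow> \<dots>\<close> on a list \<open>xs\<close> of generators of the ideal. For a set \<open>A\<close> of
  positions, \<open>S\<close> localised at the product of the \<open>x\<^sub>i\<close> with \<open>i \<in> A\<close> is realised by inverting all
  monomials in these \<open>x\<^sub>i\<close>, which makes the denominators grow with \<open>A\<close>.
\<close>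

definition cech_denoms :: "('a, 'm) ring_scheme \<Rightarrow> 'a list \<Rightarrow> nat set \<Rightarrow> 'a set"
  where "cech_denoms S xs A = {finprod S (\<lambda>i. xs ! i [^]\<^bsub>S\<^esub> k i) A | k :: nat \<Rightarrow> nat. True}"

definition cech_ring :: "('a, 'm) ring_scheme \<Rightarrow> 'a list \<Rightarrow> nat set \<Rightarrow> ('a \<times> 'a) set ring"
  where "cech_ring S xs A = localization S (cech_denoms S xs A)"

definition cech_index :: "'a list \<Rightarrow> nat \<Rightarrow> nat set set"
  where "cech_index xs i = {A. A \<subseteq> {..<length xs} \<and> card A = i}"

text \<open>The fields \<open>mult\<close> and \<open>one\<close> of a module record have no meaning for a module.\<close>

definition cech_module ::
    "('a, 'm) ring_scheme \<Rightarrow> 'a list \<Rightarrow> nat \<Rightarrow> ('a, nat set \<Rightarrow> ('a \<times> 'a) set) module"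
  where "cech_module S xs i = \<lparr>
    carrier = (\<Pi>\<^sub>E A\<in>cech_index xs i. carrier (cech_ring S xs A)),
    monoid.mult = undefined,
    monoid.one = undefined,
    ring.zero = (\<lambda>A\<in>cech_index xs i. \<zero>\<^bsub>cech_ring S xs A\<^esub>),
    ring.add = (\<lambda>c c'. \<lambda>A\<in>cech_index xs i. c A \<oplus>\<^bsub>cech_ring S xs A\<^esub> c' A),
    module.smult = (\<lambda>a c. \<lambda>A\<in>cech_index xs i.
      loc_frac S (cech_denoms S xs A) a \<one>\<^bsub>S\<^esub> \<otimes>\<^bsub>cech_ring S xs A\<^esub> c A) \<rparr>"

definition cech_diff ::
    "('a, 'm) ring_scheme \<Rightarrow> 'a list \<Rightarrow> nat \<Rightarrow>
     (nat set \<Rightarrow> ('a \<times> 'a) set) \<Rightarrow> nat set \<Rightarrow> ('a \<times> 'a) set"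
  where "cech_diff S xs i c = (\<lambda>A\<in>cech_index xs (Suc i).
    finsum (cech_ring S xs A)
      (\<lambda>j. let y = loc_map S (cech_denoms S xs A) (c (A - {j})) in
           if even (card {k \<in> A. k < j}) then y else \<ominus>\<^bsub>cech_ring S xs A\<^esub> y) A)"

definition cech_cocycles ::
    "('a, 'm) ring_scheme \<Rightarrow> 'a list \<Rightarrow> nat \<Rightarrow> (nat set \<Rightarrow> ('a \<times> 'a) set) set"
  where "cech_cocycles S xs i =
    a_kernel (cech_module S xs i) (cech_module S xs (Suc i)) (cech_diff S xs i)"

definition cech_coboundaries ::
    "('a, 'm) ring_scheme \<Rightarrow> 'a list \<Rightarrow> nat \<Rightarrow> (nat set \<Rightarrow> ('a \<times> 'a) set) set"
  where "cech_coboundaries S xs i =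
    (case i of 0 \<Rightarrow> {\<zero>\<^bsub>cech_module S xs 0\<^esub>}
     | Suc j \<Rightarrow> cech_diff S xs j ` carrier (cech_module S xs j))"

definition cech_class ::
    "('a, 'm) ring_scheme \<Rightarrow> 'a list \<Rightarrow> nat \<Rightarrow>
     (nat set \<Rightarrow> ('a \<times> 'a) set) \<Rightarrow> (nat set \<Rightarrow> ('a \<times> 'a) set) set"
  where "cech_class S xs i c = cech_coboundaries S xs i +>\<^bsub>cech_module S xs i\<^esub> c"

definition cech_cohomology ::
    "('a, 'm) ring_scheme \<Rightarrow> 'a list \<Rightarrow> nat \<Rightarrow> ('a, (nat set \<Rightarrow> ('a \<times> 'a) set) set) module"
  where "cech_cohomology S xs i = \<lparr>
    carrier = cech_class S xs i ` cech_cocycles S xs i,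
    monoid.mult = undefined,
    monoid.one = undefined,
    ring.zero = cech_coboundaries S xs i,
    ring.add = set_add (cech_module S xs i),
    module.smult = (\<lambda>a U. \<Union>c\<in>U. cech_class S xs i (a \<odot>\<^bsub>cech_module S xs i\<^esub> c)) \<rparr>"

text \<open>
  On \<open>S\<^sub>A\<close> the map \<open>S \<rightarrow> F\<^sub>* S\<close> induces \<open>a/s \<mapsto> a\<^sup>p/s\<close> into \<open>(F\<^sub>* S)\<^sub>A\<close>, which is identified with
  \<open>F\<^sub>* (S\<^sub>A)\<close> by \<open>b/s \<mapsto> b/s\<^sup>p\<close>. So the natural Frobenius map takes every component of a
  cochain to its \<open>p\<close>-th power.
\<close>

definition cech_frobenius ::
    "('a, 'm) ring_scheme \<Rightarrow> nat \<Rightarrow> 'a list \<Rightarrow> nat \<Rightarrow>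
     (nat set \<Rightarrow> ('a \<times> 'a) set) set \<Rightarrow> (nat set \<Rightarrow> ('a \<times> 'a) set) set"
  where "cech_frobenius S p xs i U =
    (\<Union>c\<in>U. cech_class S xs i (\<lambda>A\<in>cech_index xs i. c A [^]\<^bsub>cech_ring S xs A\<^esub> p))"

text \<open>
  Up to an isomorphism compatible with the Frobenius maps, the cohomology does not depend on the
  generators, so any list of generators may be chosen. One exists when \<open>S\<close> is Noetherian.
\<close>

definition ideal_gens :: "('a, 'm) ring_scheme \<Rightarrow> 'a set \<Rightarrow> 'a list"
  where "ideal_gens S I = (SOME xs. set xs \<subseteq> carrier S \<and> genideal S (set xs) = I)"

definition local_cohomology ::
    "('a, 'm) ring_scheme \<Rightarrow> 'a set \<Rightarrow> nat \<Rightarrow> ('a, (nat set \<Rightarrow> ('a \<times> 'a) set) set) module"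
  where "local_cohomology S I i = cech_cohomology S (ideal_gens S I) i"

definition local_cohomology_frobenius ::
    "('a, 'm) ring_scheme \<Rightarrow> nat \<Rightarrow> 'a set \<Rightarrow> nat \<Rightarrow>
     (nat set \<Rightarrow> ('a \<times> 'a) set) set \<Rightarrow> (nat set \<Rightarrow> ('a \<times> 'a) set) set"
  where "local_cohomology_frobenius S p I i = cech_frobenius S p (ideal_gens S I) i"

definition nil_part :: "('r, 'm, 'x) module_scheme \<Rightarrow> ('m \<Rightarrow> 'm) \<Rightarrow> 'm set"
  where "nil_part M \<theta> = (\<Union>i::nat. {x \<in> carrier M. (\<theta> ^^ i) x = \<zero>\<^bsub>M\<^esub>})"

text \<open>The value is \<open>\<infinity>\<close> if no power of \<open>\<theta>\<close> kills \<open>nil_part M \<theta>\<close>.\<close>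

definition HSL :: "('r, 'm, 'x) module_scheme \<Rightarrow> ('m \<Rightarrow> 'm) \<Rightarrow> enat"
  where "HSL M \<theta> = Inf {enat e | e. \<forall>x\<in>nil_part M \<theta>. (\<theta> ^^ e) x = \<zero>\<^bsub>M\<^esub>}"

text \<open>The local rings of a Noetherian ring have finite dimension, so \<open>the_enat\<close> is harmless.\<close>

definition HSL_top :: "('a, 'm) ring_scheme \<Rightarrow> nat \<Rightarrow> 'a set \<Rightarrow> enat"
  where "HSL_top S p M =
    (let d = the_enat (krull_dim (loc_at S M))
     in HSL (local_cohomology S M d) (local_cohomology_frobenius S p M d))"


section \<open>Frobenius powers and Frobenius closure\<close>

definition frobenius_power :: "('a, 'm) ring_scheme \<Rightarrow> nat \<Rightarrow> nat \<Rightarrow> 'a set \<Rightarrow> 'a set"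
  where "frobenius_power S p e J = genideal S ((\<lambda>a. a [^]\<^bsub>S\<^esub> (p ^ e)) ` J)"

definition frobenius_closure :: "('a, 'm) ring_scheme \<Rightarrow> nat \<Rightarrow> 'a set \<Rightarrow> 'a set"
  where "frobenius_closure S p J =
    {a \<in> carrier S. \<exists>e>0. a [^]\<^bsub>S\<^esub> (p ^ e) \<in> frobenius_power S p e J}"


section \<open>Polynomial rings\<close>

text \<open>
  The polynomial ring over a field \<open>'k\<close> in variables indexed by \<open>'v\<close>: an exponent vector is a
  finitely supported function \<open>'v \<Rightarrow>\<^sub>0 nat\<close>, a polynomial a finitely supported family of
  coefficients, and the multiplication is convolution.
\<close>

abbreviation polynomial_ring :: "(('v \<Rightarrow>\<^sub>0 nat) \<Rightarrow>\<^sub>0 'k :: field) ring"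
  where "polynomial_ring \<equiv> ring_of_type_algebra"

end

theory Submission
  imports Defs
begin

text \<open>
  Membership in an ideal is local, so let \<open>R\<close> be the local ring at a maximal ideal \<open>M\<close> containing
  \<open>J\<close>, of dimension \<open>d\<close>, with \<open>J\<close> generated in \<open>R\<close> by parameters \<open>y\<^sub>1, \<dots>, y\<^sub>d\<close>, and let \<open>x\<close> be the
  generators of \<open>M\<close> that define the Cech complex. Since \<open>R\<close> has a regular sequence of length \<open>d\<close>,
  the Koszul cohomology of every list that generates an ideal with radical \<open>M\<close> vanishes below
  degree \<open>d\<close>. Hence restriction from the Koszul complex on \<open>(x\<^sup>N, y)\<close> to the one on \<open>x\<^sup>N\<close>
  or on \<open>y\<close> is injective in degree \<open>d\<close>, and remains so for all powers of the elements. If \<open>x\<^sup>N\<close>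
  lies in \<open>(y)\<close>, every \<open>a \<in> R\<close>, seen as a cochain of top degree on \<open>y\<close>, extends to a cocycle \<open>f\<close> on
  \<open>(x\<^sup>N, y)\<close>. For \<open>q = p\<^sup>e\<close> the \<open>q\<close>-th power of \<open>f\<close> is a coboundary on \<open>y\<^sup>q\<close> exactly if \<open>a\<^sup>q\<close> lies in the
  Frobenius power \<open>(y\<^sup>q)\<close>, and by injectivity this can be tested on the \<open>x\<close>-part, that is, on the
  class of \<open>f / x\<^sup>N\<close> in local cohomology. So \<open>a\<close> is in the Frobenius closure only if this class is
  nilpotent, and then \<open>p\<^sup>\<epsilon>\<close> suffices.
\<close>

section \<open>Koszul cochains\<close>

text \<open>The bound on nilpotency lives on a Cech complex over \<open>S\<close>, while depth and
  parameters live in the local ring, and the parameters are unrelated to the chosen generators of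
  the maximal ideal. Raising cochains to the power q maps the Koszul complex on w to the one on w^q,
  so everything is stated at finite Koszul stages, the Cech complex being their limit along
  multiplication by monomials. Restriction is injective because a Koszul complex with one more
  coefficient is a mapping cone: the kernel in degree d is a quotient of the cohomology in degree d
  - 1, which vanishes. Extension from y to (x^N, y) is possible because the obstruction is x_j^N
  times the class, and the ideal (y) kills the Koszul cohomology on y. N and f are fixed before q:
  the q-th power of an extension is again an extension. Hence one f serves both for the exponent
  that witnesses nilpotency and for the exponent \<epsilon>. The additional exponent m in later
  statements records that vanishing in the limit means vanishing after some transition map; passing
  from x^(Nq) to x^(Nq+m) preserves the radical up to which the coefficients generate, so the
  vanishing below degree d persists.\<close>

text \<open>
  Cochains are functions on all sets of indices; the degree is the cardinality, and the values on
  other sets than the relevant ones are irrelevant. An ideal \<open>\<aa>\<close> stands for coefficients in \<open>R/\<aa>\<close>.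
  In degree \<open>0\<close> only \<open>0\<close> is a boundary, because \<open>kdiff\<close> is an empty sum on \<open>{}\<close>.
\<close>

definition signed :: "('a, 'm) ring_scheme \<Rightarrow> nat \<Rightarrow> 'a \<Rightarrow> 'a"
  where "signed R n y = (if even n then y else \<ominus>\<^bsub>R\<^esub> y)"

definition pos :: "nat \<Rightarrow> nat set \<Rightarrow> nat"
  where "pos j A = card {k \<in> A. k < j}"

definition kdiff :: "('a, 'm) ring_scheme \<Rightarrow> (nat \<Rightarrow> 'a) \<Rightarrow> (nat set \<Rightarrow> 'a) \<Rightarrow> nat set \<Rightarrow> 'a"
  where "kdiff R w f B = finsum R (\<lambda>j. signed R (pos j B) (w j \<otimes>\<^bsub>R\<^esub> f (B - {j}))) B"

definition kcocycle ::
    "('a, 'm) ring_scheme \<Rightarrow> (nat \<Rightarrow> 'a) \<Rightarrow> 'a set \<Rightarrow> nat set \<Rightarrow> nat \<Rightarrow> (nat set \<Rightarrow> 'a) \<Rightarrow> bool"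
  where "kcocycle R w \<aa> I i f \<longleftrightarrow> (\<forall>B\<subseteq>I. card B = Suc i \<longrightarrow> kdiff R w f B \<in> \<aa>)"

definition kboundary ::
    "('a, 'm) ring_scheme \<Rightarrow> (nat \<Rightarrow> 'a) \<Rightarrow> 'a set \<Rightarrow> nat set \<Rightarrow> nat \<Rightarrow> (nat set \<Rightarrow> 'a) \<Rightarrow> bool"
  where "kboundary R w \<aa> I i f \<longleftrightarrow>
    (\<exists>g. (\<forall>A. g A \<in> carrier R) \<and> (\<forall>A\<subseteq>I. card A = i \<longrightarrow> f A \<ominus>\<^bsub>R\<^esub> kdiff R w g A \<in> \<aa>))"

definition kexact :: "('a, 'm) ring_scheme \<Rightarrow> (nat \<Rightarrow> 'a) \<Rightarrow> 'a set \<Rightarrow> nat set \<Rightarrow> nat \<Rightarrow> bool"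
  where "kexact R w \<aa> I i \<longleftrightarrow>
    (\<forall>f. (\<forall>A. f A \<in> carrier R) \<and> kcocycle R w \<aa> I i f \<longrightarrow> kboundary R w \<aa> I i f)"

text \<open>Interior product with the \<open>j\<close>-th basis vector: the homotopy showing that
  \<open>w j\<close> acts as zero on Koszul cohomology. The value zero on sets containing
  \<open>j\<close> makes its square vanish.\<close>

definition contr :: "('a, 'm) ring_scheme \<Rightarrow> nat \<Rightarrow> (nat set \<Rightarrow> 'a) \<Rightarrow> nat set \<Rightarrow> 'a"
  where "contr R j f A = (if j \<in> A then \<zero>\<^bsub>R\<^esub> else signed R (pos j A) (f (insert j A)))"

lemma kboundaryE:
  assumes "kboundary R w \<aa> I i f"
  obtains g where "\<And>A. g A \<in> carrier R"
    "\<And>A. \<lbrakk>A \<subseteq> I; card A = i\<rbrakk> \<Longrightarrow> f A \<ominus>\<^bsub>R\<^esub> kdiff R w g A \<in> \<aa>"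
  using assms unfolding kboundary_def by blast

lemma kboundaryI:
  assumes "\<And>A. g A \<in> carrier R"
    "\<And>A. \<lbrakk>A \<subseteq> I; card A = i\<rbrakk> \<Longrightarrow> f A \<ominus>\<^bsub>R\<^esub> kdiff R w g A \<in> \<aa>"
  shows "kboundary R w \<aa> I i f"
  using assms unfolding kboundary_def by blast

lemma pos_insert_self [simp]: "pos j (insert j A) = pos j A"
  unfolding pos_def by (rule arg_cong[where f = card]) auto

lemma pos_insert:
  assumes "finite A" "j \<notin> A"
  shows "pos k (insert j A) = pos k A + (if j < k then 1 else 0)"
proof -
  have "{i \<in> insert j A. i < k} = (if j < k then insert j {i \<in> A. i < k} else {i \<in> A. i < k})"
    by auto
  then show ?thesis using assms by (simp add: pos_def)
qed

context ring
begin

lemma signed_closed [simp]: "y \<in> carrier R \<Longrightarrow> signed R n y \<in> carrier R"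
  by (simp add: signed_def)

lemma signed_signed: "y \<in> carrier R \<Longrightarrow> signed R m (signed R n y) = signed R (m + n) y"
  by (simp add: signed_def)

lemma signed_invol [simp]: "y \<in> carrier R \<Longrightarrow> signed R n (signed R n y) = y"
  by (simp add: signed_signed) (simp add: signed_def)

lemma signed_add: "\<lbrakk>x \<in> carrier R; y \<in> carrier R\<rbrakk> \<Longrightarrow> signed R n (x \<oplus> y) = signed R n x \<oplus> signed R n y"
  by (simp add: signed_def minus_add)

lemma signed_minus: "y \<in> carrier R \<Longrightarrow> signed R n (\<ominus> y) = \<ominus> signed R n y"
  by (simp add: signed_def)

lemma signed_Suc: "y \<in> carrier R \<Longrightarrow> signed R (Suc n) y = \<ominus> signed R n y"
  by (simp add: signed_def)

lemma signed_zero [simp]: "signed R n \<zero> = \<zero>"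
  by (simp add: signed_def)

lemma signed_r: "\<lbrakk>x \<in> carrier R; y \<in> carrier R\<rbrakk> \<Longrightarrow> x \<otimes> signed R n y = signed R n (x \<otimes> y)"
  by (simp add: signed_def r_minus)

lemma signed_mem: "\<lbrakk>ideal I R; y \<in> carrier R; signed R n y \<in> I\<rbrakk> \<Longrightarrow> y \<in> I"
  by (metis signed_def additive_subgroup.a_inv_closed ideal.axioms(1) minus_minus)

lemma signed_in: "\<lbrakk>ideal I R; y \<in> I\<rbrakk> \<Longrightarrow> signed R n y \<in> I"
  by (simp add: signed_def additive_subgroup.a_inv_closed ideal.axioms(1))

lemma finsum_signed:
  assumes "finite A" "\<And>a. a \<in> A \<Longrightarrow> f a \<in> carrier R"
  shows "signed R n (finsum R f A) = finsum R (\<lambda>a. signed R n (f a)) A"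
  using assms
proof (induction A)
  case (insert x F)
  then show ?case by (subst (1 2) finsum_insert) (auto simp: signed_add intro!: finsum_closed)
qed simp

lemma kdiff_closed [simp]:
  assumes "\<And>j. w j \<in> carrier R" "\<And>A. f A \<in> carrier R"
  shows "kdiff R w f B \<in> carrier R"
  unfolding kdiff_def using assms by (intro finsum_closed) auto

lemma kdiff_empty [simp]: "kdiff R w f {} = \<zero>"
  by (simp add: kdiff_def)

lemma kdiff_cong:
  assumes "\<And>j. w j \<in> carrier R" "\<And>A. f A \<in> carrier R"
    and "\<And>j. j \<in> B \<Longrightarrow> f (B - {j}) = g (B - {j})"
  shows "kdiff R w f B = kdiff R w g B"
  unfolding kdiff_def using assms(1,2) by (intro finsum_cong') (auto simp: assms(3)[symmetric])

lemma contr_closed [simp]: "(\<And>A. f A \<in> carrier R) \<Longrightarrow> contr R j f A \<in> carrier R"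
  by (simp add: contr_def)

end

section \<open>Linearity of the differential, the contraction homotopy and annihilators of
  cohomology\<close>

context cring
begin

lemma kdiff_add:
  assumes "\<And>j. w j \<in> carrier R" "\<And>A. f A \<in> carrier R" "\<And>A. g A \<in> carrier R"
  shows "kdiff R w (\<lambda>A. f A \<oplus> g A) B = kdiff R w f B \<oplus> kdiff R w g B"
  unfolding kdiff_def using assms
  by (subst finsum_addf[symmetric]) (auto intro!: finsum_cong' simp: r_distr signed_add)

lemma kdiff_smult:
  assumes "\<And>j. w j \<in> carrier R" "\<And>A. f A \<in> carrier R" "c \<in> carrier R" "finite B"
  shows "kdiff R w (\<lambda>A. c \<otimes> f A) B = c \<otimes> kdiff R w f B"
  unfolding kdiff_def using assms
  by (subst finsum_rdistr) (auto intro!: finsum_cong' simp: signed_r m_lcomm)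

lemma kdiff_minus:
  assumes "\<And>j. w j \<in> carrier R" "\<And>A. f A \<in> carrier R" "finite B"
  shows "kdiff R w (\<lambda>A. \<ominus> f A) B = \<ominus> kdiff R w f B"
proof -
  have "kdiff R w (\<lambda>A. (\<ominus> \<one>) \<otimes> f A) B = (\<ominus> \<one>) \<otimes> kdiff R w f B"
    using assms by (intro kdiff_smult) auto
  then show ?thesis using assms by (simp add: l_minus)
qed

lemma kdiff_diff:
  assumes "\<And>j. w j \<in> carrier R" "\<And>A. f A \<in> carrier R" "\<And>A. g A \<in> carrier R" "finite B"
  shows "kdiff R w (\<lambda>A. f A \<ominus> g A) B = kdiff R w f B \<ominus> kdiff R w g B"
  unfolding a_minus_def using assms by (simp add: kdiff_add kdiff_minus)

lemma kdiff_zero: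
  assumes "\<And>j. w j \<in> carrier R" "\<And>A. A \<subseteq> B \<Longrightarrow> f A = \<zero>"
  shows "kdiff R w f B = \<zero>"
proof -
  have "kdiff R w f B = finsum R (\<lambda>j. \<zero>) B"
    unfolding kdiff_def using assms by (intro finsum_cong') auto
  then show ?thesis by simp
qed

text \<open>The identity \<open>d h + h d = w\<^sub>j\<close> for the contraction \<open>h\<close> along \<open>j\<close>.\<close>

lemma kdiff_insert:
  assumes w: "\<And>j. w j \<in> carrier R" and f: "\<And>A. f A \<in> carrier R" and A: "finite A" "j \<notin> A"
  shows "kdiff R w f (insert j A) = signed R (pos j A) (w j \<otimes> f A \<ominus> kdiff R w (contr R j f) A)"
proof -
  let ?t = "\<lambda>k. signed R (pos k (insert j A)) (w k \<otimes> f (insert j A - {k}))"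
  have "kdiff R w f (insert j A) = ?t j \<oplus> finsum R ?t A"
    unfolding kdiff_def using w f A by (intro finsum_insert) auto
  moreover have "insert j A - {j} = A" using A by auto
  moreover have "finsum R ?t A = signed R (pos j A) (\<ominus> kdiff R w (contr R j f) A)"
  proof -
    have "?t k = signed R (Suc (pos j A)) (signed R (pos k A) (w k \<otimes> contr R j f (A - {k})))"
      if k: "k \<in> A" for k
    proof -
      have jk: "j \<noteq> k" using k A by auto
      have e1: "insert j A - {k} = insert j (A - {k})" using jk by auto
      have "pos j (insert k (A - {k})) = pos j (A - {k}) + (if k < j then 1 else 0)"
        using A by (intro pos_insert) auto
      then have e2: "pos j A = pos j (A - {k}) + (if k < j then 1 else 0)"
        using k by (simp add: insert_absorb)
      have e3: "pos k (insert j A) = pos k A + (if j < k then 1 else 0)"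
        using A by (rule pos_insert)
      have e4: "contr R j f (A - {k}) = signed R (pos j (A - {k})) (f (insert j (A - {k})))"
        using A by (simp add: contr_def)
      \<comment> \<open>As j and k differ, exactly one of j < k and k < j holds. One side counts the
        first case and the other the second, so the parities differ by one; this is the minus sign
        in front of the contracted term.\<close>
      have par: "even (pos k (insert j A)) = even (Suc (pos j A) + (pos k A + pos j (A - {k})))"
        unfolding e2 e3 using jk by auto
      show ?thesis
        unfolding e1 e4 using w f
        by (simp add: signed_r signed_signed m_closed) (simp add: signed_def par)
    qed
    then have "finsum R ?t A =
        finsum R (\<lambda>k. signed R (Suc (pos j A)) (signed R (pos k A) (w k \<otimes> contr R j f (A - {k})))) A"
      using w f by (intro finsum_cong') auto
    also have "\<dots> = signed R (Suc (pos j A)) (kdiff R w (contr R j f) A)"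
      unfolding kdiff_def using w f A by (intro finsum_signed[symmetric]) auto
    also have "\<dots> = signed R (pos j A) (\<ominus> kdiff R w (contr R j f) A)"
      using w f by (simp add: signed_Suc signed_minus)
    finally show ?thesis .
  qed
  ultimately have "kdiff R w f (insert j A)
      = signed R (pos j A) (w j \<otimes> f A) \<oplus> signed R (pos j A) (\<ominus> kdiff R w (contr R j f) A)"
    by simp
  then show ?thesis using w f by (simp only: a_minus_def) (subst signed_add, auto)
qed

lemma contr_kdiff:
  assumes w: "\<And>j. w j \<in> carrier R" and f: "\<And>A. f A \<in> carrier R" and A: "finite A" "j \<notin> A"
  shows "contr R j (kdiff R w f) A = w j \<otimes> f A \<ominus> kdiff R w (contr R j f) A"
  using A by (simp add: contr_def kdiff_insert[OF w f] w f)

text \<open>Induction on the set, removing an index j. The homotopy identity rewrites the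
  contraction of d f as w_j f - d h f; applying d kills the second term by induction, for the
  cochain h f instead of f, and the first cancels against w_j d f.\<close>

lemma kdiff_kdiff:
  assumes w: "\<And>j. w j \<in> carrier R" and f: "\<And>A. f A \<in> carrier R" and B: "finite B"
  shows "kdiff R w (kdiff R w f) B = \<zero>"
  using B f
proof (induction B arbitrary: f)
  case (insert j A)
  note f = insert.prems
  have "kdiff R w (contr R j (kdiff R w f)) A
      = kdiff R w (\<lambda>C. w j \<otimes> f C \<ominus> kdiff R w (contr R j f) C) A"
  proof (rule kdiff_cong)
    fix k assume "k \<in> A"
    show "contr R j (kdiff R w f) (A - {k})
        = w j \<otimes> f (A - {k}) \<ominus> kdiff R w (contr R j f) (A - {k})"
      using insert.hyps w f by (intro contr_kdiff) auto
  qed (use w f in auto)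
  also have "\<dots> = w j \<otimes> kdiff R w f A \<ominus> kdiff R w (kdiff R w (contr R j f)) A"
    using w f insert.hyps by (subst kdiff_diff) (auto simp: kdiff_smult)
  also have "\<dots> = w j \<otimes> kdiff R w f A"
    using insert.IH[of "contr R j f"] w f by (simp add: a_minus_def)
  finally show ?case
    using w f insert.hyps by (subst kdiff_insert) (auto simp: a_minus_def r_neg)
qed simp

text \<open>The contraction of the cocycle is the primitive. On sets without \<open>j\<close> this
  is the homotopy identity together with the cocycle condition on \<open>insert j A\<close>; on sets
  with \<open>j\<close> it holds because contracting twice gives zero.\<close>

lemma kboundary_w:
  assumes w: "\<And>j. w j \<in> carrier R" and f: "\<And>A. f A \<in> carrier R"
    and I: "finite I" "j \<in> I" and a: "ideal \<aa> R" and cyc: "kcocycle R w \<aa> I i f"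
  shows "kboundary R w \<aa> I i (\<lambda>A. w j \<otimes> f A)"
proof -
  have "w j \<otimes> f A \<ominus> kdiff R w (contr R j f) A \<in> \<aa>" if A: "A \<subseteq> I" "card A = i" for A
  proof (cases "j \<in> A")
    case True
    then obtain C where C: "A = insert j C" "j \<notin> C" by (meson mk_disjoint_insert)
    have fin: "finite C" using A(1) I(1) C(1) finite_subset by auto
    \<comment> \<open>No subset of \<open>C\<close> contains j, so the outer contraction always
      evaluates the inner one on a set that does contain j.\<close>
    have "kdiff R w (contr R j (contr R j f)) C = \<zero>"
      using w by (intro kdiff_zero) (auto simp: contr_def)
    then have "kdiff R w (contr R j f) A = signed R (pos j C) (w j \<otimes> contr R j f C)"
      unfolding C(1) using w f fin C(2) by (subst kdiff_insert) (auto simp: a_minus_def)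
    also have "\<dots> = w j \<otimes> f A" using C w f by (simp add: contr_def signed_r)
    finally show ?thesis
      using w f additive_subgroup.zero_closed[OF ideal.axioms(1)[OF a]] by (simp add: a_minus_def r_neg)
  next
    case False
    have fin: "finite A" using A(1) I(1) finite_subset by auto
    have "kdiff R w f (insert j A) \<in> \<aa>"
      using cyc[unfolded kcocycle_def, rule_format, of "insert j A"] A I(2) False fin by simp
    then have "signed R (pos j A) (w j \<otimes> f A \<ominus> kdiff R w (contr R j f) A) \<in> \<aa>"
      using w f fin False by (simp add: kdiff_insert)
    moreover have "w j \<otimes> f A \<ominus> kdiff R w (contr R j f) A \<in> carrier R" using w f by simp
    ultimately show ?thesis using signed_mem[OF a] by blast
  qed
  moreover have "contr R j f A \<in> carrier R" for A using f by auto
  ultimately show ?thesis unfolding kboundary_def by blast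
qed

text \<open>The ring elements that kill the class of f form an ideal, and \<open>kboundary_w\<close>
  puts the generators into it.\<close>

lemma kboundary_genideal:
  assumes w: "\<And>j. w j \<in> carrier R" and f: "\<And>A. f A \<in> carrier R"
    and I: "finite I" and r: "r \<in> genideal R (w ` I)" and a: "ideal \<aa> R" and cyc: "kcocycle R w \<aa> I i f"
  shows "kboundary R w \<aa> I i (\<lambda>A. r \<otimes> f A)"
proof -
  interpret A: ideal \<aa> R by (rule a)
  let ?K = "{r \<in> carrier R. kboundary R w \<aa> I i (\<lambda>A. r \<otimes> f A)}"
  have "ideal ?K R"
  proof (rule idealI)
    show "ring R" by unfold_locales
    show "subgroup ?K (add_monoid R)"
    proof (rule add.subgroupI)
      have "kboundary R w \<aa> I i (\<lambda>A. \<zero> \<otimes> f A)"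
        using f w A.zero_closed by (intro kboundaryI[of "\<lambda>A. \<zero>"]) (auto simp: kdiff_zero a_minus_def)
      then show "?K \<noteq> {}" using zero_closed by blast
    next
      fix x y assume x: "x \<in> ?K" and y: "y \<in> ?K"
      from x have "kboundary R w \<aa> I i (\<lambda>A. x \<otimes> f A)" by simp
      then obtain g where g: "\<And>A. g A \<in> carrier R"
        "\<And>A. \<lbrakk>A \<subseteq> I; card A = i\<rbrakk> \<Longrightarrow> x \<otimes> f A \<ominus> kdiff R w g A \<in> \<aa>"
        by (rule kboundaryE) blast
      from y have "kboundary R w \<aa> I i (\<lambda>A. y \<otimes> f A)" by simp
      then obtain h where h: "\<And>A. h A \<in> carrier R"
        "\<And>A. \<lbrakk>A \<subseteq> I; card A = i\<rbrakk> \<Longrightarrow> y \<otimes> f A \<ominus> kdiff R w h A \<in> \<aa>"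
        by (rule kboundaryE) blast
      have xy: "x \<in> carrier R" "y \<in> carrier R" using x y by auto
      have "(x \<oplus> y) \<otimes> f A \<ominus> kdiff R w (\<lambda>A. g A \<oplus> h A) A \<in> \<aa>" if A: "A \<subseteq> I" "card A = i" for A
      proof -
        have "(x \<oplus> y) \<otimes> f A \<ominus> kdiff R w (\<lambda>A. g A \<oplus> h A) A
            = (x \<otimes> f A \<ominus> kdiff R w g A) \<oplus> (y \<otimes> f A \<ominus> kdiff R w h A)"
          unfolding kdiff_add[OF w g(1) h(1)]
          using xy f[of A] kdiff_closed[OF w g(1), where B = A] kdiff_closed[OF w h(1), where B = A]
          by algebra
        then show ?thesis using A.a_closed[OF g(2) h(2)] A by simp
      qed
      then show "x \<oplus> y \<in> ?K"
        using xy g(1) h(1) by (intro CollectI conjI kboundaryI[of "\<lambda>A. g A \<oplus> h A"]) auto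
    next
      fix x assume x: "x \<in> ?K"
      from x have "kboundary R w \<aa> I i (\<lambda>A. x \<otimes> f A)" by simp
      then obtain g where g: "\<And>A. g A \<in> carrier R"
        "\<And>A. \<lbrakk>A \<subseteq> I; card A = i\<rbrakk> \<Longrightarrow> x \<otimes> f A \<ominus> kdiff R w g A \<in> \<aa>"
        by (rule kboundaryE) blast
      have xc: "x \<in> carrier R" using x by auto
      have "\<ominus> x \<otimes> f A \<ominus> kdiff R w (\<lambda>A. \<ominus> g A) A \<in> \<aa>" if A: "A \<subseteq> I" "card A = i" for A
      proof -
        have fin: "finite A" using A I finite_subset by auto
        have "\<ominus> x \<otimes> f A \<ominus> kdiff R w (\<lambda>A. \<ominus> g A) A = \<ominus> (x \<otimes> f A \<ominus> kdiff R w g A)"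
          unfolding kdiff_minus[OF w g(1) fin]
          using xc f[of A] kdiff_closed[OF w g(1), where B = A]
          by algebra
        then show ?thesis using A.a_inv_closed[OF g(2)] A by simp
      qed
      then show "\<ominus> x \<in> ?K"
        using xc g(1) by (intro CollectI conjI kboundaryI[of "\<lambda>A. \<ominus> g A"]) auto
    qed auto
  next
    fix x c assume x: "x \<in> ?K" and c: "c \<in> carrier R"
    from x have "kboundary R w \<aa> I i (\<lambda>A. x \<otimes> f A)" by simp
      then obtain g where g: "\<And>A. g A \<in> carrier R"
      "\<And>A. \<lbrakk>A \<subseteq> I; card A = i\<rbrakk> \<Longrightarrow> x \<otimes> f A \<ominus> kdiff R w g A \<in> \<aa>"
      by (rule kboundaryE) blast
    have xc: "x \<in> carrier R" using x by auto
    have "c \<otimes> x \<otimes> f A \<ominus> kdiff R w (\<lambda>A. c \<otimes> g A) A \<in> \<aa>" if A: "A \<subseteq> I" "card A = i" for A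
    proof -
      have fin: "finite A" using A I finite_subset by auto
      have "c \<otimes> x \<otimes> f A \<ominus> kdiff R w (\<lambda>A. c \<otimes> g A) A = c \<otimes> (x \<otimes> f A \<ominus> kdiff R w g A)"
        unfolding kdiff_smult[OF w g(1) c fin]
        using xc c f[of A] kdiff_closed[OF w g(1), where B = A]
        by algebra
      then show ?thesis using A.I_l_closed[OF g(2) c] A by simp
    qed
    then show "c \<otimes> x \<in> ?K"
      using xc c g(1) by (intro CollectI conjI kboundaryI[of "\<lambda>A. c \<otimes> g A"]) auto
    then show "x \<otimes> c \<in> ?K" using x c by (simp add: m_comm)
  qed
  moreover have "w ` I \<subseteq> ?K"
  proof
    fix x assume "x \<in> w ` I"
    then obtain j where "j \<in> I" "x = w j" by auto
    then show "x \<in> ?K" using kboundary_w[OF w f I \<open>j \<in> I\<close> a cyc] w by simp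
  qed
  ultimately have "genideal R (w ` I) \<subseteq> ?K" by (rule genideal_minimal)
  then show ?thesis using r by auto
qed

end

lemma kcocycle_subset: "\<lbrakk>kcocycle R w \<aa> I i f; I' \<subseteq> I\<rbrakk> \<Longrightarrow> kcocycle R w \<aa> I' i f"
  unfolding kcocycle_def by blast

lemma kboundary_subset: "\<lbrakk>kboundary R w \<aa> I i f; I' \<subseteq> I\<rbrakk> \<Longrightarrow> kboundary R w \<aa> I' i f"
  unfolding kboundary_def by blast

context cring
begin

lemma minus_eq_zero_iff: "\<lbrakk>x \<in> carrier R; y \<in> carrier R\<rbrakk> \<Longrightarrow> x \<ominus> y = \<zero> \<longleftrightarrow> x = y"
  by (metis a_minus_def minus_equality minus_minus r_neg add.inv_closed)

lemma kboundary_zeroI: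
  assumes "\<And>j. w j \<in> carrier R" "\<And>A. g A \<in> carrier R"
    and "\<And>A. \<lbrakk>A \<subseteq> I; card A = i\<rbrakk> \<Longrightarrow> f A = kdiff R w g A"
  shows "kboundary R w {\<zero>} I i f"
  using assms by (intro kboundaryI[of g]) (simp_all add: a_minus_def r_neg)

lemma kboundary_zeroE:
  assumes "kboundary R w {\<zero>} I i f" "\<And>j. w j \<in> carrier R" "\<And>A. f A \<in> carrier R"
  obtains g where "\<And>A. g A \<in> carrier R"
    "\<And>A. \<lbrakk>A \<subseteq> I; card A = i\<rbrakk> \<Longrightarrow> f A = kdiff R w g A"
proof -
  obtain g where g: "\<And>A. g A \<in> carrier R"
    "\<And>A. \<lbrakk>A \<subseteq> I; card A = i\<rbrakk> \<Longrightarrow> f A \<ominus> kdiff R w g A \<in> {\<zero>}"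
    using assms(1) by (rule kboundaryE) blast
  show thesis
  proof (rule that[of g])
    fix A assume "A \<subseteq> I" "card A = i"
    then show "f A = kdiff R w g A"
      using g(2)[of A] assms(2,3) g(1) by (simp add: minus_eq_zero_iff)
  qed (rule g(1))
qed

lemma kcocycle_zeroD:
  "\<lbrakk>kcocycle R w {\<zero>} I i f; B \<subseteq> I; card B = Suc i\<rbrakk> \<Longrightarrow> kdiff R w f B = \<zero>"
  unfolding kcocycle_def by blast

lemma ideal_finsum:
  assumes "ideal \<aa> R" "\<And>x. x \<in> A \<Longrightarrow> f x \<in> \<aa>"
  shows "finsum R f A \<in> \<aa>"
proof (cases "finite A")
  case True
  interpret ideal \<aa> R by fact
  show ?thesis using True assms(2)
  proof (induction A)
    case (insert x F)
    then show ?case by (subst finsum_insert) (auto simp: a_Hcarr)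
  qed simp
next
  case False
  then show ?thesis
    using additive_subgroup.zero_closed[OF ideal.axioms(1)[OF assms(1)]] by simp
qed

section \<open>Vanishing of Koszul cohomology below the length of a regular sequence\<close>

lemma kdiff_ideal:
  assumes "ideal \<aa> R" "\<And>j. w j \<in> carrier R" "\<And>A. f A \<in> \<aa>"
  shows "kdiff R w f B \<in> \<aa>"
  unfolding kdiff_def
proof (rule ideal_finsum[OF assms(1)])
  fix j
  have "w j \<otimes> f (B - {j}) \<in> \<aa>" by (rule ideal.I_l_closed[OF assms(1,3,2)])
  then show "signed R (pos j B) (w j \<otimes> f (B - {j})) \<in> \<aa>" by (rule signed_in[OF assms(1)])
qed

lemma genideal_insert:
  assumes T: "T \<subseteq> carrier R" and a: "a \<in> carrier R" and x: "x \<in> genideal R (insert a T)"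
  obtains c v where "c \<in> genideal R T" "v \<in> carrier R" "x = c \<oplus> a \<otimes> v"
proof -
  let ?K = "set_add R (genideal R T) (PIdl a)"
  have mem: "y \<in> ?K \<longleftrightarrow> (\<exists>c\<in>genideal R T. \<exists>v\<in>PIdl a. y = c \<oplus> v)" for y
    unfolding set_add_defs by auto
  have id: "ideal (?K) R"
    using T a by (intro add_ideals genideal_ideal cgenideal_ideal)
  interpret T: ideal "genideal R T" R using T by (rule genideal_ideal)
  interpret P: ideal "PIdl a" R using a by (rule cgenideal_ideal)
  have "insert a T \<subseteq> ?K"
  proof -
    have "\<zero> \<oplus> a \<in> ?K"
      using cgenideal_self[OF a] T.zero_closed unfolding mem by blast
    moreover have "t \<oplus> \<zero> \<in> ?K" if "t \<in> T" for t
      using genideal_self[OF T] that P.zero_closed unfolding mem by blast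
    moreover have "t \<oplus> \<zero> = t" if "t \<in> T" for t using T that by auto
    ultimately show ?thesis using a by auto
  qed
  then have "x \<in> ?K" using genideal_minimal[OF id] x by blast
  then obtain c v where "c \<in> genideal R T" "v \<in> carrier R" "x = c \<oplus> v \<otimes> a"
    using mem[of x] unfolding cgenideal_def by auto
  then show thesis using that a by (simp add: m_comm)
qed

text \<open>This is the long exact sequence of 0 -> R/\<aa> -> R/\<aa> -> R/\<bb> -> 0, whose first
  map is multiplication by a and where \<bb> = \<aa> + aR: if the cohomology over R/\<bb> vanishes
  one degree lower, then a acts injectively on the cohomology over R/\<aa>.\<close>

lemma kboundary_cancel:
  assumes w: "\<And>j. w j \<in> carrier R" and I: "finite I" and id: "ideal \<aa> R" and a: "a \<in> carrier R"
    and nzd: "\<And>r. \<lbrakk>r \<in> carrier R; a \<otimes> r \<in> \<aa>\<rbrakk> \<Longrightarrow> r \<in> \<aa>"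
    and id': "ideal \<bb> R" and sub: "\<aa> \<subseteq> \<bb>" "a \<in> \<bb>"
    and dec: "\<And>x. x \<in> \<bb> \<Longrightarrow> \<exists>c\<in>\<aa>. \<exists>v\<in>carrier R. x = c \<oplus> a \<otimes> v"
    and prev: "\<And>i'. i = Suc i' \<Longrightarrow> kexact R w \<bb> I i'"
    and f: "\<And>A. f A \<in> carrier R" and bd: "kboundary R w \<aa> I i (\<lambda>A. a \<otimes> f A)"
  shows "kboundary R w \<aa> I i f"
proof -
  interpret A: ideal \<aa> R by (rule id)
  interpret B: ideal \<bb> R by (rule id')
  obtain g where g: "\<And>A. g A \<in> carrier R"
    "\<And>A. \<lbrakk>A \<subseteq> I; card A = i\<rbrakk> \<Longrightarrow> a \<otimes> f A \<ominus> kdiff R w g A \<in> \<aa>"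
    using bd by (rule kboundaryE) blast
  show ?thesis
  proof (cases i)
    case 0
    have "f A \<ominus> kdiff R w g A \<in> \<aa>" if A: "A \<subseteq> I" "card A = i" for A
    proof -
      have "finite A" using A(1) I finite_subset by blast
      then have "A = {}" using A(2) 0 by simp
      then show ?thesis using g(2)[OF A] nzd[of "f A"] a f by (simp add: a_minus_def)
    qed
    then show ?thesis using g(1) by (intro kboundaryI[of g])
  next
    case (Suc i')
    \<comment> \<open>A primitive of \<open>a f\<close> is a cocycle modulo \<bb>, because \<bb>
      contains both a and \<aa>. Its class is the one that maps to the class of f under the
      connecting homomorphism.\<close>
    have "kdiff R w g B \<in> \<bb>" if B: "B \<subseteq> I" "card B = Suc i'" for B
    proof -
      have 1: "a \<otimes> f B \<ominus> kdiff R w g B \<in> \<bb>" using g(2)[of B] B Suc sub by auto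
      have 2: "a \<otimes> f B \<in> \<bb>" using B.I_r_closed[OF sub(2) f] .
      have "kdiff R w g B = a \<otimes> f B \<ominus> (a \<otimes> f B \<ominus> kdiff R w g B)"
        using m_closed[OF a f[of B]] kdiff_closed[OF w g(1), where B = B] by algebra
      then show ?thesis using B.a_closed[OF 2 B.a_inv_closed[OF 1]] by (simp add: a_minus_def)
    qed
    then have "kboundary R w \<bb> I i' g"
      using prev[OF Suc] g(1) unfolding kexact_def kcocycle_def by blast
    then obtain u where u: "\<And>A. u A \<in> carrier R"
      "\<And>A. \<lbrakk>A \<subseteq> I; card A = i'\<rbrakk> \<Longrightarrow> g A \<ominus> kdiff R w u A \<in> \<bb>"
      by (rule kboundaryE) blast
    \<comment> \<open>The decomposition matters only in degree i'. Zero elsewhere keeps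
      \<open>c\<close> inside \<aa> and \<open>v\<close> inside the carrier on all sets, as the
      lemmas on \<open>kdiff\<close> require.\<close>
    have "\<exists>c v. c \<in> \<aa> \<and> v \<in> carrier R \<and> (A \<subseteq> I \<and> card A = i' \<longrightarrow> g A \<ominus> kdiff R w u A = c \<oplus> a \<otimes> v)"
      for A
    proof (cases "A \<subseteq> I \<and> card A = i'")
      case True
      then show ?thesis using dec[OF u(2)] by blast
    next
      case False
      then show ?thesis using A.zero_closed zero_closed by blast
    qed
    then obtain c v where cv: "\<And>A. c A \<in> \<aa>" "\<And>A. v A \<in> carrier R"
      "\<And>A. \<lbrakk>A \<subseteq> I; card A = i'\<rbrakk> \<Longrightarrow> g A \<ominus> kdiff R w u A = c A \<oplus> a \<otimes> v A"
      by metis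
    have cc: "c A \<in> carrier R" for A using cv(1) A.a_Hcarr by blast
    have "f B \<ominus> kdiff R w v B \<in> \<aa>" if B: "B \<subseteq> I" "card B = i" for B
    proof -
      have fin: "finite B" using B(1) I finite_subset by blast
      have du: "kdiff R w u A \<in> carrier R" for A using kdiff_closed[OF w u(1)] .
      have "g A = kdiff R w u A \<oplus> (c A \<oplus> a \<otimes> v A)" if "A \<subseteq> I" "card A = i'" for A
      proof -
        have "g A = kdiff R w u A \<oplus> (g A \<ominus> kdiff R w u A)" using g(1)[of A] du[of A] by algebra
        then show ?thesis using cv(3) that by simp
      qed
      moreover have "B - {j} \<subseteq> I" "card (B - {j}) = i'" if "j \<in> B" for j
        using B Suc fin that by auto
      \<comment> \<open>The part \<open>u\<close> drops out since d d = 0, so modulo \<aa> the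
        differential of g is a times that of v; then a can be cancelled.\<close>
      ultimately have "kdiff R w g B = kdiff R w (\<lambda>A. kdiff R w u A \<oplus> (c A \<oplus> a \<otimes> v A)) B"
        using w g(1) by (intro kdiff_cong) auto
      also have "\<dots> = kdiff R w (kdiff R w u) B \<oplus> (kdiff R w c B \<oplus> a \<otimes> kdiff R w v B)"
        using w du cc a cv(2) fin by (simp add: kdiff_add kdiff_smult)
      also have "kdiff R w (kdiff R w u) B = \<zero>" using w u(1) fin by (rule kdiff_kdiff)
      finally have e: "kdiff R w g B = kdiff R w c B \<oplus> a \<otimes> kdiff R w v B"
        using kdiff_closed[OF w cc] kdiff_closed[OF w cv(2)] a by simp
      have "a \<otimes> (f B \<ominus> kdiff R w v B) = (a \<otimes> f B \<ominus> kdiff R w g B) \<oplus> kdiff R w c B"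
        unfolding e using a f[of B] kdiff_closed[OF w cc, where B = B] kdiff_closed[OF w cv(2), where B = B]
        by algebra
      also have "\<dots> \<in> \<aa>"
        using g(2)[OF B] kdiff_ideal[OF id w cv(1)] by (rule A.a_closed)
      finally have 1: "a \<otimes> (f B \<ominus> kdiff R w v B) \<in> \<aa>" .
      have "f B \<ominus> kdiff R w v B \<in> carrier R"
        using f[of B] kdiff_closed[OF w cv(2), where B = B] by (rule minus_closed)
      then show ?thesis using 1 by (rule nzd)
    qed
    then show ?thesis using cv(2) by (intro kboundaryI[of v])
  qed
qed

lemma kcocycle_smult:
  assumes "ideal \<aa> R" "\<And>j. w j \<in> carrier R" "\<And>A. f A \<in> carrier R" "c \<in> carrier R" "finite I"
    "kcocycle R w \<aa> I i f"
  shows "kcocycle R w \<aa> I i (\<lambda>A. c \<otimes> f A)"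
  unfolding kcocycle_def
proof (intro allI impI)
  fix B assume B: "B \<subseteq> I" "card B = Suc i"
  then have "finite B" using assms(5) finite_subset by blast
  then have "kdiff R w (\<lambda>A. c \<otimes> f A) B = c \<otimes> kdiff R w f B"
    using assms by (intro kdiff_smult)
  then show "kdiff R w (\<lambda>A. c \<otimes> f A) B \<in> \<aa>"
    using assms(6) B ideal.I_l_closed[OF assms(1) _ assms(4)] by (simp add: kcocycle_def)
qed

text \<open>Depth sensitivity of the Koszul complex. A power of the next element a of the sequence
  lies in the ideal of the coefficients and kills the cohomology over R modulo the first l elements;
  but a acts injectively there, by vanishing one degree lower modulo l + 1 elements. The sum l + i
  is unchanged in this induction step.\<close>

lemma kexact_regular_sequence:
  assumes w: "\<And>j. w j \<in> carrier R" and I: "finite I" and reg: "regular_sequence R as"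
    and rad: "\<And>a. a \<in> set as \<Longrightarrow> \<exists>n::nat. a [^] n \<in> genideal R (w ` I)"
    and l: "l + i < length as"
  shows "kexact R w (genideal R (set (take l as))) I i"
  using l
proof (induction i arbitrary: l)
  have main: "kexact R w (genideal R (set (take l as))) I i"
    if li: "l + i < length as"
      and prev: "\<And>i'. i = Suc i' \<Longrightarrow> kexact R w (genideal R (set (take (Suc l) as))) I i'" for l i
  proof -
    let ?a = "as ! l" and ?aa = "genideal R (set (take l as))"
      and ?bb = "genideal R (set (take (Suc l) as))"
    have ll: "l < length as" using li by simp
    have ac: "set as \<subseteq> carrier R" using reg by (simp add: regular_sequence_def)
    have tc: "set (take k as) \<subseteq> carrier R" for k
      by (rule order_trans[OF set_take_subset ac])
    have a: "?a \<in> carrier R" using ac ll by auto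
    have id: "ideal ?aa R" "ideal ?bb R" using tc by (auto intro: genideal_ideal)
    have ins: "set (take (Suc l) as) = insert ?a (set (take l as))"
      using ll by (simp add: take_Suc_conv_app_nth)
    have sub: "?aa \<subseteq> ?bb" "?a \<in> ?bb"
      using genideal_self[OF tc, of "Suc l"] genideal_minimal[OF id(2), of "set (take l as)"]
      unfolding ins by simp_all
    have dec: "\<exists>c\<in>?aa. \<exists>v\<in>carrier R. x = c \<oplus> ?a \<otimes> v" if "x \<in> ?bb" for x
      using that unfolding ins by (rule genideal_insert[OF tc a]) blast
    have nzd: "r \<in> ?aa" if "r \<in> carrier R" "?a \<otimes> r \<in> ?aa" for r
      using reg ll that unfolding regular_sequence_def by blast
    obtain n :: nat where n: "?a [^] n \<in> genideal R (w ` I)" using rad[OF nth_mem[OF ll]] by blast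
    \<comment> \<open>Powers of a are cancelled one factor at a time.\<close>
    have pw: "kboundary R w ?aa I i f"
      if f: "\<And>A. f A \<in> carrier R" and "kboundary R w ?aa I i (\<lambda>A. ?a [^] n \<otimes> f A)" for f and n :: nat
      using that
    proof (induction n arbitrary: f)
      case 0
      then show ?case by simp
    next
      case (Suc n)
      have "kboundary R w ?aa I i (\<lambda>A. ?a [^] n \<otimes> (?a \<otimes> f A))"
        using Suc.prems a by (simp add: m_assoc)
      then have "kboundary R w ?aa I i (\<lambda>A. ?a \<otimes> f A)"
        by (rule Suc.IH[rotated]) (simp add: Suc.prems(1) a)
      with w I id(1) a nzd id(2) sub dec prev Suc.prems(1) show ?case by (rule kboundary_cancel)
    qed
    show ?thesis
      unfolding kexact_def
    proof (intro allI impI, elim conjE)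
      fix f assume f: "\<forall>A. f A \<in> carrier R" "kcocycle R w ?aa I i f"
      then have fc: "f A \<in> carrier R" for A by blast
      \<comment> \<open>For the exponent n fixed above, the n-th power of a lies in the ideal of the
        coefficients, so its multiple of f is a boundary.\<close>
      show "kboundary R w ?aa I i f"
        by (rule pw[OF fc kboundary_genideal[OF w fc I n id(1) f(2)]])
    qed
  qed
  {
    case 0
    show ?case by (rule main[OF 0]) simp
  next
    case (Suc i)
    show ?case
    proof (rule main[OF Suc.prems])
      fix i' assume "Suc i = Suc i'"
      then show "kexact R w (genideal R (set (take (Suc l) as))) I i'"
        using Suc.IH[of "Suc l"] Suc.prems by simp
    qed
  }
qed

section \<open>Coefficients in \<open>R\<close> itself: restricting and extending along a longer
  list\<close>

lemma genideal_empty: "genideal R {} = {\<zero>}"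
proof
  show "genideal R {} \<subseteq> {\<zero>}" by (rule genideal_minimal[OF zeroideal]) auto
  show "{\<zero>} \<subseteq> genideal R {}"
    using additive_subgroup.zero_closed[OF ideal.axioms(1)[OF genideal_ideal[of "{}"]]] by auto
qed

text \<open>Exactness of the mapping cone sequence for multiplication by \<open>w j\<close>. A
  primitive g on I leaves over, on the sets containing j, a cocycle of one degree less; its
  primitive is the missing part of a primitive on \<open>insert j I\<close>.\<close>

lemma kboundary_insert:
  assumes w: "\<And>j. w j \<in> carrier R" and I: "finite I" "j \<notin> I"
    and ex: "\<And>i'. i = Suc i' \<Longrightarrow> kexact R w {\<zero>} I i'"
    and f: "\<And>A. f A \<in> carrier R" and cyc: "kcocycle R w {\<zero>} (insert j I) i f"
    and bd: "kboundary R w {\<zero>} I i f"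
  shows "kboundary R w {\<zero>} (insert j I) i f"
proof -
  obtain g where g: "\<And>A. g A \<in> carrier R" "\<And>A. \<lbrakk>A \<subseteq> I; card A = i\<rbrakk> \<Longrightarrow> f A = kdiff R w g A"
    using bd w f by (rule kboundary_zeroE) blast
  show ?thesis
  proof (cases i)
    case 0
    then have "A = {}" if "A \<subseteq> insert j I" "card A = i" for A
      using that finite_subset[OF that(1)] I(1) by simp
    then show ?thesis using g w 0 by (intro kboundary_zeroI[of w g]) auto
  next
    case (Suc i')
    \<comment> \<open>The defect of g on sets containing j. Both terms have the same differential,
      namely w_j f: the first by the cocycle condition for f, the second because g is a primitive of
      f on I.\<close>
    let ?h = "\<lambda>A. contr R j f A \<ominus> w j \<otimes> g A"
    have "kdiff R w ?h B = \<zero>" if B: "B \<subseteq> I" "card B = i" for B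
    proof -
      have fin: "finite B" "j \<notin> B" using B I finite_subset by auto
      have "kdiff R w f (insert j B) = \<zero>"
        using B fin by (intro kcocycle_zeroD[OF cyc]) auto
      then have "signed R (pos j B) (w j \<otimes> f B \<ominus> kdiff R w (contr R j f) B) \<in> {\<zero>}"
        using w f fin by (simp add: kdiff_insert)
      then have "w j \<otimes> f B \<ominus> kdiff R w (contr R j f) B \<in> {\<zero>}"
        by (rule signed_mem[OF zeroideal, rotated]) (simp add: w f)
      then have "w j \<otimes> f B = kdiff R w (contr R j f) B"
        using w f by (simp add: minus_eq_zero_iff)
      moreover have "kdiff R w ?h B = kdiff R w (contr R j f) B \<ominus> w j \<otimes> kdiff R w g B"
        using w f g(1) fin by (simp add: kdiff_diff kdiff_smult)
      ultimately show ?thesis using g(2)[OF B] w f by (simp add: a_minus_def r_neg)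
    qed
    then have "kcocycle R w {\<zero>} I i' ?h" using Suc by (simp add: kcocycle_def)
    moreover have h: "?h A \<in> carrier R" for A using w f g(1) by simp
    ultimately have "kboundary R w {\<zero>} I i' ?h" using ex[OF Suc] by (simp add: kexact_def)
    then obtain u where u: "\<And>A. u A \<in> carrier R"
      "\<And>A. \<lbrakk>A \<subseteq> I; card A = i'\<rbrakk> \<Longrightarrow> ?h A = kdiff R w u A"
      using w h by (rule kboundary_zeroE) blast
    \<comment> \<open>The sign is chosen so that the contraction of \<open>g'\<close> along j is
      \<open>\<ominus> u\<close> on sets without j.\<close>
    define g' where "g' A = (if j \<in> A then signed R (pos j A) (\<ominus> u (A - {j})) else g A)" for A
    have g': "g' A \<in> carrier R" for A using u(1) g(1) by (simp add: g'_def)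
    show ?thesis
    proof (rule kboundary_zeroI[of w g'])
      fix A assume A: "A \<subseteq> insert j I" "card A = i"
      have fin: "finite A" using A(1) I finite_subset by blast
      show "f A = kdiff R w g' A"
      proof (cases "j \<in> A")
        case False
        then have "kdiff R w g' A = kdiff R w g A"
          using w g' by (intro kdiff_cong) (auto simp: g'_def)
        then show ?thesis using g(2) A False by auto
      next
        case True
        then obtain C where C: "A = insert j C" "j \<notin> C" by (meson mk_disjoint_insert)
        have finC: "finite C" using fin C by simp
        have CI: "C \<subseteq> I" "card C = i'" using A C Suc finC by auto
        have "kdiff R w (contr R j g') C = kdiff R w (\<lambda>A. \<ominus> u A) C"
        proof (rule kdiff_cong)
          fix k assume k: "k \<in> C"
          have 1: "j \<notin> C - {k}" using C(2) by blast
          then have "insert j (C - {k}) - {j} = C - {k}" by blast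
          with C(2) show "contr R j g' (C - {k}) = \<ominus> u (C - {k})"
            using u(1) by (simp add: contr_def g'_def)
        qed (use w g' in auto)
        also have "\<dots> = \<ominus> kdiff R w u C" using w u(1) finC by (rule kdiff_minus)
        finally have e: "kdiff R w (contr R j g') C = \<ominus> kdiff R w u C" .
        have "kdiff R w g' A = signed R (pos j C) (w j \<otimes> g' C \<ominus> kdiff R w (contr R j g') C)"
          unfolding C(1) using w g' finC C(2) by (rule kdiff_insert)
        also have "w j \<otimes> g' C \<ominus> kdiff R w (contr R j g') C = w j \<otimes> g C \<oplus> ?h C"
          unfolding e u(2)[OF CI] using C(2) kdiff_closed[OF w u(1), where B = C]
          by (simp add: g'_def a_minus_def)
        also have "\<dots> = contr R j f C"
          using w[of j] g(1)[of C] contr_closed[OF f, where j = j and A = C] by algebra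
        also have "signed R (pos j C) (contr R j f C) = f A"
          using C f by (simp add: contr_def)
        finally show ?thesis by simp
      qed
    qed (use w g' in auto)
  qed
qed

text \<open>Indices are adjoined one at a time, hence the vanishing hypothesis for every index set
  between I and \<open>V \<union> I\<close>.\<close>

lemma kboundary_union:
  assumes w: "\<And>j. w j \<in> carrier R" and I: "finite I" "finite V"
    and ex: "\<And>i' I'. \<lbrakk>i = Suc i'; I \<subseteq> I'; I' \<subseteq> V \<union> I\<rbrakk> \<Longrightarrow> kexact R w {\<zero>} I' i'"
    and f: "\<And>A. f A \<in> carrier R" and cyc: "kcocycle R w {\<zero>} (V \<union> I) i f"
    and bd: "kboundary R w {\<zero>} I i f"
  shows "kboundary R w {\<zero>} (V \<union> I) i f"
  using I(2) ex cyc
proof (induction V)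
  case empty
  then show ?case using bd by simp
next
  case (insert j V)
  have IH: "kboundary R w {\<zero>} (V \<union> I) i f"
  proof (rule insert.IH)
    show "kcocycle R w {\<zero>} (V \<union> I) i f"
      using insert.prems(2) by (rule kcocycle_subset) auto
  qed (use insert.prems(1) in blast)
  show ?case
  proof (cases "j \<in> V \<union> I")
    case True
    then show ?thesis using IH by (simp add: insert_absorb)
  next
    case False
    have "kboundary R w {\<zero>} (insert j (V \<union> I)) i f"
    proof (rule kboundary_insert[OF w])
      fix i' assume "i = Suc i'"
      then show "kexact R w {\<zero>} (V \<union> I) i'" by (rule insert.prems(1)) auto
    qed (use insert.prems(2) IH False f I insert.hyps in auto)
    then show ?thesis by simp
  qed
qed

text \<open>The obstruction to extending f over j is the class of \<open>w j\<close> times f on I.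
  It vanishes because \<open>w j\<close> lies in the ideal generated by the coefficients on I, and a
  primitive supplies the values on sets containing j.\<close>

lemma kcocycle_lift:
  assumes w: "\<And>j. w j \<in> carrier R" and I: "finite I" "j \<notin> I" and wj: "w j \<in> genideal R (w ` I)"
    and f: "\<And>A. f A \<in> carrier R" and cyc: "kcocycle R w {\<zero>} I i f"
  obtains f' where "\<And>A. f' A \<in> carrier R" "\<And>A. A \<subseteq> I \<Longrightarrow> f' A = f A"
    "kcocycle R w {\<zero>} (insert j I) i f'"
proof -
  have "kboundary R w {\<zero>} I i (\<lambda>A. w j \<otimes> f A)"
    by (rule kboundary_genideal[OF w f I(1) wj zeroideal cyc])
  then obtain g where g: "\<And>A. g A \<in> carrier R"
    "\<And>A. \<lbrakk>A \<subseteq> I; card A = i\<rbrakk> \<Longrightarrow> w j \<otimes> f A = kdiff R w g A"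
    by (rule kboundary_zeroE) (use w f in auto)
  \<comment> \<open>With this sign the contraction of f' along j is g, so the cocycle condition on
    \<open>insert j C\<close> becomes w_j f = d g.\<close>
  define f' where "f' A = (if j \<in> A then signed R (pos j A) (g (A - {j})) else f A)" for A
  have f': "f' A \<in> carrier R" for A using f g(1) by (simp add: f'_def)
  show thesis
  proof (rule that[of f'])
    show "kcocycle R w {\<zero>} (insert j I) i f'" unfolding kcocycle_def
    proof (intro allI impI)
      fix B assume B: "B \<subseteq> insert j I" "card B = Suc i"
      have fin: "finite B" using B(1) I(1) finite_subset by blast
      show "kdiff R w f' B \<in> {\<zero>}"
      proof (cases "j \<in> B")
        case False
        then have "kdiff R w f' B = kdiff R w f B"
          using w f' by (intro kdiff_cong) (auto simp: f'_def)
        then show ?thesis using kcocycle_zeroD[OF cyc _ B(2)] B(1) False by auto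
      next
        case True
        then obtain C where C: "B = insert j C" "j \<notin> C" by (meson mk_disjoint_insert)
        have finC: "finite C" using fin C by simp
        have CI: "C \<subseteq> I" "card C = i" using B C finC by auto
        have "kdiff R w (contr R j f') C = kdiff R w g C"
        proof (rule kdiff_cong)
          fix k assume k: "k \<in> C"
          have 1: "j \<notin> C - {k}" using C(2) by blast
          then have "insert j (C - {k}) - {j} = C - {k}" by blast
          with C(2) show "contr R j f' (C - {k}) = g (C - {k})"
            using g(1) by (simp add: contr_def f'_def)
        qed (use w f' in auto)
        moreover have "f' C = f C" using C(2) by (simp add: f'_def)
        moreover have "kdiff R w f' B = signed R (pos j C) (w j \<otimes> f' C \<ominus> kdiff R w (contr R j f') C)"
          unfolding C(1) using w f' finC C(2) by (rule kdiff_insert)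
        ultimately show ?thesis using g(2)[OF CI] kdiff_closed[OF w g(1), where B = C]
          by (simp add: a_minus_def r_neg)
      qed
    qed
  qed (use f' I(2) in \<open>auto simp: f'_def\<close>)
qed

lemma kcocycle_lift_union:
  assumes w: "\<And>j. w j \<in> carrier R" and I: "finite I" "finite V"
    and wV: "\<And>j. j \<in> V \<Longrightarrow> w j \<in> genideal R (w ` I)"
    and f: "\<And>A. f A \<in> carrier R" and cyc: "kcocycle R w {\<zero>} I i f"
  shows "\<exists>f'. (\<forall>A. f' A \<in> carrier R) \<and> (\<forall>A\<subseteq>I. f' A = f A) \<and> kcocycle R w {\<zero>} (V \<union> I) i f'"
  using I(2) wV
proof (induction V)
  case empty
  then show ?case using f cyc by auto
next
  case (insert j V)
  then obtain f' where f': "\<And>A. f' A \<in> carrier R" "\<And>A. A \<subseteq> I \<Longrightarrow> f' A = f A"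
    "kcocycle R w {\<zero>} (V \<union> I) i f'"
    by auto
  show ?case
  proof (cases "j \<in> V \<union> I")
    case True
    then show ?thesis using f' by (auto simp: insert_absorb)
  next
    case False
    have "genideal R (w ` I) \<subseteq> genideal R (w ` (V \<union> I))"
    proof (rule genideal_minimal)
      have *: "w ` (V \<union> I) \<subseteq> carrier R" using w by auto
      show "ideal (genideal R (w ` (V \<union> I))) R" using * by (rule genideal_ideal)
      show "w ` I \<subseteq> genideal R (w ` (V \<union> I))" using genideal_self[OF *] by auto
    qed
    then have "w j \<in> genideal R (w ` (V \<union> I))" using insert.prems by auto
    then obtain f'' where f'': "\<And>A. f'' A \<in> carrier R" "\<And>A. A \<subseteq> V \<union> I \<Longrightarrow> f'' A = f' A"
      "kcocycle R w {\<zero>} (insert j (V \<union> I)) i f''"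
      using kcocycle_lift[OF w _ False _ f'(1,3)] I(1) insert.hyps(1) by auto
    have "f'' A = f A" if "A \<subseteq> I" for A
      using that f''(2)[of A] f'(2)[of A] by auto
    then show ?thesis using f'' by (intro exI[of _ f'']) simp
  qed
qed

end

section \<open>Additive powers\<close>

text \<open>The single consequence of characteristic p that the Koszul arguments need. It passes to
  powers of p and to localisations. Positivity gives that the power of zero is zero, and it allows a
  factor t to be completed to t^q by t^(q-1).\<close>

definition additive_power :: "('a, 'm) ring_scheme \<Rightarrow> nat \<Rightarrow> bool"
  where "additive_power R q \<longleftrightarrow> q > 0 \<and>
    (\<forall>x\<in>carrier R. \<forall>y\<in>carrier R. (x \<oplus>\<^bsub>R\<^esub> y) [^]\<^bsub>R\<^esub> q = x [^]\<^bsub>R\<^esub> q \<oplus>\<^bsub>R\<^esub> y [^]\<^bsub>R\<^esub> q)"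

context cring
begin

lemma additive_powerD:
  "\<lbrakk>additive_power R q; x \<in> carrier R; y \<in> carrier R\<rbrakk> \<Longrightarrow> (x \<oplus> y) [^] q = x [^] q \<oplus> y [^] q"
  by (simp add: additive_power_def)

lemma additive_power_zero: "additive_power R q \<Longrightarrow> \<zero> [^] q = \<zero>"
  by (simp add: additive_power_def nat_pow_zero)

lemma additive_power_minus:
  assumes q: "additive_power R q" and x: "x \<in> carrier R"
  shows "(\<ominus> x) [^] q = \<ominus> (x [^] q)"
proof -
  have "(\<ominus> x) [^] q \<oplus> x [^] q = \<zero>"
    using additive_powerD[OF q, of "\<ominus> x" x] x by (simp add: l_neg additive_power_zero[OF q])
  then show ?thesis using x by (simp add: minus_equality)
qed

lemma additive_power_signed:
  "\<lbrakk>additive_power R q; x \<in> carrier R\<rbrakk> \<Longrightarrow> signed R n x [^] q = signed R n (x [^] q)"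
  by (simp add: signed_def additive_power_minus)

lemma additive_power_finsum:
  assumes q: "additive_power R q" and "finite A" "\<And>a. a \<in> A \<Longrightarrow> f a \<in> carrier R"
  shows "finsum R f A [^] q = finsum R (\<lambda>a. f a [^] q) A"
  using assms(2,3)
proof (induction A)
  case empty
  then show ?case by (simp add: additive_power_zero[OF q])
next
  case (insert x F)
  then have "f x \<in> carrier R" "finsum R f F \<in> carrier R" by (auto intro: finsum_closed)
  then show ?case
    using insert by (subst (1 2) finsum_insert) (auto simp: additive_powerD[OF q])
qed

lemma additive_power_power:
  assumes p: "additive_power R p"
  shows "additive_power R (p ^ e)"
proof (induction e)
  case 0
  then show ?case by (simp add: additive_power_def)
next
  case (Suc e)
  have "(x \<oplus> y) [^] (p ^ Suc e) = x [^] (p ^ Suc e) \<oplus> y [^] (p ^ Suc e)"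
    if "x \<in> carrier R" "y \<in> carrier R" for x y
  proof -
    have *: "z [^] (p ^ Suc e) = (z [^] (p ^ e)) [^] p" if "z \<in> carrier R" for z
      using that by (simp add: nat_pow_pow mult.commute)
    show ?thesis using that by (simp only: * a_closed additive_powerD[OF Suc.IH] additive_powerD[OF p] nat_pow_closed)
  qed
  then show ?case using p by (simp add: additive_power_def)
qed

text \<open>The reason why Frobenius acts on Koszul cochains: the power respects sums and signs, and
  multiplicativity moves it onto the coefficients, so the target is the complex on the powers of
  w.\<close>

lemma additive_power_kdiff:
  assumes q: "additive_power R q" and w: "\<And>j. w j \<in> carrier R" and f: "\<And>A. f A \<in> carrier R"
    and B: "finite B"
  shows "kdiff R w f B [^] q = kdiff R (\<lambda>j. w j [^] q) (\<lambda>A. f A [^] q) B"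
proof -
  have "kdiff R w f B [^] q = finsum R (\<lambda>j. signed R (pos j B) (w j \<otimes> f (B - {j})) [^] q) B"
    unfolding kdiff_def using w f B by (intro additive_power_finsum[OF q]) auto
  also have "\<dots> = kdiff R (\<lambda>j. w j [^] q) (\<lambda>A. f A [^] q) B"
    unfolding kdiff_def using w f
    by (intro finsum_cong') (auto simp: additive_power_signed[OF q] nat_pow_distrib)
  finally show ?thesis .
qed

text \<open>By additivity the elements whose q-th power lies in K form an ideal, so it is enough to
  look at generators.\<close>

lemma additive_power_genideal:
  assumes q: "additive_power R q" and K: "ideal K R" and G: "G \<subseteq> carrier R"
    and gen: "\<And>g. g \<in> G \<Longrightarrow> g [^] q \<in> K" and r: "r \<in> genideal R G"
  shows "r [^] q \<in> K"
proof -
  interpret K: ideal K R by (rule K)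
  let ?I = "{r \<in> carrier R. r [^] q \<in> K}"
  have "ideal ?I R"
  proof (rule idealI)
    show "ring R" by unfold_locales
    show "subgroup ?I (add_monoid R)"
      by (rule add.subgroupI)
        (auto simp: additive_power_zero[OF q] additive_powerD[OF q] additive_power_minus[OF q] intro!: exI[of _ \<zero>])
  qed (auto simp: nat_pow_distrib K.I_l_closed K.I_r_closed)
  moreover have "G \<subseteq> ?I" using G gen by auto
  ultimately have "genideal R G \<subseteq> ?I" by (rule genideal_minimal)
  then show ?thesis using r by auto
qed

lemma pow_ideal_mono:
  assumes "ideal K R" "x \<in> carrier R" "x [^] m \<in> K" "m \<le> (n::nat)"
  shows "x [^] n \<in> K"
proof -
  have "x [^] n = x [^] (n - m) \<otimes> x [^] m" using assms by (simp add: nat_pow_mult)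
  then show ?thesis using ideal.I_l_closed[OF assms(1,3)] assms(2) by simp
qed

text \<open>The additive powers play the part of the binomial theorem here.\<close>

lemma radical_genideal:
  assumes p: "additive_power R p" "p \<ge> 2" and K: "ideal K R" and G: "G \<subseteq> carrier R" "finite G"
    and gen: "\<And>g. g \<in> G \<Longrightarrow> \<exists>k::nat. g [^] k \<in> K" and r: "r \<in> carrier R" "r [^] (n::nat) \<in> genideal R G"
  shows "\<exists>k::nat. r [^] k \<in> K"
proof -
  obtain k :: "_ \<Rightarrow> nat" where k: "\<And>g. g \<in> G \<Longrightarrow> g [^] k g \<in> K" using gen by metis
  \<comment> \<open>A bound for all exponents k g; since p is at least 2, also k g < p^e, so one
    Frobenius power works for all generators.\<close>
  define e where "e = Max (insert 0 (k ` G))"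
  have ke: "k g \<le> p ^ e" if "g \<in> G" for g
  proof -
    have "k g \<le> e" unfolding e_def using that G(2) by (intro Max_ge) auto
    also have "e < p ^ e" using p(2) power_gt_expt[of p e] by simp
    finally show ?thesis by simp
  qed
  have "(r [^] n) [^] (p ^ e) \<in> K"
    by (rule additive_power_genideal[OF additive_power_power[OF p(1)] K G(1) _ r(2)])
      (use pow_ideal_mono[OF K _ k ke] G(1) in blast)
  then show ?thesis using r(1) by (auto simp: nat_pow_pow)
qed

section \<open>Parameters in a ring with a regular sequence\<close>

lemma kdiff_cong_coeff:
  assumes "\<And>j. w j \<in> carrier R" "\<And>A. f A \<in> carrier R" "\<And>j. j \<in> B \<Longrightarrow> w j = w' j"
  shows "kdiff R w f B = kdiff R w' f B"
  unfolding kdiff_def using assms(1,2) by (intro finsum_cong') (auto simp: assms(3)[symmetric])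

lemma kboundary_cong:
  assumes w: "\<And>j. w j \<in> carrier R" and ww: "\<And>j. j \<in> I \<Longrightarrow> w j = w' j"
    and ff: "\<And>A. \<lbrakk>A \<subseteq> I; card A = i\<rbrakk> \<Longrightarrow> f A = f' A"
    and bd: "kboundary R w \<aa> I i f"
  shows "kboundary R w' \<aa> I i f'"
proof -
  obtain g where g: "\<And>A. g A \<in> carrier R"
    "\<And>A. \<lbrakk>A \<subseteq> I; card A = i\<rbrakk> \<Longrightarrow> f A \<ominus> kdiff R w g A \<in> \<aa>"
    using bd by (rule kboundaryE) blast
  show ?thesis
  proof (rule kboundaryI[OF g(1)])
    fix A assume A: "A \<subseteq> I" "card A = i"
    have "kdiff R w g A = kdiff R w' g A"
      using A(1) by (intro kdiff_cong_coeff[OF w g(1)] ww) auto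
    then show "f' A \<ominus> kdiff R w' g A \<in> \<aa>" using g(2)[OF A] ff[OF A] by simp
  qed
qed

text \<open>Multiplication by the products of the t_j is a chain map from the complex on w to the
  one on w t. With t_j = x_j^m these are the transition maps whose limit is the Cech
  complex.\<close>

lemma kdiff_twist:
  assumes w: "\<And>j. w j \<in> carrier R" and t: "\<And>j. t j \<in> carrier R" and f: "\<And>A. f A \<in> carrier R"
    and B: "finite B"
  shows "kdiff R (\<lambda>j. w j \<otimes> t j) (\<lambda>A. finprod R t A \<otimes> f A) B = finprod R t B \<otimes> kdiff R w f B"
proof -
  have tc: "finprod R t A \<in> carrier R" for A using t by (intro finprod_closed) auto
  have "(w j \<otimes> t j) \<otimes> (finprod R t (B - {j}) \<otimes> f (B - {j})) = finprod R t B \<otimes> (w j \<otimes> f (B - {j}))"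
    if j: "j \<in> B" for j
  proof -
    have "finprod R t (insert j (B - {j})) = t j \<otimes> finprod R t (B - {j})"
      using B t by (intro finprod_insert) auto
    then have "finprod R t B = t j \<otimes> finprod R t (B - {j})" using j by (simp add: insert_absorb)
    then show ?thesis using w[of j] t[of j] f[of "B - {j}"] tc[of "B - {j}"] by (simp add: m_ac)
  qed
  then have "kdiff R (\<lambda>j. w j \<otimes> t j) (\<lambda>A. finprod R t A \<otimes> f A) B
      = finsum R (\<lambda>j. finprod R t B \<otimes> signed R (pos j B) (w j \<otimes> f (B - {j}))) B"
    unfolding kdiff_def using w t f tc by (intro finsum_cong') (auto simp: signed_r)
  also have "\<dots> = finprod R t B \<otimes> kdiff R w f B"
    unfolding kdiff_def using B w f tc by (intro finsum_rdistr[symmetric]) auto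
  finally show ?thesis .
qed

lemma kdiff_mem_genideal:
  assumes w: "\<And>j. w j \<in> carrier R" and f: "\<And>A. f A \<in> carrier R"
  shows "kdiff R w f B \<in> genideal R (w ` B)"
proof -
  have wB: "w ` B \<subseteq> carrier R" using w by auto
  have id: "ideal (genideal R (w ` B)) R" using wB by (rule genideal_ideal)
  show ?thesis unfolding kdiff_def
  proof (rule ideal_finsum[OF id])
    fix j assume "j \<in> B"
    then have "w j \<in> genideal R (w ` B)" using genideal_self[OF wB] by auto
    then have "w j \<otimes> f (B - {j}) \<in> genideal R (w ` B)" using f by (rule ideal.I_r_closed[OF id])
    then show "signed R (pos j B) (w j \<otimes> f (B - {j})) \<in> genideal R (w ` B)"
      by (rule signed_in[OF id])
  qed
qed

lemma kcocycle_top: "finite Y \<Longrightarrow> kcocycle R w \<aa> Y (card Y) f"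
  unfolding kcocycle_def by (metis card_mono not_less_eq_eq order_refl)

text \<open>Top Koszul cohomology is R modulo the ideal of the coefficients. This includes empty Y,
  where both sides say that \<open>f {}\<close> is zero.\<close>

lemma kboundary_top_iff:
  assumes w: "\<And>j. w j \<in> carrier R" and f: "\<And>A. f A \<in> carrier R" and Y: "finite Y"
  shows "kboundary R w {\<zero>} Y (card Y) f \<longleftrightarrow> f Y \<in> genideal R (w ` Y)"
proof
  assume "kboundary R w {\<zero>} Y (card Y) f"
  then obtain g where g: "\<And>A. g A \<in> carrier R"
    "\<And>A. \<lbrakk>A \<subseteq> Y; card A = card Y\<rbrakk> \<Longrightarrow> f A = kdiff R w g A"
    using w f by (rule kboundary_zeroE) blast
  then show "f Y \<in> genideal R (w ` Y)" using kdiff_mem_genideal[OF w g(1)] by simp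
next
  assume r: "f Y \<in> genideal R (w ` Y)"
  have top: "A = Y" if "A \<subseteq> Y" "card A = card Y" for A
    using that Y by (simp add: card_subset_eq)
  \<comment> \<open>In top degree the constant cochain 1 is a cocycle, so the ideal of the
    coefficients kills its class; f is \<open>f Y\<close> times it.\<close>
  have "kcocycle R w {\<zero>} Y (card Y) (\<lambda>A. \<one>)"
    using Y by (rule kcocycle_top)
  then have "kboundary R w {\<zero>} Y (card Y) (\<lambda>A. f Y \<otimes> \<one>)"
    by (intro kboundary_genideal[OF w _ Y r zeroideal]) simp_all
  then show "kboundary R w {\<zero>} Y (card Y) f"
    by (rule kboundary_cong[OF w, rotated 2]) (use f in \<open>auto dest: top\<close>)
qed

text \<open>One family z carries both lists, the generators x on V and the parameters y on Y. The
  last two conclusions are the two directions of one equivalence for fixed N and f: the first is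
  stated at stage m = 0, the second for every m, since vanishing in Cech cohomology supplies an m
  that cannot be chosen.\<close>

lemma parameter_cocycle:
  assumes p: "additive_power R p" "p \<ge> 2"
    and z: "\<And>j. z j \<in> carrier R" and V: "finite V" and Y: "finite Y" "V \<inter> Y = {}"
    and reg: "regular_sequence R as" "length as = card Y"
    and radV: "\<And>a. a \<in> set as \<Longrightarrow> \<exists>n::nat. a [^] n \<in> genideal R (z ` V)"
    and radY: "\<And>a. a \<in> set as \<Longrightarrow> \<exists>n::nat. a [^] n \<in> genideal R (z ` Y)"
    and zV: "\<And>j. j \<in> V \<Longrightarrow> \<exists>n::nat. z j [^] n \<in> genideal R (z ` Y)"
    and a: "a \<in> carrier R"
  obtains N :: nat and f where "\<And>A. f A \<in> carrier R"
    "kcocycle R (\<lambda>j. z j [^] N) {\<zero>} V (card Y) f"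
    "\<And>q. \<lbrakk>additive_power R q; a [^] q \<in> genideal R ((\<lambda>j. z j [^] q) ` Y)\<rbrakk>
      \<Longrightarrow> kboundary R (\<lambda>j. z j [^] (N * q)) {\<zero>} V (card Y) (\<lambda>A. f A [^] q)"
    "\<And>q m. \<lbrakk>additive_power R q;
        kboundary R (\<lambda>j. z j [^] (N * q + m)) {\<zero>} V (card Y)
          (\<lambda>A. finprod R (\<lambda>j. z j [^] m) A \<otimes> f A [^] q)\<rbrakk>
      \<Longrightarrow> a [^] q \<in> genideal R ((\<lambda>j. z j [^] q) ` Y)"
proof -
  let ?d = "card Y"
  have zT: "z ` T \<subseteq> carrier R" for T using z by auto
  have asc: "set as \<subseteq> carrier R" using reg(1) by (simp add: regular_sequence_def)
  obtain k :: "nat \<Rightarrow> nat" where k: "\<And>j. j \<in> V \<Longrightarrow> z j [^] k j \<in> genideal R (z ` Y)"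
    using zV by metis
  \<comment> \<open>Large enough for every x_j^N to lie in (y), which is what the extension of
    cocycles from Y needs.\<close>
  define N where "N = Max (insert 0 (k ` V))"
  have kN: "k j \<le> N" if "j \<in> V" for j unfolding N_def using that V by (intro Max_ge) auto
  define w where "w j = (if j \<in> V then z j [^] N else z j)" for j
  have w: "w j \<in> carrier R" for j using z by (simp add: w_def)
  have wY: "w ` Y = z ` Y" using Y(2) by (intro image_cong) (auto simp: w_def)
  have top: "kcocycle R w {\<zero>} Y ?d (\<lambda>A. a)"
    using Y(1) by (rule kcocycle_top)
  have wV: "w j \<in> genideal R (w ` Y)" if "j \<in> V" for j
    unfolding wY using pow_ideal_mono[OF genideal_ideal[OF zT] z k[OF that] kN[OF that]] that
    by (simp add: w_def)
  obtain f where f: "\<forall>A. f A \<in> carrier R" "\<forall>A\<subseteq>Y. f A = a" "kcocycle R w {\<zero>} (V \<union> Y) ?d f"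
    using kcocycle_lift_union[of w Y V "\<lambda>A. a", OF w Y(1) V _ a top] wV by auto
  note f = f(1)[rule_format] f(2)[rule_format] f(3)
  \<comment> \<open>The twist by x_j^m touches only the indices in V. On Y it is 1, so the
    coefficients there stay y_j^q and the twisted cochain still has the value a^q on Y.\<close>
  define t where "t m j = (if j \<in> V then z j [^] m else \<one>)" for m :: nat and j
  have t: "t m j \<in> carrier R" for m j using z by (simp add: t_def)
  define W where "W q m j = (if j \<in> V then z j [^] (N * q + m) else z j [^] q)" for q m :: nat and j
  have W: "W q m j \<in> carrier R" for q m j using z by (simp add: W_def)
  have Wt: "W q m j = w j [^] q \<otimes> t m j" for q m j
    using z by (simp add: W_def w_def t_def nat_pow_pow nat_pow_mult)
  define F where "F q m A = finprod R (t m) A \<otimes> f A [^] q" for q m :: nat and A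
  have tc: "finprod R (t m) A \<in> carrier R" for m A using t by (intro finprod_closed) auto
  have F: "F q m A \<in> carrier R" for q m A using tc f(1) by (simp add: F_def)
  \<comment> \<open>The q-th power of f is a cocycle for the q-th powers of w, and the transition
    map to exponent Nq + m keeps it one.\<close>
  have cocW: "kcocycle R (W q m) {\<zero>} (V \<union> Y) ?d (F q m)" if q: "additive_power R q" for q m
    unfolding kcocycle_def
  proof (intro allI impI)
    fix B assume B: "B \<subseteq> V \<union> Y" "card B = Suc ?d"
    have fin: "finite B" using B(1) V Y(1) finite_subset by blast
    have "kdiff R (W q m) (F q m) B
        = kdiff R (\<lambda>j. w j [^] q \<otimes> t m j) (\<lambda>A. finprod R (t m) A \<otimes> f A [^] q) B"
      unfolding Wt[abs_def] F_def[abs_def] ..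
    also have "\<dots> = finprod R (t m) B \<otimes> kdiff R (\<lambda>j. w j [^] q) (\<lambda>A. f A [^] q) B"
      using w t f(1) fin by (intro kdiff_twist) auto
    also have "kdiff R (\<lambda>j. w j [^] q) (\<lambda>A. f A [^] q) B = kdiff R w f B [^] q"
      using q w f(1) fin by (rule additive_power_kdiff[symmetric])
    also have "kdiff R w f B = \<zero>" using f(3) B by (rule kcocycle_zeroD)
    finally show "kdiff R (W q m) (F q m) B \<in> {\<zero>}" using tc by (simp add: additive_power_zero[OF q])
  qed
  \<comment> \<open>Vanishing in degree d - 1 for every index set whose z generate, up to radical,
    an ideal containing the regular sequence. Each z_j has a power among the coefficients W, so this
    radical condition survives all choices of q and m. For d = 0 there is no lower degree and
    nothing is needed.\<close>
  have ex: "kexact R (W q m) {\<zero>} I i"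
    if d: "?d = Suc i" and I: "finite I" "\<And>a. a \<in> set as \<Longrightarrow> \<exists>n::nat. a [^] n \<in> genideal R (z ` I)"
    for q m I i
  proof -
    have WI: "W q m ` I \<subseteq> carrier R" using W by auto
    have id: "ideal (genideal R (W q m ` I)) R" using WI by (rule genideal_ideal)
    have rd: "\<exists>k::nat. g [^] k \<in> genideal R (W q m ` I)" if g: "g \<in> z ` I" for g
    proof -
      obtain j where j: "j \<in> I" "g = z j" using g by blast
      have "W q m j \<in> genideal R (W q m ` I)" using genideal_self[OF WI] j(1) by auto
      then show ?thesis unfolding j(2) W_def by (cases "j \<in> V") auto
    qed
    have rad: "\<exists>n::nat. a [^] n \<in> genideal R (W q m ` I)" if aas: "a \<in> set as" for a
    proof -
      obtain n :: nat where n: "a [^] n \<in> genideal R (z ` I)" using I(2)[OF aas] ..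
      have ac: "a \<in> carrier R" using aas asc by (rule subsetD[rotated])
      show ?thesis
        by (rule radical_genideal[OF p id zT finite_imageI[OF I(1)] rd ac n])
    qed
    \<comment> \<open>The empty prefix of the regular sequence means coefficients in R.\<close>
    have "kexact R (W q m) (genideal R (set (take 0 as))) I i"
      by (rule kexact_regular_sequence[OF W I(1) reg(1) rad]) (use reg(2) d in auto)
    then show ?thesis by (simp add: genideal_empty)
  qed
  have rad_mono: "\<exists>n::nat. a [^] n \<in> genideal R (z ` I')"
    if "\<exists>n::nat. a [^] n \<in> genideal R (z ` I)" "I \<subseteq> I'" for a I I'
  proof -
    have "z ` I \<subseteq> genideal R (z ` I')"
      using image_mono[OF that(2)] genideal_self[OF zT] by (rule order_trans)
    then have "genideal R (z ` I) \<subseteq> genideal R (z ` I')"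
      by (rule genideal_minimal[OF genideal_ideal[OF zT]])
    then show ?thesis using that(1) by blast
  qed
  have fY: "F q m Y = a [^] q" for q m
  proof -
    have "finprod R (t m) Y = finprod R (\<lambda>j. \<one>) Y"
      using Y(2) by (intro finprod_cong') (auto simp: t_def)
    then show ?thesis using a by (simp add: F_def f(2))
  qed
  have WY: "W q m ` Y = (\<lambda>j. z j [^] q) ` Y" for q m
    using Y(2) by (intro image_cong) (auto simp: W_def)
  \<comment> \<open>Restriction to V and restriction to Y are both injective on degree d classes
    over the union, so vanishing on V, on Y and on the union are equivalent; on Y it is ideal
    membership.\<close>
  have iffVY: "kboundary R (W q m) {\<zero>} V ?d (F q m) \<longleftrightarrow> a [^] q \<in> genideal R ((\<lambda>j. z j [^] q) ` Y)"
    if q: "additive_power R q" for q m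
  proof -
    have finVY: "I' \<subseteq> V \<union> Y \<Longrightarrow> finite I'" for I' using V Y(1) finite_subset by blast
    have "kboundary R (W q m) {\<zero>} (Y \<union> V) ?d (F q m)" if bd: "kboundary R (W q m) {\<zero>} V ?d (F q m)"
    proof (rule kboundary_union[OF W V Y(1) _ F _ bd])
      fix i' I' assume i: "?d = Suc i'" and I': "V \<subseteq> I'" "I' \<subseteq> Y \<union> V"
      show "kexact R (W q m) {\<zero>} I' i'"
        by (rule ex[OF i]) (use finVY I' rad_mono[OF radV I'(1)] in auto)
    qed (use cocW[OF q] in \<open>simp add: Un_commute\<close>)
    moreover have "kboundary R (W q m) {\<zero>} (V \<union> Y) ?d (F q m)" if bd: "kboundary R (W q m) {\<zero>} Y ?d (F q m)"
    proof (rule kboundary_union[OF W Y(1) V _ F _ bd])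
      fix i' I' assume i: "?d = Suc i'" and I': "Y \<subseteq> I'" "I' \<subseteq> V \<union> Y"
      show "kexact R (W q m) {\<zero>} I' i'"
        by (rule ex[OF i]) (use finVY I' rad_mono[OF radY I'(1)] in auto)
    qed (use cocW[OF q] in simp)
    ultimately have "kboundary R (W q m) {\<zero>} V ?d (F q m) \<longleftrightarrow> kboundary R (W q m) {\<zero>} Y ?d (F q m)"
      by (meson Un_upper1 kboundary_subset)
    then show ?thesis using kboundary_top_iff[of "W q m" "F q m" Y, OF W F Y(1)] by (simp add: fY WY)
  qed
  show thesis
  proof (rule that[of f N])
    show "kcocycle R (\<lambda>j. z j [^] N) {\<zero>} V ?d f" unfolding kcocycle_def
    proof (intro allI impI)
      fix B assume B: "B \<subseteq> V" "card B = Suc ?d"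
      have "kdiff R w f B = kdiff R (\<lambda>j. z j [^] N) f B"
        using B(1) by (intro kdiff_cong_coeff[OF w f(1)]) (auto simp: w_def)
      then show "kdiff R (\<lambda>j. z j [^] N) f B \<in> {\<zero>}"
        using kcocycle_zeroD[OF f(3) _ B(2)] B(1) by auto
    qed
  next
    fix q assume q: "additive_power R q" and "a [^] q \<in> genideal R ((\<lambda>j. z j [^] q) ` Y)"
    then have "kboundary R (W q 0) {\<zero>} V ?d (F q 0)" using iffVY by blast
    then show "kboundary R (\<lambda>j. z j [^] (N * q)) {\<zero>} V ?d (\<lambda>A. f A [^] q)"
    proof (rule kboundary_cong[OF W, rotated 2])
      fix A assume "A \<subseteq> V"
      then have "finprod R (t 0) A = finprod R (\<lambda>j. \<one>) A"
        by (intro finprod_cong') (auto simp: t_def)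
      then show "F q 0 A = f A [^] q" using f(1) by (simp add: F_def)
    qed (simp add: W_def)
  next
    fix q m assume q: "additive_power R q"
      and bd: "kboundary R (\<lambda>j. z j [^] (N * q + m)) {\<zero>} V ?d
          (\<lambda>A. finprod R (\<lambda>j. z j [^] m) A \<otimes> f A [^] q)"
    have zc: "z j [^] (N * q + m) \<in> carrier R" for j using z by simp
    have "kboundary R (W q m) {\<zero>} V ?d (F q m)"
    proof (rule kboundary_cong[OF zc _ _ bd])
      fix A assume "A \<subseteq> V"
      then have "finprod R (\<lambda>j. z j [^] m) A = finprod R (t m) A"
        using t by (intro finprod_cong') (auto simp: t_def)
      then show "finprod R (\<lambda>j. z j [^] m) A \<otimes> f A [^] q = F q m A" by (simp add: F_def)
    qed (simp add: W_def)
    then show "a [^] q \<in> genideal R ((\<lambda>j. z j [^] q) ` Y)" using iffVY[OF q] by blast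
  qed (rule f(1))
qed

end

section \<open>Localisation\<close>

lemma UN_UN_constant:
  assumes "x0 \<in> A" "y0 \<in> B" "\<And>x y. \<lbrakk>x \<in> A; y \<in> B\<rbrakk> \<Longrightarrow> F x y = C"
  shows "(\<Union>x\<in>A. \<Union>y\<in>B. F x y) = C"
proof -
  have "(\<Union>x\<in>A. \<Union>y\<in>B. F x y) = (\<Union>x\<in>A. \<Union>y\<in>B. C)"
    using assms(3) by (intro SUP_cong) auto
  then show ?thesis using assms(1,2) by auto
qed

locale mult_set = cring S for S (structure) +
  fixes W :: "'a set"
  assumes W_carrier: "W \<subseteq> carrier S" and one_W [simp]: "\<one> \<in> W"
    and mult_W [simp]: "\<lbrakk>s \<in> W; t \<in> W\<rbrakk> \<Longrightarrow> s \<otimes> t \<in> W"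
begin

abbreviation "fr \<equiv> loc_frac S W"
abbreviation "L \<equiv> localization S W"

lemma W_mem [simp]: "s \<in> W \<Longrightarrow> s \<in> carrier S"
  using W_carrier by blast

lemma pow_W [simp]: "s \<in> W \<Longrightarrow> s [^] (n::nat) \<in> W"
  by (induction n) simp_all

lemma frac_mem:
  assumes "a \<in> carrier S" "s \<in> W"
  shows "(b, t) \<in> fr a s \<longleftrightarrow> b \<in> carrier S \<and> t \<in> W \<and> (\<exists>w\<in>W. w \<otimes> (a \<otimes> t) = w \<otimes> (b \<otimes> s))"
proof -
  have "w \<otimes> (a \<otimes> t \<ominus> b \<otimes> s) = \<zero> \<longleftrightarrow> w \<otimes> (a \<otimes> t) = w \<otimes> (b \<otimes> s)"
    if "b \<in> carrier S" "t \<in> W" "w \<in> W" for w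
  proof -
    have "w \<otimes> (a \<otimes> t \<ominus> b \<otimes> s) = w \<otimes> (a \<otimes> t) \<ominus> w \<otimes> (b \<otimes> s)"
      using that assms W_mem[of w] W_mem[of s] W_mem[of t] by algebra
    then show ?thesis using that assms by (simp add: minus_eq_zero_iff)
  qed
  then show ?thesis by (auto simp: loc_frac_def)
qed

lemma frac_trans:
  assumes a: "a \<in> carrier S" "s \<in> W" and b: "(b, t) \<in> fr a s" and c: "(c, u) \<in> fr b t"
  shows "(c, u) \<in> fr a s"
proof -
  obtain w where w: "b \<in> carrier S" "t \<in> W" "w \<in> W" "w \<otimes> (a \<otimes> t) = w \<otimes> (b \<otimes> s)"
    using b a by (auto simp: frac_mem)
  obtain v where v: "c \<in> carrier S" "u \<in> W" "v \<in> W" "v \<otimes> (b \<otimes> u) = v \<otimes> (c \<otimes> t)"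
    using c w by (auto simp: frac_mem)
  note m = a w(1) v(1) W_mem[OF a(2)] W_mem[OF w(2)] W_mem[OF w(3)] W_mem[OF v(2)] W_mem[OF v(3)]
  \<comment> \<open>The middle denominator t cannot be cancelled, so it becomes part of the
    multiplier.\<close>
  have "(w \<otimes> v \<otimes> t) \<otimes> (a \<otimes> u) = (v \<otimes> u) \<otimes> (w \<otimes> (a \<otimes> t))"
    using m by (simp add: m_ac)
  also have "\<dots> = (w \<otimes> s) \<otimes> (v \<otimes> (b \<otimes> u))" unfolding w(4) using m by (simp add: m_ac)
  also have "\<dots> = (w \<otimes> v \<otimes> t) \<otimes> (c \<otimes> s)" unfolding v(4) using m by (simp add: m_ac)
  finally have "(w \<otimes> v \<otimes> t) \<otimes> (a \<otimes> u) = (w \<otimes> v \<otimes> t) \<otimes> (c \<otimes> s)" .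
  moreover have "w \<otimes> v \<otimes> t \<in> W" using w v by simp
  ultimately show ?thesis using a v by (auto simp: frac_mem)
qed

lemma frac_sym:
  assumes a: "a \<in> carrier S" "s \<in> W" and b: "(b, t) \<in> fr a s"
  shows "(a, s) \<in> fr b t"
proof -
  have "b \<in> carrier S" "t \<in> W" using b a by (auto simp: frac_mem)
  then show ?thesis using b a by (simp add: frac_mem) metis
qed

lemma frac_eq:
  assumes a: "a \<in> carrier S" "s \<in> W" and b: "(b, t) \<in> fr a s"
  shows "fr b t = fr a s"
proof -
  have bt: "b \<in> carrier S" "t \<in> W" using b a by (auto simp: frac_mem)
  have "x \<in> fr b t \<longleftrightarrow> x \<in> fr a s" for x
    by (cases x) (use frac_trans[OF a b] frac_trans[OF bt frac_sym[OF a b]] in blast)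
  then show ?thesis by blast
qed

lemma frac_self: "\<lbrakk>a \<in> carrier S; s \<in> W\<rbrakk> \<Longrightarrow> (a, s) \<in> fr a s"
  by (auto simp: frac_mem)

lemma frac_eq_iff:
  assumes "a \<in> carrier S" "s \<in> W" "b \<in> carrier S" "t \<in> W"
  shows "fr a s = fr b t \<longleftrightarrow> (\<exists>w\<in>W. w \<otimes> (a \<otimes> t) = w \<otimes> (b \<otimes> s))"
proof -
  have "fr a s = fr b t \<longleftrightarrow> (b, t) \<in> fr a s"
    using frac_eq[OF assms(1,2)] frac_self[OF assms(3,4)] by auto
  then show ?thesis using assms by (simp add: frac_mem)
qed

lemma frac_eqI:
  assumes "a \<in> carrier S" "s \<in> W" "b \<in> carrier S" "t \<in> W" "a \<otimes> t = b \<otimes> s"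
  shows "fr a s = fr b t"
  using assms by (subst frac_eq_iff) (auto intro!: bexI[of _ \<one>])

lemma loc_carrier: "carrier L = {fr a s | a s. a \<in> carrier S \<and> s \<in> W}"
  and loc_one: "\<one>\<^bsub>L\<^esub> = fr \<one> \<one>" and loc_zero: "\<zero>\<^bsub>L\<^esub> = fr \<zero> \<one>"
  by (simp_all add: localization_def)

lemma frac_closed [simp]: "\<lbrakk>a \<in> carrier S; s \<in> W\<rbrakk> \<Longrightarrow> fr a s \<in> carrier L"
  by (auto simp: loc_carrier)

lemma loc_cases:
  assumes "x \<in> carrier L"
  obtains a s where "x = fr a s" "a \<in> carrier S" "s \<in> W"
  using assms by (auto simp: loc_carrier)

lemma loc_mult:
  assumes a: "a \<in> carrier S" "s \<in> W" and b: "b \<in> carrier S" "t \<in> W"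
  shows "fr a s \<otimes>\<^bsub>L\<^esub> fr b t = fr (a \<otimes> b) (s \<otimes> t)"
proof -
  have "fr (c \<otimes> d) (u \<otimes> v) = fr (a \<otimes> b) (s \<otimes> t)"
    if c: "(c, u) \<in> fr a s" and d: "(d, v) \<in> fr b t" for c d u v
  proof -
    obtain w where w: "c \<in> carrier S" "u \<in> W" "w \<in> W" "w \<otimes> (a \<otimes> u) = w \<otimes> (c \<otimes> s)"
      using c a by (auto simp: frac_mem)
    obtain w' where w': "d \<in> carrier S" "v \<in> W" "w' \<in> W" "w' \<otimes> (b \<otimes> v) = w' \<otimes> (d \<otimes> t)"
      using d b by (auto simp: frac_mem)
    note m = a(1) b(1) w(1) w'(1) W_mem[OF a(2)] W_mem[OF b(2)] W_mem[OF w(2)] W_mem[OF w(3)] W_mem[OF w'(2)] W_mem[OF w'(3)]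
    have "w \<otimes> w' \<otimes> ((c \<otimes> d) \<otimes> (s \<otimes> t)) = (w \<otimes> (c \<otimes> s)) \<otimes> (w' \<otimes> (d \<otimes> t))"
      using m by (simp add: m_ac)
    also have "\<dots> = w \<otimes> w' \<otimes> ((a \<otimes> b) \<otimes> (u \<otimes> v))"
      unfolding w(4)[symmetric] w'(4)[symmetric] using m by (simp add: m_ac)
    finally show ?thesis using a b w w' by (subst frac_eq_iff) (auto intro!: bexI[of _ "w \<otimes> w'"])
  qed
  then have "(\<Union>x\<in>fr a s. \<Union>y\<in>fr b t. fr (fst x \<otimes> fst y) (snd x \<otimes> snd y))
      = fr (a \<otimes> b) (s \<otimes> t)"
    by (intro UN_UN_constant[OF frac_self[OF a] frac_self[OF b]]) (metis prod.collapse)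
  then show ?thesis by (simp add: localization_def)
qed

lemma loc_add:
  assumes a: "a \<in> carrier S" "s \<in> W" and b: "b \<in> carrier S" "t \<in> W"
  shows "fr a s \<oplus>\<^bsub>L\<^esub> fr b t = fr (a \<otimes> t \<oplus> b \<otimes> s) (s \<otimes> t)"
proof -
  have "fr (c \<otimes> v \<oplus> d \<otimes> u) (u \<otimes> v) = fr (a \<otimes> t \<oplus> b \<otimes> s) (s \<otimes> t)"
    if c: "(c, u) \<in> fr a s" and d: "(d, v) \<in> fr b t" for c d u v
  proof -
    obtain w where w: "c \<in> carrier S" "u \<in> W" "w \<in> W" "w \<otimes> (a \<otimes> u) = w \<otimes> (c \<otimes> s)"
      using c a by (auto simp: frac_mem)
    obtain w' where w': "d \<in> carrier S" "v \<in> W" "w' \<in> W" "w' \<otimes> (b \<otimes> v) = w' \<otimes> (d \<otimes> t)"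
      using d b by (auto simp: frac_mem)
    note m = a(1) b(1) w(1) w'(1) W_mem[OF a(2)] W_mem[OF b(2)] W_mem[OF w(2)] W_mem[OF w(3)] W_mem[OF w'(2)] W_mem[OF w'(3)]
    have "w \<otimes> w' \<otimes> ((c \<otimes> v \<oplus> d \<otimes> u) \<otimes> (s \<otimes> t))
        = (w \<otimes> (c \<otimes> s)) \<otimes> (w' \<otimes> t \<otimes> v) \<oplus> (w' \<otimes> (d \<otimes> t)) \<otimes> (w \<otimes> s \<otimes> u)"
      using m by algebra
    also have "\<dots> = w \<otimes> w' \<otimes> ((a \<otimes> t \<oplus> b \<otimes> s) \<otimes> (u \<otimes> v))"
      unfolding w(4)[symmetric] w'(4)[symmetric] using m by algebra
    finally show ?thesis using a b w w' by (subst frac_eq_iff) (auto intro!: bexI[of _ "w \<otimes> w'"])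
  qed
  then have "(\<Union>x\<in>fr a s. \<Union>y\<in>fr b t. fr (fst x \<otimes> snd y \<oplus> fst y \<otimes> snd x) (snd x \<otimes> snd y))
      = fr (a \<otimes> t \<oplus> b \<otimes> s) (s \<otimes> t)"
    by (intro UN_UN_constant[OF frac_self[OF a] frac_self[OF b]]) (metis prod.collapse)
  then show ?thesis by (simp add: localization_def)
qed

lemma cring_loc: "cring L"
proof (rule cringI)
  show "abelian_group L"
  proof (rule abelian_groupI)
    fix x y assume "x \<in> carrier L" "y \<in> carrier L"
    then obtain a s b t where e: "x = fr a s" "a \<in> carrier S" "s \<in> W" "y = fr b t" "b \<in> carrier S" "t \<in> W"
      by (meson loc_cases)
    then show "x \<oplus>\<^bsub>L\<^esub> y \<in> carrier L" by (simp add: loc_add)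
    show "x \<oplus>\<^bsub>L\<^esub> y = y \<oplus>\<^bsub>L\<^esub> x"
      using e by (simp add: loc_add m_comm a_comm)
    fix z assume "z \<in> carrier L"
    then obtain c u where f: "z = fr c u" "c \<in> carrier S" "u \<in> W" by (meson loc_cases)
    have "(a \<otimes> t \<oplus> b \<otimes> s) \<otimes> u \<oplus> c \<otimes> (s \<otimes> t) = a \<otimes> (t \<otimes> u) \<oplus> (b \<otimes> u \<oplus> c \<otimes> t) \<otimes> s"
      using e(2,5) f(2) W_mem[OF e(3)] W_mem[OF e(6)] W_mem[OF f(3)] by algebra
    then show "x \<oplus>\<^bsub>L\<^esub> y \<oplus>\<^bsub>L\<^esub> z = x \<oplus>\<^bsub>L\<^esub> (y \<oplus>\<^bsub>L\<^esub> z)"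
      using e f by (simp add: loc_add m_assoc)
  next
    fix x assume "x \<in> carrier L"
    then obtain a s where e: "x = fr a s" "a \<in> carrier S" "s \<in> W" by (meson loc_cases)
    then show "\<zero>\<^bsub>L\<^esub> \<oplus>\<^bsub>L\<^esub> x = x" by (simp add: loc_zero loc_add)
    have "fr (\<ominus> a) s \<oplus>\<^bsub>L\<^esub> x = \<zero>\<^bsub>L\<^esub>"
      unfolding e(1) loc_zero using e by (simp add: loc_add l_minus l_neg) (intro frac_eqI; simp)
    then show "\<exists>y\<in>carrier L. y \<oplus>\<^bsub>L\<^esub> x = \<zero>\<^bsub>L\<^esub>" using e by (intro bexI[of _ "fr (\<ominus> a) s"]) auto
  qed (simp add: loc_zero)
  show "comm_monoid L"
  proof (rule comm_monoidI)
    fix x y assume "x \<in> carrier L" "y \<in> carrier L"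
    then obtain a s b t where e: "x = fr a s" "a \<in> carrier S" "s \<in> W" "y = fr b t" "b \<in> carrier S" "t \<in> W"
      by (meson loc_cases)
    then show "x \<otimes>\<^bsub>L\<^esub> y \<in> carrier L" by (simp add: loc_mult)
    show "x \<otimes>\<^bsub>L\<^esub> y = y \<otimes>\<^bsub>L\<^esub> x" using e by (simp add: loc_mult m_comm)
    fix z assume "z \<in> carrier L"
    then obtain c u where f: "z = fr c u" "c \<in> carrier S" "u \<in> W" by (meson loc_cases)
    show "x \<otimes>\<^bsub>L\<^esub> y \<otimes>\<^bsub>L\<^esub> z = x \<otimes>\<^bsub>L\<^esub> (y \<otimes>\<^bsub>L\<^esub> z)"
      using e f by (simp add: loc_mult m_assoc)
  next
    fix x assume "x \<in> carrier L"
    then show "\<one>\<^bsub>L\<^esub> \<otimes>\<^bsub>L\<^esub> x = x" by (rule loc_cases) (simp add: loc_one loc_mult)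
  qed (simp add: loc_one)
  fix x y z assume "x \<in> carrier L" "y \<in> carrier L" "z \<in> carrier L"
  then obtain a s b t c u where e: "x = fr a s" "a \<in> carrier S" "s \<in> W" "y = fr b t" "b \<in> carrier S" "t \<in> W"
    and f: "z = fr c u" "c \<in> carrier S" "u \<in> W"
    by (meson loc_cases)
  note m = e(2,5) f(2) W_mem[OF e(3)] W_mem[OF e(6)] W_mem[OF f(3)]
  have "((a \<otimes> t \<oplus> b \<otimes> s) \<otimes> c) \<otimes> ((s \<otimes> u) \<otimes> (t \<otimes> u))
      = ((a \<otimes> c) \<otimes> (t \<otimes> u) \<oplus> (b \<otimes> c) \<otimes> (s \<otimes> u)) \<otimes> ((s \<otimes> t) \<otimes> u)"
    using m by algebra
  then have "fr ((a \<otimes> t \<oplus> b \<otimes> s) \<otimes> c) ((s \<otimes> t) \<otimes> u)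
      = fr ((a \<otimes> c) \<otimes> (t \<otimes> u) \<oplus> (b \<otimes> c) \<otimes> (s \<otimes> u)) ((s \<otimes> u) \<otimes> (t \<otimes> u))"
    using e f by (intro frac_eqI) simp_all
  then show "(x \<oplus>\<^bsub>L\<^esub> y) \<otimes>\<^bsub>L\<^esub> z = x \<otimes>\<^bsub>L\<^esub> z \<oplus>\<^bsub>L\<^esub> y \<otimes>\<^bsub>L\<^esub> z"
    using e f by (simp add: loc_mult loc_add)
qed

sublocale loc: cring L
  by (rule cring_loc)

lemma frac_add_same:
  assumes "a \<in> carrier S" "b \<in> carrier S" "s \<in> W"
  shows "fr a s \<oplus>\<^bsub>L\<^esub> fr b s = fr (a \<oplus> b) s"
proof -
  have "(a \<otimes> s \<oplus> b \<otimes> s) \<otimes> s = (a \<oplus> b) \<otimes> (s \<otimes> s)"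
    using assms(1,2) W_mem[OF assms(3)] by algebra
  then have "fr (a \<otimes> s \<oplus> b \<otimes> s) (s \<otimes> s) = fr (a \<oplus> b) s"
    using assms by (intro frac_eqI) simp_all
  then show ?thesis using assms by (simp add: loc_add)
qed

lemma frac_zero [simp]: "s \<in> W \<Longrightarrow> fr \<zero> s = \<zero>\<^bsub>L\<^esub>"
  unfolding loc_zero by (intro frac_eqI) auto

lemma frac_one [simp]: "s \<in> W \<Longrightarrow> fr s s = \<one>\<^bsub>L\<^esub>"
  unfolding loc_one by (intro frac_eqI) auto

lemma frac_minus:
  assumes "a \<in> carrier S" "s \<in> W"
  shows "fr (\<ominus> a) s = \<ominus>\<^bsub>L\<^esub> fr a s"
  using assms by (intro loc.minus_equality[symmetric]) (auto simp: frac_add_same l_neg)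

lemma frac_signed:
  "\<lbrakk>a \<in> carrier S; s \<in> W\<rbrakk> \<Longrightarrow> fr (signed S n a) s = signed L n (fr a s)"
  by (simp add: signed_def frac_minus)

lemma frac_finsum:
  assumes "finite A" "\<And>i. i \<in> A \<Longrightarrow> f i \<in> carrier S" "s \<in> W"
  shows "finsum L (\<lambda>i. fr (f i) s) A = fr (finsum S f A) s"
  using assms(1,2)
proof (induction A)
  case empty
  show ?case using frac_zero[OF assms(3)] by simp
next
  case (insert x F)
  have c: "finsum S f F \<in> carrier S" "f x \<in> carrier S"
    using insert.prems by (auto intro: finsum_closed)
  have "finsum L (\<lambda>i. fr (f i) s) (insert x F) = fr (f x) s \<oplus>\<^bsub>L\<^esub> finsum L (\<lambda>i. fr (f i) s) F"
    using insert.hyps insert.prems assms(3) by (intro loc.finsum_insert) auto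
  also have "\<dots> = fr (f x \<oplus> finsum S f F) s"
    using insert.IH insert.prems c assms(3) by (simp add: frac_add_same)
  also have "f x \<oplus> finsum S f F = finsum S f (insert x F)"
    using insert.hyps insert.prems by (intro finsum_insert[symmetric]) auto
  finally show ?case .
qed

lemma frac_pow:
  assumes "a \<in> carrier S" "s \<in> W"
  shows "fr a s [^]\<^bsub>L\<^esub> (n::nat) = fr (a [^] n) (s [^] n)"
  using assms by (induction n) (simp_all add: loc_mult)

lemma frac_cancel:
  "\<lbrakk>a \<in> carrier S; s \<in> W; u \<in> W\<rbrakk> \<Longrightarrow> fr (u \<otimes> a) (u \<otimes> s) = fr a s"
  by (intro frac_eqI) (auto simp: m_ac)

lemma frac_eq_zero_iff:
  assumes "a \<in> carrier S" "s \<in> W"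
  shows "fr a s = \<zero>\<^bsub>L\<^esub> \<longleftrightarrow> (\<exists>w\<in>W. w \<otimes> a = \<zero>)"
  unfolding loc_zero using assms by (simp only: frac_eq_iff one_W zero_closed) simp

lemma frac_hom: "(\<lambda>a. fr a \<one>) \<in> ring_hom S L"
  by (rule ring_hom_memI) (auto simp: loc_mult frac_add_same)

lemma additive_power_loc:
  assumes q: "additive_power S q"
  shows "additive_power L q"
proof -
  have "(x \<oplus>\<^bsub>L\<^esub> y) [^]\<^bsub>L\<^esub> q = x [^]\<^bsub>L\<^esub> q \<oplus>\<^bsub>L\<^esub> y [^]\<^bsub>L\<^esub> q"
    if xy: "x \<in> carrier L" "y \<in> carrier L" for x y
  proof -
    obtain a s b t where e: "x = fr a s" "a \<in> carrier S" "s \<in> W" "y = fr b t" "b \<in> carrier S" "t \<in> W"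
      using xy by (meson loc_cases)
    then show ?thesis
      by (simp add: loc_add frac_pow additive_powerD[OF q] nat_pow_distrib)
  qed
  then show ?thesis using q by (simp add: additive_power_def)
qed

text \<open>Denominators are multiplied up over the finite set. The numerators form a total function
  into the carrier, so that they can serve as a cochain.\<close>

lemma common_denominator:
  assumes "finite \<A>" "\<And>A. A \<in> \<A> \<Longrightarrow> f A \<in> carrier L"
  obtains s g where "s \<in> W" "\<And>A. g A \<in> carrier S" "\<And>A. A \<in> \<A> \<Longrightarrow> f A = fr (g A) s"
proof -
  have "\<exists>s\<in>W. \<exists>g. (\<forall>A. g A \<in> carrier S) \<and> (\<forall>A\<in>\<A>. f A = fr (g A) s)"
    using assms
  proof (induction \<A>)
    case empty
    then show ?case by (intro bexI[of _ \<one>] exI[of _ "\<lambda>_. \<zero>"]) auto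
  next
    case (insert B \<A>)
    then have "\<exists>s\<in>W. \<exists>g. (\<forall>A. g A \<in> carrier S) \<and> (\<forall>A\<in>\<A>. f A = fr (g A) s)" by simp
    then obtain s g where g: "s \<in> W" "\<And>A. g A \<in> carrier S" "\<And>A. A \<in> \<A> \<Longrightarrow> f A = fr (g A) s"
      by blast
    obtain b t where b: "f B = fr b t" "b \<in> carrier S" "t \<in> W" using insert.prems by (meson insertI1 loc_cases)
    let ?g = "\<lambda>A. if A = B then s \<otimes> b else t \<otimes> g A"
    have 1: "f A = fr (?g A) (s \<otimes> t)" if A: "A \<in> insert B \<A>" for A
    proof (cases "A = B")
      case True
      then show ?thesis using b g(1) by (simp add: frac_cancel)
    next
      case False
      then have "f A = fr (g A) s" using A g(3) by blast
      also have "\<dots> = fr (t \<otimes> g A) (t \<otimes> s)" using g b by (simp add: frac_cancel)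
      also have "t \<otimes> s = s \<otimes> t" using g(1) b(3) by (simp add: m_comm)
      finally show ?thesis using False by simp
    qed
    have 2: "?g A \<in> carrier S" for A using g b by simp
    have "s \<otimes> t \<in> W" using g(1) b(3) by simp
    moreover have "(\<forall>A. ?g A \<in> carrier S) \<and> (\<forall>A\<in>insert B \<A>. f A = fr (?g A) (s \<otimes> t))"
      using 1 2 by blast
    ultimately show ?case by (intro bexI exI)
  qed
  then show thesis using that by blast
qed

lemma common_annihilator:
  assumes "finite \<A>" "\<And>A. A \<in> \<A> \<Longrightarrow> a A \<in> carrier S" "\<And>A. A \<in> \<A> \<Longrightarrow> \<exists>w\<in>W. w \<otimes> a A = \<zero>"
  obtains w where "w \<in> W" "\<And>A. A \<in> \<A> \<Longrightarrow> w \<otimes> a A = \<zero>"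
proof -
  have "\<exists>w\<in>W. \<forall>A\<in>\<A>. w \<otimes> a A = \<zero>"
    using assms
  proof (induction \<A>)
    case empty
    then show ?case using one_W by blast
  next
    case (insert B \<A>)
    then obtain w where w: "w \<in> W" "\<And>A. A \<in> \<A> \<Longrightarrow> w \<otimes> a A = \<zero>" by auto
    obtain v where v: "v \<in> W" "v \<otimes> a B = \<zero>" using insert.prems by auto
    have "(w \<otimes> v) \<otimes> a A = \<zero>" if A: "A \<in> insert B \<A>" for A
    proof (cases "A = B")
      case True
      then show ?thesis using v w(1) insert.prems(1)[OF A] by (simp add: m_assoc)
    next
      case False
      then have "w \<otimes> a A = \<zero>" using w(2) A by blast
      then have "v \<otimes> (w \<otimes> a A) = \<zero>" using v(1) by simp
      then show ?thesis using v(1) w(1) insert.prems(1)[OF A] by (simp add: m_ac)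
    qed
    then show ?case using w(1) v(1) by (intro bexI[of _ "w \<otimes> v"]) auto
  qed
  then show thesis using that by blast
qed

end

lemma loc_map_frac:
  assumes "mult_set S W" "mult_set S W'" "W \<subseteq> W'" "a \<in> carrier S" "s \<in> W"
  shows "loc_map S W' (loc_frac S W a s) = loc_frac S W' a s"
proof -
  interpret A: mult_set S W by fact
  interpret B: mult_set S W' by fact
  have s': "s \<in> W'" using assms(3,5) by blast
  have "loc_frac S W' b t = loc_frac S W' a s" if "(b, t) \<in> loc_frac S W a s" for b t
  proof (rule B.frac_eq)
    show "(b, t) \<in> loc_frac S W' a s"
      using that s' assms(3-5) by (auto simp: A.frac_mem B.frac_mem[OF assms(4) s'])
  qed (use assms(4) s' in auto)
  then have "loc_map S W' (loc_frac S W a s) = (\<Union>x\<in>loc_frac S W a s. loc_frac S W' a s)"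
    unfolding loc_map_def by (intro SUP_cong) auto
  then show ?thesis using A.frac_self[OF assms(4,5)] by auto
qed

section \<open>The Cech complex as a limit of Koszul complexes\<close>

locale cech = cring S for S :: "('a, 'm) ring_scheme" (structure) +
  fixes xs :: "'a list"
  assumes xs_carrier: "set xs \<subseteq> carrier S"
begin

text \<open>The default 1 past the end of the list makes this a total family in the carrier, as
  Koszul coefficients have to be.\<close>

definition var :: "nat \<Rightarrow> 'a"
  where "var j = (if j < length xs then xs ! j else \<one>)"

text \<open>Monomials with equal exponents. They are cofinal under divisibility among the
  denominators of the Cech ring and index the direct limit.\<close>

definition xpow :: "nat set \<Rightarrow> nat \<Rightarrow> 'a"
  where "xpow A k = finprod S (\<lambda>j. var j [^] k) A"

abbreviation "idx \<equiv> {..<length xs}"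
abbreviation "denoms \<equiv> cech_denoms S xs"
abbreviation "LR A \<equiv> cech_ring S xs A"
abbreviation "CM i \<equiv> cech_module S xs i"

text \<open>The canonical map from the Koszul complex on the k-th powers of the generators, in
  degree i, to the Cech complex.\<close>

definition cochain :: "(nat set \<Rightarrow> 'a) \<Rightarrow> nat \<Rightarrow> nat \<Rightarrow> nat set \<Rightarrow> ('a \<times> 'a) set"
  where "cochain f k i = (\<lambda>A\<in>cech_index xs i. loc_frac S (denoms A) (f A) (xpow A k))"

lemma nth_closed [simp]: "j < length xs \<Longrightarrow> xs ! j \<in> carrier S"
  using xs_carrier nth_mem by blast

lemma var_closed [simp]: "var j \<in> carrier S"
  by (simp add: var_def)

lemma xpow_closed [simp]: "xpow A k \<in> carrier S"
  unfolding xpow_def by (intro finprod_closed) auto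

lemma xpow_zero [simp]: "xpow A 0 = \<one>"
  by (simp add: xpow_def finprod_one_eqI)

lemma xpow_add: "xpow A (k + m) = xpow A k \<otimes> xpow A m"
  unfolding xpow_def by (subst finprod_multf[symmetric]) (auto simp: nat_pow_mult)

lemma xpow_remove:
  assumes "finite A" "j \<in> A"
  shows "xpow A k = var j [^] k \<otimes> xpow (A - {j}) k"
proof -
  have "xpow (insert j (A - {j})) k = var j [^] k \<otimes> xpow (A - {j}) k"
    unfolding xpow_def using assms by (intro finprod_insert) auto
  then show ?thesis using assms by (simp add: insert_absorb)
qed

lemma xpow_pow: "xpow A k [^] (q::nat) = xpow A (k * q)"
  by (induction q) (simp_all add: xpow_add m_comm)

lemma idx_finite: "A \<subseteq> idx \<Longrightarrow> finite A"
  using finite_subset by blast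

lemma index_iff: "A \<in> cech_index xs i \<longleftrightarrow> A \<subseteq> idx \<and> card A = i"
  by (simp add: cech_index_def)

lemma denoms_eq:
  assumes A: "A \<subseteq> idx"
  shows "denoms A = {finprod S (\<lambda>j. var j [^] k j) A | k :: nat \<Rightarrow> nat. True}"
proof -
  have "finprod S (\<lambda>i. xs ! i [^] k i) A = finprod S (\<lambda>j. var j [^] k j) A" for k :: "nat \<Rightarrow> nat"
    using A xs_carrier by (intro finprod_cong') (auto simp: var_def)
  then show ?thesis unfolding cech_denoms_def by simp
qed

lemma denomsI: "A \<subseteq> idx \<Longrightarrow> finprod S (\<lambda>j. var j [^] (k j :: nat)) A \<in> denoms A"
  unfolding denoms_eq by (intro CollectI exI[of _ k]) simp

lemma xpow_denoms: "A \<subseteq> idx \<Longrightarrow> xpow A k \<in> denoms A"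
  unfolding xpow_def by (rule denomsI)

lemma denoms_mult_set:
  assumes A: "A \<subseteq> idx"
  shows "mult_set S (denoms A)"
proof
  show "denoms A \<subseteq> carrier S" unfolding denoms_eq[OF A] by (auto intro!: finprod_closed)
  show "\<one> \<in> denoms A" using xpow_denoms[OF A, of 0] by simp
  fix s t assume "s \<in> denoms A" "t \<in> denoms A"
  then obtain k l :: "nat \<Rightarrow> nat" where "s = finprod S (\<lambda>j. var j [^] k j) A" "t = finprod S (\<lambda>j. var j [^] l j) A"
    unfolding denoms_eq[OF A] by blast
  then have "s \<otimes> t = finprod S (\<lambda>j. var j [^] (k j + l j)) A"
    by (simp add: nat_pow_mult[symmetric] finprod_multf)
  then show "s \<otimes> t \<in> denoms A" using denomsI[OF A, of "\<lambda>j. k j + l j"] by simp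
qed

text \<open>Take K as the largest exponent in the monomial w. The claim covers all larger k so that
  finitely many index sets can share one exponent.\<close>

lemma denoms_divide:
  assumes A: "A \<subseteq> idx" and w: "w \<in> denoms A"
  shows "\<exists>K. \<forall>k\<ge>K. \<exists>u\<in>denoms A. u \<otimes> w = xpow A k"
proof -
  obtain l :: "nat \<Rightarrow> nat" where l: "w = finprod S (\<lambda>j. var j [^] l j) A"
    using w unfolding denoms_eq[OF A] by blast
  define K where "K = Max (insert 0 (l ` A))"
  have lK: "l j \<le> K" if "j \<in> A" for j
    unfolding K_def using that idx_finite[OF A] by (intro Max_ge) auto
  have "\<exists>u\<in>denoms A. u \<otimes> w = xpow A k" if k: "k \<ge> K" for k
  proof (rule bexI)
    have "finprod S (\<lambda>j. var j [^] (k - l j)) A \<otimes> w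
        = finprod S (\<lambda>j. var j [^] (k - l j) \<otimes> var j [^] l j) A"
      unfolding l by (intro finprod_multf[symmetric]) auto
    also have "\<dots> = xpow A k"
      unfolding xpow_def using order_trans[OF lK k] by (intro finprod_cong') (auto simp: nat_pow_mult)
    finally show "finprod S (\<lambda>j. var j [^] (k - l j)) A \<otimes> w = xpow A k" .
    show "finprod S (\<lambda>j. var j [^] (k - l j)) A \<in> denoms A" using A by (rule denomsI)
  qed
  then show ?thesis by blast
qed

lemma denoms_diff:
  assumes A: "A \<subseteq> idx" and j: "j \<in> A"
  shows "denoms (A - {j}) \<subseteq> denoms A"
proof
  fix w assume "w \<in> denoms (A - {j})"
  then obtain l :: "nat \<Rightarrow> nat" where l: "w = finprod S (\<lambda>i. var i [^] l i) (A - {j})"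
    using denoms_eq[of "A - {j}"] A by blast
  have "finprod S (\<lambda>i. var i [^] (if i = j then 0 else l i)) (insert j (A - {j}))
      = var j [^] (0::nat) \<otimes> finprod S (\<lambda>i. var i [^] (if i = j then 0 else l i)) (A - {j})"
    using idx_finite[OF A] by (subst finprod_insert) auto
  also have "\<dots> = w" unfolding l by (simp, intro finprod_cong') auto
  finally have "w = finprod S (\<lambda>i. var i [^] (if i = j then 0 else l i)) A"
    using j by (simp add: insert_absorb)
  then show "w \<in> denoms A" using denomsI[OF A] by simp
qed

lemma finite_index: "finite (cech_index xs i)"
  unfolding cech_index_def by simp

lemma uniform_bound:
  assumes "finite \<A>" "\<And>A. A \<in> \<A> \<Longrightarrow> \<exists>K::nat. \<forall>k\<ge>K. P A k"
  shows "\<exists>K. \<forall>A\<in>\<A>. P A K"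
proof -
  obtain K where K: "\<And>A k. \<lbrakk>A \<in> \<A>; k \<ge> K A\<rbrakk> \<Longrightarrow> P A k" using assms(2) by metis
  have "P A (Max (insert 0 (K ` \<A>)))" if "A \<in> \<A>" for A
    using that assms(1) by (intro K Max_ge) auto
  then show ?thesis by blast
qed

lemma cochain_apply:
  "\<lbrakk>A \<subseteq> idx; card A = i\<rbrakk> \<Longrightarrow> cochain f k i A = loc_frac S (denoms A) (f A) (xpow A k)"
  by (simp add: cochain_def index_iff)

lemma cochain_closed:
  assumes "\<And>A. f A \<in> carrier S"
  shows "cochain f k i \<in> carrier (CM i)"
  unfolding cochain_def cech_module_def
  using assms mult_set.frac_closed[OF denoms_mult_set] xpow_denoms
  by (auto simp: index_iff cech_ring_def)

lemma cochain_cong: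
  assumes "\<And>A. \<lbrakk>A \<subseteq> idx; card A = i\<rbrakk> \<Longrightarrow> f A = g A"
  shows "cochain f k i = cochain g k i"
  unfolding cochain_def using assms by (intro restrict_ext) (simp add: index_iff)

lemma module_eqI:
  assumes "c \<in> carrier (CM i)" "c' \<in> carrier (CM i)"
    and "\<And>A. \<lbrakk>A \<subseteq> idx; card A = i\<rbrakk> \<Longrightarrow> c A = c' A"
  shows "c = c'"
proof (rule PiE_ext)
  show "c \<in> (\<Pi>\<^sub>E A\<in>cech_index xs i. carrier (LR A))" "c' \<in> (\<Pi>\<^sub>E A\<in>cech_index xs i. carrier (LR A))"
    using assms(1,2) by (simp_all add: cech_module_def)
qed (use assms(3) in \<open>simp add: index_iff\<close>)

text \<open>Every Cech cochain comes from a finite Koszul stage: there are finitely many components,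
  and each fraction can be expanded to any sufficiently large common exponent.\<close>

lemma cochain_rep:
  assumes c: "c \<in> carrier (CM i)"
  obtains f k where "\<And>A. f A \<in> carrier S" "c = cochain f k i"
proof -
  have "\<exists>K. \<forall>k\<ge>K. \<exists>a\<in>carrier S. c A = loc_frac S (denoms A) a (xpow A k)"
    if A: "A \<in> cech_index xs i" for A
  proof -
    have A': "A \<subseteq> idx" using A by (simp add: index_iff)
    interpret mult_set S "denoms A" using A' by (rule denoms_mult_set)
    have "c A \<in> carrier (LR A)" using c A by (auto simp: cech_module_def)
    then obtain a s where as: "c A = fr a s" "a \<in> carrier S" "s \<in> denoms A"
      unfolding cech_ring_def by (rule loc_cases)
    obtain K where K: "\<And>k. k \<ge> K \<Longrightarrow> \<exists>u\<in>denoms A. u \<otimes> s = xpow A k"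
      using denoms_divide[OF A' as(3)] by blast
    have "\<exists>a\<in>carrier S. c A = fr a (xpow A k)" if k: "k \<ge> K" for k
    proof -
      obtain u where u: "u \<in> denoms A" "u \<otimes> s = xpow A k" using K[OF k] by blast
      have "fr (u \<otimes> a) (u \<otimes> s) = c A" using frac_cancel[OF as(2,3) u(1)] as(1) by simp
      then show ?thesis using u as(2) by (intro bexI[of _ "u \<otimes> a"]) auto
    qed
    then show ?thesis by blast
  qed
  then have "\<exists>k. \<forall>A\<in>cech_index xs i. \<exists>a\<in>carrier S. c A = loc_frac S (denoms A) a (xpow A k)"
    by (rule uniform_bound[OF finite_index])
  then obtain k where k: "\<And>A. A \<in> cech_index xs i \<Longrightarrow> \<exists>a\<in>carrier S. c A = loc_frac S (denoms A) a (xpow A k)"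
    by blast
  have "\<exists>a. a \<in> carrier S \<and> (A \<in> cech_index xs i \<longrightarrow> c A = loc_frac S (denoms A) a (xpow A k))" for A
    using k zero_closed by blast
  then obtain f where f: "\<And>A. f A \<in> carrier S"
    "\<And>A. A \<in> cech_index xs i \<Longrightarrow> c A = loc_frac S (denoms A) (f A) (xpow A k)"
    by metis
  have "c = cochain f k i"
    using f by (intro module_eqI[OF c cochain_closed]) (auto simp: cochain_apply index_iff)
  then show thesis using that f(1) by blast
qed

text \<open>Numerator and denominator are expanded by the same monomial: the maps to the Cech
  complex are compatible with the transition maps.\<close>

lemma cochain_shift:
  assumes f: "\<And>A. f A \<in> carrier S"
  shows "cochain (\<lambda>A. xpow A m \<otimes> f A) (k + m) i = cochain f k i"
  unfolding cochain_def
proof (rule restrict_ext)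
  fix A assume "A \<in> cech_index xs i"
  then have A: "A \<subseteq> idx" by (simp add: index_iff)
  interpret mult_set S "denoms A" using A by (rule denoms_mult_set)
  have "fr (xpow A m \<otimes> f A) (xpow A m \<otimes> xpow A k) = fr (f A) (xpow A k)"
    using f xpow_denoms[OF A] by (intro frac_cancel) auto
  then show "fr (xpow A m \<otimes> f A) (xpow A (k + m)) = fr (f A) (xpow A k)"
    by (simp add: xpow_add m_comm)
qed

text \<open>Equal fractions agree after multiplication by some denominator; enlarging it to a
  monomial with equal exponents makes one m serve all index sets.\<close>

lemma cochain_eqD:
  assumes f: "\<And>A. f A \<in> carrier S" and g: "\<And>A. g A \<in> carrier S"
    and eq: "cochain f k i = cochain g l i"
  obtains m where "\<And>A. \<lbrakk>A \<subseteq> idx; card A = i\<rbrakk> \<Longrightarrow> xpow A (m + l) \<otimes> f A = xpow A (m + k) \<otimes> g A"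
proof -
  have "\<exists>K. \<forall>m\<ge>K. xpow A (m + l) \<otimes> f A = xpow A (m + k) \<otimes> g A" if A: "A \<in> cech_index xs i" for A
  proof -
    have A': "A \<subseteq> idx" "card A = i" using A by (simp_all add: index_iff)
    interpret mult_set S "denoms A" using A'(1) by (rule denoms_mult_set)
    have "fr (f A) (xpow A k) = fr (g A) (xpow A l)"
      using fun_cong[OF eq, of A] A' by (simp add: cochain_apply)
    then obtain w where w: "w \<in> denoms A" "w \<otimes> (f A \<otimes> xpow A l) = w \<otimes> (g A \<otimes> xpow A k)"
      using f g xpow_denoms[OF A'(1)] by (auto simp: frac_eq_iff)
    obtain K where K: "\<And>m. m \<ge> K \<Longrightarrow> \<exists>u\<in>denoms A. u \<otimes> w = xpow A m"
      using denoms_divide[OF A'(1) w(1)] by blast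
    have "xpow A (m + l) \<otimes> f A = xpow A (m + k) \<otimes> g A" if m: "m \<ge> K" for m
    proof -
      obtain u where u: "u \<in> denoms A" "u \<otimes> w = xpow A m" using K[OF m] by blast
      note mem = W_mem[OF u(1)] W_mem[OF w(1)] f[of A] g[of A]
      have "xpow A (m + l) \<otimes> f A = u \<otimes> (w \<otimes> (f A \<otimes> xpow A l))"
        unfolding xpow_add u(2)[symmetric] using mem by (simp add: m_ac)
      also have "\<dots> = xpow A (m + k) \<otimes> g A"
        unfolding w(2) xpow_add u(2)[symmetric] using mem by (simp add: m_ac)
      finally show ?thesis .
    qed
    then show ?thesis by blast
  qed
  then have "\<exists>m. \<forall>A\<in>cech_index xs i. xpow A (m + l) \<otimes> f A = xpow A (m + k) \<otimes> g A"
    by (rule uniform_bound[OF finite_index])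
  then obtain m where "\<And>A. A \<in> cech_index xs i \<Longrightarrow> xpow A (m + l) \<otimes> f A = xpow A (m + k) \<otimes> g A"
    by blast
  then show thesis by (intro that[of m]) (simp add: index_iff)
qed

section \<open>The group of Cech cochains and its differential\<close>

lemma cring_LR: "A \<subseteq> idx \<Longrightarrow> cring (LR A)"
  unfolding cech_ring_def by (intro mult_set.cring_loc denoms_mult_set)

lemma module_apply_closed: "\<lbrakk>c \<in> carrier (CM i); A \<subseteq> idx; card A = i\<rbrakk> \<Longrightarrow> c A \<in> carrier (LR A)"
  by (auto simp: cech_module_def index_iff)

lemma module_add_apply:
  "\<lbrakk>A \<subseteq> idx; card A = i\<rbrakk> \<Longrightarrow> (c \<oplus>\<^bsub>CM i\<^esub> c') A = c A \<oplus>\<^bsub>LR A\<^esub> c' A"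
  by (simp add: cech_module_def index_iff)

lemma cochain_add:
  assumes f: "\<And>A. f A \<in> carrier S" and g: "\<And>A. g A \<in> carrier S"
  shows "cochain f k i \<oplus>\<^bsub>CM i\<^esub> cochain g k i = cochain (\<lambda>A. f A \<oplus> g A) k i"
proof -
  have "(\<lambda>A\<in>cech_index xs i. cochain f k i A \<oplus>\<^bsub>LR A\<^esub> cochain g k i A) = cochain (\<lambda>A. f A \<oplus> g A) k i"
    unfolding cochain_def[of "\<lambda>A. f A \<oplus> g A"]
  proof (rule restrict_ext)
    fix A assume "A \<in> cech_index xs i"
    then have A: "A \<subseteq> idx" "card A = i" by (simp_all add: index_iff)
    interpret mult_set S "denoms A" using A(1) by (rule denoms_mult_set)
    show "cochain f k i A \<oplus>\<^bsub>LR A\<^esub> cochain g k i A = fr (f A \<oplus> g A) (xpow A k)"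
      using A f g xpow_denoms[OF A(1)] by (simp add: cochain_apply cech_ring_def frac_add_same)
  qed
  then show ?thesis by (simp add: cech_module_def)
qed

lemma cochain_zero: "cochain (\<lambda>A. \<zero>) k i = \<zero>\<^bsub>CM i\<^esub>"
proof -
  have "cochain (\<lambda>A. \<zero>) k i = (\<lambda>A\<in>cech_index xs i. \<zero>\<^bsub>LR A\<^esub>)"
    unfolding cochain_def
  proof (rule restrict_ext)
    fix A assume "A \<in> cech_index xs i"
    then have A: "A \<subseteq> idx" by (simp add: index_iff)
    interpret mult_set S "denoms A" using A by (rule denoms_mult_set)
    show "fr \<zero> (xpow A k) = \<zero>\<^bsub>LR A\<^esub>" using xpow_denoms[OF A] by (simp add: cech_ring_def)
  qed
  then show ?thesis by (simp add: cech_module_def)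
qed

lemma module_add_closed:
  assumes "c \<in> carrier (CM i)" "c' \<in> carrier (CM i)"
  shows "c \<oplus>\<^bsub>CM i\<^esub> c' \<in> carrier (CM i)"
proof -
  have "c A \<oplus>\<^bsub>LR A\<^esub> c' A \<in> carrier (LR A)" if A: "A \<in> cech_index xs i" for A
  proof -
    interpret A: cring "LR A" using A by (intro cring_LR) (simp add: index_iff)
    show ?thesis using assms[THEN module_apply_closed] A by (simp add: index_iff)
  qed
  then show ?thesis by (simp add: cech_module_def)
qed

lemma module_zero_closed: "\<zero>\<^bsub>CM i\<^esub> \<in> carrier (CM i)"
  using cochain_closed[of "\<lambda>A. \<zero>" 0 i] by (simp add: cochain_zero)

lemma module_zero_apply:
  "\<lbrakk>A \<subseteq> idx; card A = i\<rbrakk> \<Longrightarrow> \<zero>\<^bsub>CM i\<^esub> A = \<zero>\<^bsub>LR A\<^esub>"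
  by (simp add: cech_module_def index_iff)

lemma abelian_group_CM: "abelian_group (CM i)"
proof (rule abelian_groupI)
  fix x y z assume x: "x \<in> carrier (CM i)" and y: "y \<in> carrier (CM i)" and z: "z \<in> carrier (CM i)"
  show "x \<oplus>\<^bsub>CM i\<^esub> y \<oplus>\<^bsub>CM i\<^esub> z = x \<oplus>\<^bsub>CM i\<^esub> (y \<oplus>\<^bsub>CM i\<^esub> z)"
  proof (rule module_eqI)
    fix A assume A: "A \<subseteq> idx" "card A = i"
    interpret A: cring "LR A" using A(1) by (rule cring_LR)
    show "(x \<oplus>\<^bsub>CM i\<^esub> y \<oplus>\<^bsub>CM i\<^esub> z) A = (x \<oplus>\<^bsub>CM i\<^esub> (y \<oplus>\<^bsub>CM i\<^esub> z)) A"
      using A module_apply_closed[OF x A] module_apply_closed[OF y A] module_apply_closed[OF z A]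
      by (simp add: module_add_apply A.a_assoc)
  qed (intro module_add_closed x y z)+
next
  fix x y assume x: "x \<in> carrier (CM i)" and y: "y \<in> carrier (CM i)"
  show "x \<oplus>\<^bsub>CM i\<^esub> y \<in> carrier (CM i)" using x y by (rule module_add_closed)
  show "x \<oplus>\<^bsub>CM i\<^esub> y = y \<oplus>\<^bsub>CM i\<^esub> x"
  proof (rule module_eqI)
    fix A assume A: "A \<subseteq> idx" "card A = i"
    interpret A: cring "LR A" using A(1) by (rule cring_LR)
    show "(x \<oplus>\<^bsub>CM i\<^esub> y) A = (y \<oplus>\<^bsub>CM i\<^esub> x) A"
      using A module_apply_closed[OF x A] module_apply_closed[OF y A]
      by (simp add: module_add_apply A.a_comm)
  qed (intro module_add_closed x y)+
next
  fix x assume x: "x \<in> carrier (CM i)"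
  show "\<zero>\<^bsub>CM i\<^esub> \<oplus>\<^bsub>CM i\<^esub> x = x"
  proof (rule module_eqI)
    fix A assume A: "A \<subseteq> idx" "card A = i"
    interpret A: cring "LR A" using A(1) by (rule cring_LR)
    show "(\<zero>\<^bsub>CM i\<^esub> \<oplus>\<^bsub>CM i\<^esub> x) A = x A"
      using A module_apply_closed[OF x A] by (simp add: module_add_apply module_zero_apply)
  qed (intro module_add_closed module_zero_closed x)+
  obtain f k where f: "\<And>A. f A \<in> carrier S" "x = cochain f k i" using x by (rule cochain_rep) blast
  have "cochain (\<lambda>A. \<ominus> f A) k i \<oplus>\<^bsub>CM i\<^esub> x = \<zero>\<^bsub>CM i\<^esub>"
    using f by (simp add: cochain_add l_neg cochain_zero)
  then show "\<exists>y\<in>carrier (CM i). y \<oplus>\<^bsub>CM i\<^esub> x = \<zero>\<^bsub>CM i\<^esub>"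
    using f(1) by (intro bexI[of _ "cochain (\<lambda>A. \<ominus> f A) k i"] cochain_closed) auto
qed (rule module_zero_closed)

lemma cochain_minus:
  assumes f: "\<And>A. f A \<in> carrier S"
  shows "\<ominus>\<^bsub>CM i\<^esub> cochain f k i = cochain (\<lambda>A. \<ominus> f A) k i"
proof -
  interpret M: abelian_group "CM i" by (rule abelian_group_CM)
  show ?thesis
    using f by (intro M.minus_equality) (simp_all add: cochain_add l_neg cochain_zero cochain_closed)
qed

text \<open>To bring a fraction over \<open>xpow (A - {j}) k\<close> to the denominator
  \<open>xpow A k\<close> it is expanded by x_j^k, and this factor is exactly the Koszul
  coefficient.\<close>

lemma cech_diff_cochain:
  assumes f: "\<And>A. f A \<in> carrier S"
  shows "cech_diff S xs i (cochain f k i) = cochain (kdiff S (\<lambda>j. var j [^] k) f) k (Suc i)"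
  unfolding cech_diff_def cochain_def[of "kdiff S (\<lambda>j. var j [^] k) f"]
proof (rule restrict_ext)
  fix A assume "A \<in> cech_index xs (Suc i)"
  then have A: "A \<subseteq> idx" "card A = Suc i" by (simp_all add: index_iff)
  note fin = idx_finite[OF A(1)]
  interpret mult_set S "denoms A" using A(1) by (rule denoms_mult_set)
  let ?y = "\<lambda>j. loc_map S (denoms A) (cochain f k i (A - {j}))"
  let ?t = "\<lambda>j. signed S (pos j A) (var j [^] k \<otimes> f (A - {j}))"
  have t: "?t j \<in> carrier S" for j using f by simp
  have "signed L (pos j A) (?y j) = fr (?t j) (xpow A k)" if j: "j \<in> A" for j
  proof -
    have Aj: "A - {j} \<subseteq> idx" "card (A - {j}) = i" using A j fin by auto
    have "cochain f k i (A - {j}) = loc_frac S (denoms (A - {j})) (f (A - {j})) (xpow (A - {j}) k)"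
      using Aj by (rule cochain_apply)
    then have "?y j = fr (f (A - {j})) (xpow (A - {j}) k)"
      using loc_map_frac[OF denoms_mult_set[OF Aj(1)] denoms_mult_set[OF A(1)] denoms_diff[OF A(1) j] f
        xpow_denoms[OF Aj(1)]] by simp
    also have "\<dots> = fr (var j [^] k \<otimes> f (A - {j})) (xpow A k)"
    proof (rule frac_eqI)
      show "xpow (A - {j}) k \<in> denoms A" using xpow_denoms[OF Aj(1)] denoms_diff[OF A(1) j] by blast
      show "f (A - {j}) \<otimes> xpow A k = var j [^] k \<otimes> f (A - {j}) \<otimes> xpow (A - {j}) k"
        unfolding xpow_remove[OF fin j] using f by (simp add: m_ac)
    qed (use f xpow_denoms[OF A(1)] in auto)
    finally show ?thesis using f xpow_denoms[OF A(1)] by (simp add: frac_signed)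
  qed
  then have "finsum L (\<lambda>j. signed L (pos j A) (?y j)) A = finsum L (\<lambda>j. fr (?t j) (xpow A k)) A"
    using t xpow_denoms[OF A(1)] by (intro loc.finsum_cong') auto
  also have "\<dots> = fr (kdiff S (\<lambda>j. var j [^] k) f A) (xpow A k)"
    unfolding kdiff_def using fin t xpow_denoms[OF A(1)] by (rule frac_finsum)
  finally show "finsum (LR A) (\<lambda>j. let y = ?y j in if even (card {k \<in> A. k < j}) then y else \<ominus>\<^bsub>LR A\<^esub> y) A
      = fr (kdiff S (\<lambda>j. var j [^] k) f A) (xpow A k)"
    unfolding signed_def pos_def cech_ring_def Let_def .
qed

lemma coboundaries_Suc:
  "cech_coboundaries S xs (Suc i) = cech_diff S xs i ` carrier (CM i)"
  by (simp add: cech_coboundaries_def)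

text \<open>Cohomology commutes with the direct limit: the image of a Koszul cochain of stage k is a
  Cech coboundary exactly if the cochain becomes a boundary at some later stage k + m.\<close>

lemma cochain_coboundary_iff:
  assumes f: "\<And>A. f A \<in> carrier S"
  shows "cochain f k i \<in> cech_coboundaries S xs i \<longleftrightarrow>
    (\<exists>m. kboundary S (\<lambda>j. var j [^] (k + m)) {\<zero>} idx i (\<lambda>A. xpow A m \<otimes> f A))"
proof (cases i)
  \<comment> \<open>Degree 0 has its own definition of coboundaries, namely zero alone. The only
    index set is empty, where the monomials are 1, so both sides reduce to
    \<open>f {} = \<zero>\<close>.\<close>
  case 0
  have emp: "A = {}" if "A \<subseteq> idx" "card A = 0" for A
    using that idx_finite by auto
  have "cochain f k 0 = \<zero>\<^bsub>CM 0\<^esub> \<longleftrightarrow> f {} = \<zero>"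
  proof
    assume "cochain f k 0 = \<zero>\<^bsub>CM 0\<^esub>"
    then have "cochain f k 0 = cochain (\<lambda>A. \<zero>) k 0" by (simp add: cochain_zero)
    then obtain m where "\<And>A. \<lbrakk>A \<subseteq> idx; card A = 0\<rbrakk> \<Longrightarrow> xpow A (m + k) \<otimes> f A = xpow A (m + k) \<otimes> \<zero>"
      by (rule cochain_eqD[OF f zero_closed]) blast
    from this[of "{}"] show "f {} = \<zero>" using f by (simp add: xpow_def)
  next
    assume "f {} = \<zero>"
    then have "cochain f k 0 = cochain (\<lambda>A. \<zero>) k 0" by (intro cochain_cong) (auto dest: emp)
    then show "cochain f k 0 = \<zero>\<^bsub>CM 0\<^esub>" by (simp add: cochain_zero)
  qed
  moreover have "(\<exists>m. kboundary S (\<lambda>j. var j [^] (k + m)) {\<zero>} idx 0 (\<lambda>A. xpow A m \<otimes> f A)) \<longleftrightarrow> f {} = \<zero>"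
  proof
    assume "\<exists>m. kboundary S (\<lambda>j. var j [^] (k + m)) {\<zero>} idx 0 (\<lambda>A. xpow A m \<otimes> f A)"
    then obtain m where "kboundary S (\<lambda>j. var j [^] (k + m)) {\<zero>} idx 0 (\<lambda>A. xpow A m \<otimes> f A)" ..
    then obtain g where "\<And>A. \<lbrakk>A \<subseteq> idx; card A = 0\<rbrakk> \<Longrightarrow> xpow A m \<otimes> f A = kdiff S (\<lambda>j. var j [^] (k + m)) g A"
      by (rule kboundary_zeroE) (use f in auto)
    from this[of "{}"] show "f {} = \<zero>" using f by (simp add: xpow_def)
  next
    assume "f {} = \<zero>"
    then have "kboundary S (\<lambda>j. var j [^] (k + 0)) {\<zero>} idx 0 (\<lambda>A. xpow A 0 \<otimes> f A)"
      by (intro kboundary_zeroI[of _ "\<lambda>A. \<zero>"]) (auto dest!: emp)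
    then show "\<exists>m. kboundary S (\<lambda>j. var j [^] (k + m)) {\<zero>} idx 0 (\<lambda>A. xpow A m \<otimes> f A)" ..
  qed
  ultimately show ?thesis unfolding 0 by (simp add: cech_coboundaries_def)
next
  case (Suc i')
  show ?thesis
  proof
    assume "cochain f k i \<in> cech_coboundaries S xs i"
    then obtain b where b: "b \<in> carrier (CM i')" "cochain f k i = cech_diff S xs i' b"
      unfolding Suc coboundaries_Suc by blast
    obtain g l where g: "\<And>A. g A \<in> carrier S" "b = cochain g l i'" using b(1) by (rule cochain_rep) blast
    have vl: "var j [^] (l::nat) \<in> carrier S" for j l by simp
    have "cochain f k i = cochain (kdiff S (\<lambda>j. var j [^] l) g) l i"
      using b(2) g by (simp add: cech_diff_cochain Suc)
    then obtain m where m: "\<And>A. \<lbrakk>A \<subseteq> idx; card A = i\<rbrakk>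
        \<Longrightarrow> xpow A (m + l) \<otimes> f A = xpow A (m + k) \<otimes> kdiff S (\<lambda>j. var j [^] l) g A"
      by (rule cochain_eqD[OF f kdiff_closed[OF vl g(1)]]) blast
    \<comment> \<open>The common stage is k + m + l: f is shifted from stage k by m + l, its
      primitive g from stage l by m + k.\<close>
    have "kboundary S (\<lambda>j. var j [^] (k + (m + l))) {\<zero>} idx i (\<lambda>A. xpow A (m + l) \<otimes> f A)"
    proof (rule kboundary_zeroI[OF vl])
      fix A assume A: "A \<subseteq> idx" "card A = i"
      have "kdiff S (\<lambda>j. var j [^] l \<otimes> var j [^] (m + k)) (\<lambda>A. xpow A (m + k) \<otimes> g A) A
          = xpow A (m + k) \<otimes> kdiff S (\<lambda>j. var j [^] l) g A"
        unfolding xpow_def using g(1) idx_finite[OF A(1)] by (intro kdiff_twist) auto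
      moreover have "l + (m + k) = k + (m + l)" by simp
      ultimately show "xpow A (m + l) \<otimes> f A
          = kdiff S (\<lambda>j. var j [^] (k + (m + l))) (\<lambda>A. xpow A (m + k) \<otimes> g A) A"
        using m[OF A] by (simp add: nat_pow_mult)
    qed (use g(1) in auto)
    then show "\<exists>m. kboundary S (\<lambda>j. var j [^] (k + m)) {\<zero>} idx i (\<lambda>A. xpow A m \<otimes> f A)" ..
  next
    assume "\<exists>m. kboundary S (\<lambda>j. var j [^] (k + m)) {\<zero>} idx i (\<lambda>A. xpow A m \<otimes> f A)"
    then obtain m where "kboundary S (\<lambda>j. var j [^] (k + m)) {\<zero>} idx i (\<lambda>A. xpow A m \<otimes> f A)" ..
    then obtain g where g: "\<And>A. g A \<in> carrier S"
      "\<And>A. \<lbrakk>A \<subseteq> idx; card A = i\<rbrakk> \<Longrightarrow> xpow A m \<otimes> f A = kdiff S (\<lambda>j. var j [^] (k + m)) g A"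
      by (rule kboundary_zeroE) (use f in auto)
    have "cochain f k i = cochain (\<lambda>A. xpow A m \<otimes> f A) (k + m) i"
      using f by (rule cochain_shift[symmetric])
    also have "\<dots> = cochain (kdiff S (\<lambda>j. var j [^] (k + m)) g) (k + m) i"
      using g(2) by (rule cochain_cong)
    also have "\<dots> = cech_diff S xs i' (cochain g (k + m) i')"
      using g(1) by (simp add: cech_diff_cochain Suc)
    finally show "cochain f k i \<in> cech_coboundaries S xs i"
      unfolding Suc coboundaries_Suc using cochain_closed[of g, OF g(1)] by blast
  qed
qed

end

lemma (in cring) kboundary_pow:
  assumes q: "additive_power R q" and w: "\<And>j. w j \<in> carrier R" and f: "\<And>A. f A \<in> carrier R"
    and I: "finite I" and bd: "kboundary R w {\<zero>} I i f"
  shows "kboundary R (\<lambda>j. w j [^] q) {\<zero>} I i (\<lambda>A. f A [^] q)"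
proof -
  obtain g where g: "\<And>A. g A \<in> carrier R" "\<And>A. \<lbrakk>A \<subseteq> I; card A = i\<rbrakk> \<Longrightarrow> f A = kdiff R w g A"
    using bd w f by (rule kboundary_zeroE) blast
  show ?thesis
  proof (rule kboundary_zeroI[of _ "\<lambda>A. g A [^] q"])
    fix A assume A: "A \<subseteq> I" "card A = i"
    have "finite A" using A(1) I finite_subset by blast
    then show "f A [^] q = kdiff R (\<lambda>j. w j [^] q) (\<lambda>A. g A [^] q) A"
      unfolding g(2)[OF A] using q w g(1) by (intro additive_power_kdiff)
  qed (use w g(1) in auto)
qed

text \<open>If no exponent up to n worked, \<open>Suc n\<close> would be a lower bound of the set
  whose infimum is \<open>HSL\<close>. The exponent obtained may be smaller than n, so the passage
  to n itself is left to the user of the lemma.\<close>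

lemma HSL_le:
  assumes "HSL M \<theta> \<le> enat n"
  obtains e where "e \<le> n" "\<And>x. x \<in> nil_part M \<theta> \<Longrightarrow> (\<theta> ^^ e) x = \<zero>\<^bsub>M\<^esub>"
proof -
  have "\<exists>e\<le>n. \<forall>x\<in>nil_part M \<theta>. (\<theta> ^^ e) x = \<zero>\<^bsub>M\<^esub>"
  proof (rule ccontr)
    assume none: "\<not> ?thesis"
    have "enat (Suc n) \<le> HSL M \<theta>"
      unfolding HSL_def
    proof (rule Inf_greatest, clarify)
      fix e assume "\<forall>x\<in>nil_part M \<theta>. (\<theta> ^^ e) x = \<zero>\<^bsub>M\<^esub>"
      then have "\<not> e \<le> n" using none by blast
      then show "enat (Suc n) \<le> enat e" by simp
    qed
    then have "enat (Suc n) \<le> enat n" using assms by (rule order_trans)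
    then show False by simp
  qed
  then show thesis using that by blast
qed

section \<open>Cech coboundaries and the Frobenius map on Cech cohomology\<close>

context cech
begin

lemma cochain_common_rep:
  assumes x: "x \<in> carrier (CM i)" and y: "y \<in> carrier (CM i)"
  obtains f g k where "\<And>A. f A \<in> carrier S" "\<And>A. g A \<in> carrier S" "x = cochain f k i" "y = cochain g k i"
proof -
  obtain f k where f: "\<And>A. f A \<in> carrier S" "x = cochain f k i" using x by (rule cochain_rep) blast
  obtain g l where g: "\<And>A. g A \<in> carrier S" "y = cochain g l i" using y by (rule cochain_rep) blast
  show thesis
  proof (rule that)
    show "x = cochain (\<lambda>A. xpow A l \<otimes> f A) (k + l) i" using cochain_shift[OF f(1)] f(2) by simp
    show "y = cochain (\<lambda>A. xpow A k \<otimes> g A) (k + l) i"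
      using cochain_shift[OF g(1), where m = k and k = l] g(2) by (simp add: add.commute)
  qed (use f(1) g(1) in auto)
qed

lemma coboundaries_subgroup: "additive_subgroup (cech_coboundaries S xs i) (CM i)"
proof (cases i)
  case 0
  interpret M: abelian_group "CM 0" by (rule abelian_group_CM)
  show ?thesis unfolding 0
    by (rule additive_subgroupI, rule M.add.subgroupI) (auto simp: cech_coboundaries_def)
next
  case (Suc i')
  interpret M: abelian_group "CM i" by (rule abelian_group_CM)
  let ?d = "cech_diff S xs i'"
  have var: "var j [^] (k::nat) \<in> carrier S" for j k by simp
  have cl: "?d b \<in> carrier (CM i)" if b: "b \<in> carrier (CM i')" for b
  proof -
    obtain f k where f: "\<And>A. f A \<in> carrier S" "b = cochain f k i'" using b by (rule cochain_rep) blast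
    show ?thesis
      unfolding f(2) cech_diff_cochain[of f, OF f(1)] Suc
      by (rule cochain_closed, rule kdiff_closed) (simp_all add: f(1))
  qed
  have add: "?d b \<oplus>\<^bsub>CM i\<^esub> ?d c \<in> ?d ` carrier (CM i')"
    if b: "b \<in> carrier (CM i')" and c: "c \<in> carrier (CM i')" for b c
  proof -
    obtain f g k where f: "\<And>A. f A \<in> carrier S" "\<And>A. g A \<in> carrier S"
      "b = cochain f k i'" "c = cochain g k i'"
      using b c by (rule cochain_common_rep) blast
    have "?d b \<oplus>\<^bsub>CM i\<^esub> ?d c
        = cochain (\<lambda>A. kdiff S (\<lambda>j. var j [^] k) f A \<oplus> kdiff S (\<lambda>j. var j [^] k) g A) k i"
      unfolding f(3,4) using f(1,2) kdiff_closed[OF var f(1)] kdiff_closed[OF var f(2)]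
      by (simp add: cech_diff_cochain Suc cochain_add)
    also have "\<dots> = cochain (kdiff S (\<lambda>j. var j [^] k) (\<lambda>A. f A \<oplus> g A)) k i"
      using f(1,2) by (intro cochain_cong) (simp add: kdiff_add)
    also have "\<dots> = ?d (cochain (\<lambda>A. f A \<oplus> g A) k i')" using f(1,2) by (simp add: cech_diff_cochain Suc)
    finally have "?d b \<oplus>\<^bsub>CM i\<^esub> ?d c = ?d (cochain (\<lambda>A. f A \<oplus> g A) k i')" .
    moreover have "cochain (\<lambda>A. f A \<oplus> g A) k i' \<in> carrier (CM i')"
      by (rule cochain_closed) (simp add: f(1,2))
    ultimately show ?thesis by simp
  qed
  have inv: "\<ominus>\<^bsub>CM i\<^esub> ?d b \<in> ?d ` carrier (CM i')" if b: "b \<in> carrier (CM i')" for b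
  proof -
    obtain f k where f: "\<And>A. f A \<in> carrier S" "b = cochain f k i'" using b by (rule cochain_rep) blast
    have "\<ominus>\<^bsub>CM i\<^esub> ?d b = cochain (\<lambda>A. \<ominus> kdiff S (\<lambda>j. var j [^] k) f A) k i"
      unfolding f(2) using f(1) kdiff_closed[OF var f(1)]
      by (simp add: cech_diff_cochain Suc cochain_minus)
    also have "\<dots> = cochain (kdiff S (\<lambda>j. var j [^] k) (\<lambda>A. \<ominus> f A)) k i"
      using f(1) idx_finite by (intro cochain_cong kdiff_minus[symmetric]) auto
    also have "\<dots> = ?d (cochain (\<lambda>A. \<ominus> f A) k i')" using f(1) by (simp add: cech_diff_cochain Suc)
    finally have "\<ominus>\<^bsub>CM i\<^esub> ?d b = ?d (cochain (\<lambda>A. \<ominus> f A) k i')" .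
    moreover have "cochain (\<lambda>A. \<ominus> f A) k i' \<in> carrier (CM i')"
      by (rule cochain_closed) (simp add: f(1))
    ultimately show ?thesis by simp
  qed
  have "?d ` carrier (CM i') \<noteq> {}" using module_zero_closed by blast
  then have "subgroup (?d ` carrier (CM i')) (add_monoid (CM i))"
    by (intro M.add.subgroupI) (use cl add inv in \<open>auto simp: a_inv_def\<close>)
  then show ?thesis unfolding Suc coboundaries_Suc by (intro additive_subgroupI) (simp add: Suc)
qed

lemma coboundaries_abelian_subgroup: "abelian_subgroup (cech_coboundaries S xs i) (CM i)"
  using coboundaries_subgroup abelian_group_CM by (rule abelian_subgroupI3)

definition frobenius :: "nat \<Rightarrow> nat \<Rightarrow> (nat set \<Rightarrow> ('a \<times> 'a) set) \<Rightarrow> nat set \<Rightarrow> ('a \<times> 'a) set"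
  where "frobenius p i c = (\<lambda>A\<in>cech_index xs i. c A [^]\<^bsub>LR A\<^esub> p)"

lemma frobenius_cochain:
  assumes f: "\<And>A. f A \<in> carrier S"
  shows "frobenius p i (cochain f k i) = cochain (\<lambda>A. f A [^] p) (k * p) i"
  unfolding frobenius_def cochain_def[of "\<lambda>A. f A [^] p"]
proof (rule restrict_ext)
  fix A assume "A \<in> cech_index xs i"
  then have A: "A \<subseteq> idx" "card A = i" by (simp_all add: index_iff)
  interpret mult_set S "denoms A" using A(1) by (rule denoms_mult_set)
  show "cochain f k i A [^]\<^bsub>LR A\<^esub> p = fr (f A [^] p) (xpow A (k * p))"
    using f xpow_denoms[OF A(1)] A by (simp add: cochain_apply cech_ring_def frac_pow xpow_pow)
qed

lemma frobenius_add:
  assumes p: "additive_power S p" and b: "b \<in> carrier (CM i)" and c: "c \<in> carrier (CM i)"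
  shows "frobenius p i (b \<oplus>\<^bsub>CM i\<^esub> c) = frobenius p i b \<oplus>\<^bsub>CM i\<^esub> frobenius p i c"
proof -
  obtain f g k where f: "\<And>A. f A \<in> carrier S" "\<And>A. g A \<in> carrier S"
    "b = cochain f k i" "c = cochain g k i"
    using b c by (rule cochain_common_rep) blast
  show ?thesis
    unfolding f(3,4) using f(1,2) by (simp add: cochain_add frobenius_cochain additive_powerD[OF p])
qed

text \<open>A coboundary becomes a Koszul boundary at some stage k + m, and its p-th power is then a
  boundary at stage (k + m)p.\<close>

lemma frobenius_coboundary:
  assumes p: "additive_power S p" and b: "b \<in> cech_coboundaries S xs i"
  shows "frobenius p i b \<in> cech_coboundaries S xs i"
proof -
  have "b \<in> carrier (CM i)" using additive_subgroup.a_Hcarr[OF coboundaries_subgroup b] .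
  then obtain f k where f: "\<And>A. f A \<in> carrier S" "b = cochain f k i" by (rule cochain_rep) blast
  obtain m where "kboundary S (\<lambda>j. var j [^] (k + m)) {\<zero>} idx i (\<lambda>A. xpow A m \<otimes> f A)"
    using b unfolding f(2) cochain_coboundary_iff[of f, OF f(1)] by blast
  then have "kboundary S (\<lambda>j. (var j [^] (k + m)) [^] p) {\<zero>} idx i (\<lambda>A. (xpow A m \<otimes> f A) [^] p)"
    using f(1) by (intro kboundary_pow[OF p]) auto
  then have "kboundary S (\<lambda>j. var j [^] (k * p + m * p)) {\<zero>} idx i (\<lambda>A. xpow A (m * p) \<otimes> f A [^] p)"
    using f(1) by (simp add: nat_pow_pow nat_pow_distrib xpow_pow add_mult_distrib)
  then have "cochain (\<lambda>A. f A [^] p) (k * p) i \<in> cech_coboundaries S xs i"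
    using f(1) by (subst cochain_coboundary_iff) auto
  then show ?thesis unfolding f(2) using f(1) by (simp add: frobenius_cochain)
qed

lemma class_add_coboundary:
  assumes "b \<in> cech_coboundaries S xs i" "c \<in> carrier (CM i)"
  shows "cech_class S xs i (b \<oplus>\<^bsub>CM i\<^esub> c) = cech_class S xs i c"
proof -
  interpret B: abelian_subgroup "cech_coboundaries S xs i" "CM i" by (rule coboundaries_abelian_subgroup)
  have "b \<oplus>\<^bsub>CM i\<^esub> c \<in> cech_coboundaries S xs i +>\<^bsub>CM i\<^esub> c"
    using assms(1) by (auto simp: a_r_coset_def')
  then show ?thesis unfolding cech_class_def using assms(2) by (intro B.a_repr_independence[symmetric] B.a_subgroup)
qed

text \<open>\<open>cech_frobenius\<close> is a union over all representatives. These differ by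
  coboundaries, which Frobenius preserves additively, so every member of the union is the same
  class.\<close>

lemma frobenius_class:
  assumes p: "additive_power S p" and f: "\<And>A. f A \<in> carrier S"
  shows "cech_frobenius S p xs i (cech_class S xs i (cochain f k i))
    = cech_class S xs i (cochain (\<lambda>A. f A [^] p) (k * p) i)"
proof -
  interpret B: abelian_subgroup "cech_coboundaries S xs i" "CM i" by (rule coboundaries_abelian_subgroup)
  let ?c = "cochain f k i"
  have c: "?c \<in> carrier (CM i)" using f by (rule cochain_closed)
  have fc: "frobenius p i ?c \<in> carrier (CM i)"
    unfolding frobenius_cochain[of f, OF f] by (rule cochain_closed) (simp add: f)
  have "cech_class S xs i (frobenius p i u) = cech_class S xs i (frobenius p i ?c)"
    if u: "u \<in> cech_class S xs i ?c" for u
  proof -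
    obtain b where b: "b \<in> cech_coboundaries S xs i" "u = b \<oplus>\<^bsub>CM i\<^esub> ?c"
      using u unfolding cech_class_def a_r_coset_def' by blast
    have "frobenius p i u = frobenius p i b \<oplus>\<^bsub>CM i\<^esub> frobenius p i ?c"
      unfolding b(2) using B.a_Hcarr[OF b(1)] c by (rule frobenius_add[OF p])
    then show ?thesis using class_add_coboundary[OF frobenius_coboundary[OF p b(1)] fc] by simp
  qed
  then have "cech_frobenius S p xs i (cech_class S xs i ?c)
      = (\<Union>u\<in>cech_class S xs i ?c. cech_class S xs i (frobenius p i ?c))"
    unfolding cech_frobenius_def frobenius_def[symmetric] by (intro SUP_cong) auto
  also have "\<dots> = cech_class S xs i (frobenius p i ?c)"
    using B.a_rcos_self[OF c] unfolding cech_class_def by auto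
  finally show ?thesis using f by (simp add: frobenius_cochain)
qed

lemma frobenius_iterate_class:
  assumes p: "additive_power S p" and f: "\<And>A. f A \<in> carrier S"
  shows "(cech_frobenius S p xs i ^^ e) (cech_class S xs i (cochain f k i))
    = cech_class S xs i (cochain (\<lambda>A. f A [^] (p ^ e)) (k * p ^ e) i)"
proof (induction e)
  case 0
  then show ?case using f by simp
next
  case (Suc e)
  then show ?case using f by (simp add: frobenius_class[OF p] nat_pow_pow mult_ac)
qed

lemma class_eq_zero_iff:
  assumes c: "c \<in> carrier (CM i)"
  shows "cech_class S xs i c = cech_coboundaries S xs i \<longleftrightarrow> c \<in> cech_coboundaries S xs i"
proof -
  interpret B: abelian_subgroup "cech_coboundaries S xs i" "CM i" by (rule coboundaries_abelian_subgroup)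
  show ?thesis
    unfolding cech_class_def using B.a_rcos_self[OF c] B.a_rcos_const by auto
qed

text \<open>Translates the bound on \<open>HSL\<close> into Koszul terms: the boundary hypothesis
  says that Frobenius to the power e kills the class, and the conclusion says that Frobenius to the
  power \<epsilon> does.\<close>

lemma HSL_bound_cochain:
  assumes p: "additive_power S p"
    and HSL: "HSL (cech_cohomology S xs i) (cech_frobenius S p xs i) \<le> enat \<epsilon>"
    and f: "\<And>A. f A \<in> carrier S" and cyc: "kcocycle S (\<lambda>j. var j [^] k) {\<zero>} idx i f"
    and bd: "kboundary S (\<lambda>j. var j [^] (k * p ^ e)) {\<zero>} idx i (\<lambda>A. f A [^] (p ^ e))"
  shows "\<exists>m. kboundary S (\<lambda>j. var j [^] (k * p ^ \<epsilon> + m)) {\<zero>} idx i (\<lambda>A. xpow A m \<otimes> f A [^] (p ^ \<epsilon>))"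
proof -
  let ?H = "cech_cohomology S xs i" and ?F = "cech_frobenius S p xs i"
  let ?x = "cech_class S xs i (cochain f k i)"
  have fe: "f A [^] (p ^ e) \<in> carrier S" for A e using f by simp
  have zero: "\<zero>\<^bsub>?H\<^esub> = cech_coboundaries S xs i" by (simp add: cech_cohomology_def)
  have iter: "(?F ^^ e) ?x = \<zero>\<^bsub>?H\<^esub> \<longleftrightarrow>
      (\<exists>m. kboundary S (\<lambda>j. var j [^] (k * p ^ e + m)) {\<zero>} idx i (\<lambda>A. xpow A m \<otimes> f A [^] (p ^ e)))" for e
    unfolding frobenius_iterate_class[of p f, OF p f] zero
      class_eq_zero_iff[OF cochain_closed[of "\<lambda>A. f A [^] (p ^ e)", OF fe]]
      cochain_coboundary_iff[of "\<lambda>A. f A [^] (p ^ e)", OF fe] ..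
  have "cech_diff S xs i (cochain f k i) = cochain (\<lambda>A. \<zero>) k (Suc i)"
    unfolding cech_diff_cochain[of f, OF f] by (rule cochain_cong) (rule kcocycle_zeroD[OF cyc])
  then have "cochain f k i \<in> cech_cocycles S xs i"
    unfolding cech_cocycles_def a_kernel_def' using cochain_closed[of f, OF f] by (simp add: cochain_zero)
  then have "?x \<in> carrier ?H" by (simp add: cech_cohomology_def)
  \<comment> \<open>The hypothesis is the case m = 0 of vanishing in the limit.\<close>
  moreover have "(?F ^^ e) ?x = \<zero>\<^bsub>?H\<^esub>"
    unfolding iter using bd f by (intro exI[of _ 0]) simp
  ultimately have nil: "?x \<in> nil_part ?H ?F" unfolding nil_part_def by blast
  obtain e' where e': "e' \<le> \<epsilon>" "(?F ^^ e') ?x = \<zero>\<^bsub>?H\<^esub>"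
    using HSL_le[OF HSL] nil by metis
  obtain m where "kboundary S (\<lambda>j. var j [^] (k * p ^ e' + m)) {\<zero>} idx i (\<lambda>A. xpow A m \<otimes> f A [^] (p ^ e'))"
    using e'(2) unfolding iter by blast
  \<comment> \<open>The bound provides some exponent e' up to \<epsilon>; the remaining power
    p^(\<epsilon> - e') is applied to the boundary relation and turns the shift m into m
    p^(\<epsilon> - e').\<close>
  then have "kboundary S (\<lambda>j. (var j [^] (k * p ^ e' + m)) [^] (p ^ (\<epsilon> - e'))) {\<zero>} idx i
      (\<lambda>A. (xpow A m \<otimes> f A [^] (p ^ e')) [^] (p ^ (\<epsilon> - e')))"
    using f by (intro kboundary_pow additive_power_power[OF p]) auto
  moreover have "p ^ e' * p ^ (\<epsilon> - e') = p ^ \<epsilon>" using e'(1) by (simp flip: power_add)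
  then have "(k * p ^ e' + m) * p ^ (\<epsilon> - e') = k * p ^ \<epsilon> + m * p ^ (\<epsilon> - e')"
    by (simp add: add_mult_distrib mult.assoc)
  ultimately have "kboundary S (\<lambda>j. var j [^] (k * p ^ \<epsilon> + m * p ^ (\<epsilon> - e'))) {\<zero>} idx i
      (\<lambda>A. xpow A (m * p ^ (\<epsilon> - e')) \<otimes> f A [^] (p ^ \<epsilon>))"
    using f \<open>p ^ e' * p ^ (\<epsilon> - e') = p ^ \<epsilon>\<close> by (simp add: nat_pow_pow nat_pow_distrib xpow_pow)
  then show ?thesis ..
qed

end

section \<open>Koszul complexes and localisation\<close>

lemma (in cring) kboundary_smult:
  assumes w: "\<And>j. w j \<in> carrier R" and f: "\<And>A. f A \<in> carrier R" and c: "c \<in> carrier R"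
    and I: "finite I" and bd: "kboundary R w {\<zero>} I i f"
  shows "kboundary R w {\<zero>} I i (\<lambda>A. c \<otimes> f A)"
proof -
  obtain g where g: "\<And>A. g A \<in> carrier R" "\<And>A. \<lbrakk>A \<subseteq> I; card A = i\<rbrakk> \<Longrightarrow> f A = kdiff R w g A"
    using bd w f by (rule kboundary_zeroE) blast
  show ?thesis
  proof (rule kboundary_zeroI[OF w, of "\<lambda>A. c \<otimes> g A"])
    fix A assume A: "A \<subseteq> I" "card A = i"
    have "finite A" using A(1) I finite_subset by blast
    then show "c \<otimes> f A = kdiff R w (\<lambda>A. c \<otimes> g A) A"
      using w g(1) c by (simp add: g(2)[OF A] kdiff_smult)
  qed (use c g(1) in auto)
qed

context mult_set
begin

abbreviation h :: "'a \<Rightarrow> ('a \<times> 'a) set"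
  where "h a \<equiv> fr a \<one>"

lemma h_ring_hom: "ring_hom_ring S L h"
  using frac_hom by (intro ring_hom_ringI2) unfold_locales

lemma h_mult: "\<lbrakk>a \<in> carrier S; b \<in> carrier S\<rbrakk> \<Longrightarrow> h (a \<otimes> b) = h a \<otimes>\<^bsub>L\<^esub> h b"
  by (simp add: loc_mult)

lemma h_pow: "a \<in> carrier S \<Longrightarrow> h (a [^] n) = h a [^]\<^bsub>L\<^esub> (n::nat)"
  by (simp add: frac_pow)

lemma h_finprod:
  assumes "finite A" "\<And>i. i \<in> A \<Longrightarrow> f i \<in> carrier S"
  shows "h (finprod S f A) = finprod L (\<lambda>i. h (f i)) A"
  using assms
proof (induction A)
  case (insert x F)
  have c: "finprod S f F \<in> carrier S" "f x \<in> carrier S"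
    using insert.prems by (auto intro: finprod_closed)
  have "finprod S f (insert x F) = f x \<otimes> finprod S f F"
    using insert.hyps insert.prems by (intro finprod_insert) auto
  moreover have "finprod L (\<lambda>i. h (f i)) (insert x F) = h (f x) \<otimes>\<^bsub>L\<^esub> finprod L (\<lambda>i. h (f i)) F"
    using insert.hyps insert.prems by (intro loc.finprod_insert) auto
  ultimately show ?case using c insert.IH insert.prems by (simp add: h_mult)
qed simp

lemma h_kdiff:
  assumes v: "\<And>j. v j \<in> carrier S" and g: "\<And>A. g A \<in> carrier S" and B: "finite B"
  shows "h (kdiff S v g B) = kdiff L (\<lambda>j. h (v j)) (\<lambda>A. h (g A)) B"
  unfolding kdiff_def
proof (subst frac_finsum[symmetric])
  show "finsum L (\<lambda>j. h (signed S (pos j B) (v j \<otimes> g (B - {j})))) B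
      = finsum L (\<lambda>j. signed L (pos j B) (h (v j) \<otimes>\<^bsub>L\<^esub> h (g (B - {j})))) B"
    using v g by (intro loc.finsum_cong') (auto simp: frac_signed h_mult)
qed (use v g B in auto)

lemma kboundary_to_loc:
  assumes v: "\<And>j. v j \<in> carrier S" and g: "\<And>A. g A \<in> carrier S" and I: "finite I"
    and bd: "kboundary S v {\<zero>} I i g"
  shows "kboundary L (\<lambda>j. h (v j)) {\<zero>\<^bsub>L\<^esub>} I i (\<lambda>A. h (g A))"
proof -
  obtain b where b: "\<And>A. b A \<in> carrier S" "\<And>A. \<lbrakk>A \<subseteq> I; card A = i\<rbrakk> \<Longrightarrow> g A = kdiff S v b A"
    using bd v g by (rule kboundary_zeroE) blast
  show ?thesis
  proof (rule loc.kboundary_zeroI[of _ "\<lambda>A. h (b A)"])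
    fix A assume A: "A \<subseteq> I" "card A = i"
    have "finite A" using A(1) I finite_subset by blast
    then show "h (g A) = kdiff L (\<lambda>j. h (v j)) (\<lambda>A. h (b A)) A"
      unfolding b(2)[OF A] using v b(1) by (intro h_kdiff)
  qed (use v b(1) in auto)
qed

text \<open>The cocycle condition concerns finitely many sets, so a single denominator kills all its
  defects over S.\<close>

lemma kcocycle_from_loc:
  assumes v: "\<And>j. v j \<in> carrier S" and g: "\<And>A. g A \<in> carrier S" and I: "finite I"
    and cyc: "kcocycle L (\<lambda>j. h (v j)) {\<zero>\<^bsub>L\<^esub>} I i (\<lambda>A. h (g A))"
  obtains w where "w \<in> W" "kcocycle S v {\<zero>} I i (\<lambda>A. w \<otimes> g A)"
proof -
  let ?\<B> = "{B. B \<subseteq> I \<and> card B = Suc i}"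
  have fin: "finite ?\<B>" using I by simp
  have "\<exists>w\<in>W. w \<otimes> kdiff S v g B = \<zero>" if B: "B \<in> ?\<B>" for B
  proof -
    have "finite B" using B I finite_subset by blast
    then have "h (kdiff S v g B) = \<zero>\<^bsub>L\<^esub>"
      using loc.kcocycle_zeroD[OF cyc] B v g by (simp add: h_kdiff)
    then show ?thesis using kdiff_closed[OF v g] by (simp add: frac_eq_zero_iff)
  qed
  then obtain w where w: "w \<in> W" "\<And>B. B \<in> ?\<B> \<Longrightarrow> w \<otimes> kdiff S v g B = \<zero>"
    using common_annihilator[OF fin, of "kdiff S v g"] kdiff_closed[of v g, OF v g] by auto
  have "kdiff S v (\<lambda>A. w \<otimes> g A) B = \<zero>" if B: "B \<subseteq> I" "card B = Suc i" for B
  proof -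
    have "finite B" using B I finite_subset by blast
    then show ?thesis using v g w B by (simp add: kdiff_smult)
  qed
  then show thesis using that[OF w(1)] by (simp add: kcocycle_def)
qed

text \<open>A primitive over the localisation has the form c/t. The relation t g = d c holds only
  after localising, and one further denominator makes it hold over S; the multiplier is the product
  of both.\<close>

lemma kboundary_from_loc:
  assumes v: "\<And>j. v j \<in> carrier S" and g: "\<And>A. g A \<in> carrier S" and I: "finite I"
    and bd: "kboundary L (\<lambda>j. h (v j)) {\<zero>\<^bsub>L\<^esub>} I i (\<lambda>A. h (g A))"
  obtains w where "w \<in> W" "kboundary S v {\<zero>} I i (\<lambda>A. w \<otimes> g A)"
proof -
  have hv: "h (v j) \<in> carrier L" for j using v by simp
  have hg: "h (g A) \<in> carrier L" for A using g by simp
  obtain b where b: "\<And>A. b A \<in> carrier L"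
    "\<And>A. \<lbrakk>A \<subseteq> I; card A = i\<rbrakk> \<Longrightarrow> h (g A) = kdiff L (\<lambda>j. h (v j)) b A"
    using bd hv hg by (rule loc.kboundary_zeroE) blast
  \<comment> \<open>All subsets of I are included, because the differential evaluates the primitive
    on smaller sets than those of cardinality i.\<close>
  obtain t c where c: "t \<in> W" "\<And>A. c A \<in> carrier S" "\<And>A. A \<in> Pow I \<Longrightarrow> b A = fr (c A) t"
    by (rule common_denominator[of "Pow I" b]) (use I b(1) in \<open>simp, blast, blast\<close>)
  have tc: "t \<in> carrier S" using c(1) by simp
  let ?\<A> = "{A. A \<subseteq> I \<and> card A = i}"
  let ?e = "\<lambda>A. t \<otimes> g A \<ominus> kdiff S v c A"
  have dc: "kdiff S v c A \<in> carrier S" for A using v c(2) by (rule kdiff_closed)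
  have e: "?e A \<in> carrier S" for A using tc g dc by simp
  have fin: "finite ?\<A>" using I by simp
  have "\<exists>w\<in>W. w \<otimes> ?e A = \<zero>" if A: "A \<in> ?\<A>" for A
  proof -
    have finA: "finite A" using A I finite_subset by blast
    have htb: "h t \<otimes>\<^bsub>L\<^esub> b C = h (c C)" if C: "C \<subseteq> I" for C
      using c(1) c(2)[of C] c(3)[of C] C tc by (simp add: loc_mult) (intro frac_eqI; simp add: m_comm)
    have "kdiff L (\<lambda>j. h (v j)) (\<lambda>C. h t \<otimes>\<^bsub>L\<^esub> b C) A = kdiff L (\<lambda>j. h (v j)) (\<lambda>C. h (c C)) A"
    proof (rule loc.kdiff_cong)
      fix j
      show "h t \<otimes>\<^bsub>L\<^esub> b (A - {j}) = h (c (A - {j}))" using A by (intro htb) auto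
    qed (use hv b(1) tc in auto)
    then have "h t \<otimes>\<^bsub>L\<^esub> h (g A) = h (kdiff S v c A)"
      using A b finA hv v c(2) tc by (simp add: loc.kdiff_smult h_kdiff)
    then have "h (t \<otimes> g A) = h (kdiff S v c A)" using g tc by (simp add: h_mult)
    then obtain w where w: "w \<in> W" "w \<otimes> (t \<otimes> g A) = w \<otimes> kdiff S v c A"
      using g tc dc by (auto simp: frac_eq_iff)
    have "w \<otimes> ?e A = w \<otimes> (t \<otimes> g A) \<ominus> w \<otimes> kdiff S v c A"
      using W_mem[OF w(1)] tc g[of A] dc[of A] by algebra
    also have "\<dots> = \<zero>" using w tc g dc by (simp add: minus_eq_zero_iff)
    finally show ?thesis using w(1) by blast
  qed
  then obtain w where w: "w \<in> W" "\<And>A. A \<in> ?\<A> \<Longrightarrow> w \<otimes> ?e A = \<zero>"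
    using common_annihilator[OF fin, of ?e] e by auto
  have wc: "w \<in> carrier S" using w(1) by simp
  have "kboundary S v {\<zero>} I i (\<lambda>A. (w \<otimes> t) \<otimes> g A)"
  proof (rule kboundary_zeroI[OF v, of "\<lambda>A. w \<otimes> c A"])
    fix A assume A: "A \<subseteq> I" "card A = i"
    have finA: "finite A" using A I finite_subset by blast
    have "w \<otimes> ?e A = w \<otimes> t \<otimes> g A \<ominus> w \<otimes> kdiff S v c A"
      using wc tc g[of A] dc[of A] by algebra
    then have "w \<otimes> t \<otimes> g A \<ominus> w \<otimes> kdiff S v c A = \<zero>"
      using w(2)[of A] A by simp
    then have "w \<otimes> t \<otimes> g A = w \<otimes> kdiff S v c A"
      by (rule iffD1[OF minus_eq_zero_iff, rotated 2]) (use wc tc g dc in auto)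
    then show "w \<otimes> t \<otimes> g A = kdiff S v (\<lambda>A. w \<otimes> c A) A"
      using v c(2) wc finA by (simp add: kdiff_smult)
  qed (use wc c(2) in auto)
  then show thesis using that[of "w \<otimes> t"] w(1) c(1) by simp
qed

text \<open>The extension of K consists of the fractions with numerator in K, since these already
  form an ideal.\<close>

lemma ideal_from_loc:
  assumes K: "ideal K S" and c: "c \<in> carrier S" and hc: "h c \<in> genideal L (h ` K)"
  obtains w where "w \<in> W" "w \<otimes> c \<in> K"
proof -
  interpret K: ideal K S by (rule K)
  let ?E = "{fr k s | k s. k \<in> K \<and> s \<in> W}"
  have E: "ideal ?E L"
  proof (rule idealI)
    show "ring L" by (rule loc.ring_axioms)
    show "subgroup ?E (add_monoid L)"
    proof (rule loc.add.subgroupI)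
      show "?E \<subseteq> carrier L" using K.a_Hcarr by auto
      show "?E \<noteq> {}" using K.zero_closed one_W by blast
    next
      fix x assume "x \<in> ?E"
      then obtain k s where k: "x = fr k s" "k \<in> K" "s \<in> W" by blast
      then have "\<ominus>\<^bsub>L\<^esub> x = fr (\<ominus> k) s" using K.a_Hcarr by (simp add: frac_minus)
      then show "\<ominus>\<^bsub>L\<^esub> x \<in> ?E" using K.a_inv_closed[OF k(2)] k(3) by blast
    next
      fix x y assume "x \<in> ?E" "y \<in> ?E"
      then obtain k s l t where k: "x = fr k s" "k \<in> K" "s \<in> W" "y = fr l t" "l \<in> K" "t \<in> W" by blast
      then have "x \<oplus>\<^bsub>L\<^esub> y = fr (k \<otimes> t \<oplus> l \<otimes> s) (s \<otimes> t)" using K.a_Hcarr by (simp add: loc_add)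
      moreover have "k \<otimes> t \<oplus> l \<otimes> s \<in> K" using k by (intro K.a_closed K.I_r_closed) auto
      moreover have "s \<otimes> t \<in> W" using k by simp
      ultimately show "x \<oplus>\<^bsub>L\<^esub> y \<in> ?E" by blast
    qed
  next
    fix x y assume x: "x \<in> ?E" and y: "y \<in> carrier L"
    obtain k s where k: "x = fr k s" "k \<in> K" "s \<in> W" using x by blast
    obtain b t where b: "y = fr b t" "b \<in> carrier S" "t \<in> W" using y by (rule loc_cases)
    have "y \<otimes>\<^bsub>L\<^esub> x = fr (b \<otimes> k) (t \<otimes> s)" using k b K.a_Hcarr by (simp add: loc_mult)
    moreover have "b \<otimes> k \<in> K" using k(2) b(2) by (rule K.I_l_closed)
    moreover have "t \<otimes> s \<in> W" using k b by simp
    ultimately show *: "y \<otimes>\<^bsub>L\<^esub> x \<in> ?E" by blast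
    have "x \<in> carrier L" using k K.a_Hcarr by simp
    then show "x \<otimes>\<^bsub>L\<^esub> y \<in> ?E" using * y by (simp add: loc.m_comm)
  qed
  moreover have "h ` K \<subseteq> ?E" using one_W by blast
  ultimately have "genideal L (h ` K) \<subseteq> ?E" by (rule loc.genideal_minimal)
  then obtain k s where k: "h c = fr k s" "k \<in> K" "s \<in> W" using hc by blast
  then obtain w where w: "w \<in> W" "w \<otimes> (c \<otimes> s) = w \<otimes> (k \<otimes> \<one>)"
    using c K.a_Hcarr by (auto simp: frac_eq_iff)
  have "(w \<otimes> s) \<otimes> c = w \<otimes> k" using w c k K.a_Hcarr by (simp add: m_ac)
  moreover have "w \<otimes> k \<in> K" using k w by (intro K.I_l_closed) auto
  ultimately show thesis using that[of "w \<otimes> s"] w k by simp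
qed

lemma h_genideal:
  assumes G: "G \<subseteq> carrier S" and K: "ideal K L" and sub: "h ` G \<subseteq> K" and m: "m \<in> genideal S G"
  shows "h m \<in> K"
proof -
  interpret ring_hom_ring S L h by (rule h_ring_hom)
  have "ideal {r \<in> carrier S. h r \<in> K} S" by (rule ideal_vimage[OF K])
  then have "genideal S G \<subseteq> {r \<in> carrier S. h r \<in> K}"
    by (rule genideal_minimal) (use G sub in auto)
  then show ?thesis using m by blast
qed

end

section \<open>The local rings at maximal ideals\<close>

lemma (in cring) mult_set_maximal:
  assumes "maximalideal M R"
  shows "mult_set R (carrier R - M)"
proof -
  interpret P: primeideal M R using assms by (rule maximalideal_prime)
  have "\<one> \<notin> M" using P.one_imp_carrier P.I_notcarr by blast
  then show ?thesis
    by unfold_locales (use P.I_prime in auto)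
qed

text \<open>A fraction outside this set has its numerator in W and is therefore a unit, so any
  larger ideal is everything.\<close>

lemma (in mult_set) maximal_ideal_loc:
  assumes M: "maximalideal M S" and W: "W = carrier S - M"
  shows "maximalideal {fr m s | m s. m \<in> M \<and> s \<in> W} L" (is "maximalideal ?N L")
proof (rule maximalidealI)
  interpret M: maximalideal M S by (rule M)
  have unit: "fr a s \<otimes>\<^bsub>L\<^esub> fr s a = \<one>\<^bsub>L\<^esub>" if "a \<in> W" "s \<in> W" for a s
    using that by (simp add: loc_mult) (simp add: m_comm)
  show "ideal ?N L"
  proof (rule idealI)
    show "ring L" by (rule loc.ring_axioms)
    show "subgroup ?N (add_monoid L)"
    proof (rule loc.add.subgroupI)
      show "?N \<subseteq> carrier L" using M.a_Hcarr by auto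
      show "?N \<noteq> {}" using M.zero_closed one_W by blast
    next
      fix x assume "x \<in> ?N"
      then obtain k s where k: "x = fr k s" "k \<in> M" "s \<in> W" by blast
      then have "\<ominus>\<^bsub>L\<^esub> x = fr (\<ominus> k) s" using M.a_Hcarr by (simp add: frac_minus)
      then show "\<ominus>\<^bsub>L\<^esub> x \<in> ?N" using M.a_inv_closed[OF k(2)] k(3) by blast
    next
      fix x y assume "x \<in> ?N" "y \<in> ?N"
      then obtain k s l t where k: "x = fr k s" "k \<in> M" "s \<in> W" "y = fr l t" "l \<in> M" "t \<in> W" by blast
      then have "x \<oplus>\<^bsub>L\<^esub> y = fr (k \<otimes> t \<oplus> l \<otimes> s) (s \<otimes> t)" using M.a_Hcarr by (simp add: loc_add)
      moreover have "k \<otimes> t \<oplus> l \<otimes> s \<in> M" using k by (intro M.a_closed M.I_r_closed) auto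
      moreover have "s \<otimes> t \<in> W" using k by simp
      ultimately show "x \<oplus>\<^bsub>L\<^esub> y \<in> ?N" by blast
    qed
  next
    fix x y assume x: "x \<in> ?N" and y: "y \<in> carrier L"
    obtain k s where k: "x = fr k s" "k \<in> M" "s \<in> W" using x by blast
    obtain b t where b: "y = fr b t" "b \<in> carrier S" "t \<in> W" using y by (rule loc_cases)
    have "y \<otimes>\<^bsub>L\<^esub> x = fr (b \<otimes> k) (t \<otimes> s)" using k b M.a_Hcarr by (simp add: loc_mult)
    moreover have "b \<otimes> k \<in> M" using k(2) b(2) by (rule M.I_l_closed)
    moreover have "t \<otimes> s \<in> W" using k b by simp
    ultimately show *: "y \<otimes>\<^bsub>L\<^esub> x \<in> ?N" by blast
    have "x \<in> carrier L" using k M.a_Hcarr by simp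
    then show "x \<otimes>\<^bsub>L\<^esub> y \<in> ?N" using * y by (simp add: loc.m_comm)
  qed
  have "\<one>\<^bsub>L\<^esub> \<notin> ?N"
  proof
    assume "\<one>\<^bsub>L\<^esub> \<in> ?N"
    then obtain m s where m: "fr \<one> \<one> = fr m s" "m \<in> M" "s \<in> W" unfolding loc_one by blast
    then have mc: "m \<in> carrier S" using M.a_Hcarr by blast
    obtain w where "w \<in> W" "w \<otimes> (\<one> \<otimes> s) = w \<otimes> (m \<otimes> \<one>)"
      using iffD1[OF frac_eq_iff[OF one_closed one_W mc m(3)] m(1)] by blast
    then have w: "w \<in> W" "w \<otimes> s = w \<otimes> m" using mc m(3) by simp_all
    have "w \<otimes> m \<in> M" using m(2) w(1) by (intro M.I_l_closed) auto
    moreover have "w \<otimes> s \<in> W" using w(1) m(3) by simp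
    ultimately show False using w(2) W by simp
  qed
  then show "carrier L \<noteq> ?N" using loc.one_closed by blast
  fix K assume K: "ideal K L" "?N \<subseteq> K" "K \<subseteq> carrier L"
  interpret K: ideal K L by (rule K(1))
  show "K = ?N \<or> K = carrier L"
  proof (cases "K \<subseteq> ?N")
    case False
    then obtain x where x: "x \<in> K" "x \<notin> ?N" by blast
    obtain a s where a: "x = fr a s" "a \<in> carrier S" "s \<in> W" using K(3) x(1) by (blast elim: loc_cases)
    then have "a \<in> W" using x(2) W by blast
    then have "x \<otimes>\<^bsub>L\<^esub> fr s a = \<one>\<^bsub>L\<^esub>" "fr s a \<in> carrier L" using unit a by simp_all
    then have "\<one>\<^bsub>L\<^esub> \<in> K" using K.I_r_closed[OF x(1)] by metis
    then show ?thesis using K.one_imp_carrier by blast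
  qed (use K(2) in blast)
qed

text \<open>Uniqueness in a local ring identifies the described maximal ideal with the fractions
  having numerator in M. The two inclusions say that generators of M still generate after
  localising.\<close>

lemma (in mult_set) the_maximal_loc:
  assumes M: "maximalideal M S" and W: "W = carrier S - M" and local: "noetherian_local L"
    and G: "G \<subseteq> carrier S" "genideal S G = M"
  shows "maximalideal (the_maximal L) L" "h ` G \<subseteq> the_maximal L" "the_maximal L \<subseteq> genideal L (h ` G)"
proof -
  let ?N = "{fr m s | m s. m \<in> M \<and> s \<in> W}"
  have N: "maximalideal ?N L" using M W by (rule maximal_ideal_loc)
  have "\<exists>!K. maximalideal K L" using local by (simp add: noetherian_local_def)
  then have e: "the_maximal L = ?N" unfolding the_maximal_def using N by (rule the1_equality)
  show "maximalideal (the_maximal L) L" using N e by simp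
  have "G \<subseteq> M" using genideal_self[OF G(1)] G(2) by simp
  then show "h ` G \<subseteq> the_maximal L" unfolding e using one_W by blast
  have hG: "h ` G \<subseteq> carrier L" using G(1) by auto
  have id: "ideal (genideal L (h ` G)) L" using hG by (rule loc.genideal_ideal)
  show "the_maximal L \<subseteq> genideal L (h ` G)" unfolding e
  proof
    fix x assume "x \<in> ?N"
    then obtain m s where m: "x = fr m s" "m \<in> M" "s \<in> W" by blast
    have mc: "m \<in> carrier S" using m(2) M ideal.Icarr maximalideal.axioms(1) by metis
    have "h m \<in> genideal L (h ` G)"
      using G m(2) by (intro h_genideal[OF G(1) id loc.genideal_self[OF hG]]) simp
    then have "h m \<otimes>\<^bsub>L\<^esub> fr \<one> s \<in> genideal L (h ` G)"
      by (rule ideal.I_r_closed[OF id]) (simp add: m(3))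
    then show "x \<in> genideal L (h ` G)" using m mc by (simp add: loc_mult)
  qed
qed

text \<open>Otherwise every member would be at most n. The value 0 is left out because it is also
  the supremum of the empty set.\<close>

lemma enat_Sup_attained:
  assumes "Sup A = enat (Suc n)"
  shows "enat (Suc n) \<in> A"
proof (rule ccontr)
  assume no: "enat (Suc n) \<notin> A"
  have "Sup A \<le> enat n"
  proof (rule Sup_least)
    fix x assume x: "x \<in> A"
    then have "x \<le> enat (Suc n)" using Sup_upper[OF x] assms by simp
    moreover have "x \<noteq> enat (Suc n)" using x no by blast
    ultimately show "x \<le> enat n" by (cases x) auto
  qed
  then show False using assms by simp
qed

lemma (in cring) depth_attained:
  assumes "depth R = enat d" "carrier R \<noteq> {\<zero>}"
  obtains xs where "regular_sequence R xs" "set xs \<subseteq> the_maximal R" "length xs = d"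
proof (cases d)
  case 0
  \<comment> \<open>In depth 0 the empty list serves; it generates the zero ideal, which is proper
    because the ring is nonzero.\<close>
  have "regular_sequence R []" using assms(2) by (simp add: regular_sequence_def genideal_empty)
  then show thesis using that[of "[]"] 0 by simp
next
  case (Suc n)
  have "enat (Suc n) \<in> {enat (length xs) | xs. regular_sequence R xs \<and> set xs \<subseteq> the_maximal R}"
    using assms(1) unfolding depth_def Suc by (rule enat_Sup_attained)
  then show thesis using that Suc by auto
qed

lemma (in cring) frobenius_power_ideal:
  assumes "ideal J R"
  shows "ideal (frobenius_power R p e J) R"
proof -
  interpret ideal J R by fact
  have "(\<lambda>a. a [^] (p ^ e)) ` J \<subseteq> carrier R" using a_Hcarr by auto
  then show ?thesis unfolding frobenius_power_def by (rule genideal_ideal)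
qed

lemma (in cring) frobenius_power_mem:
  assumes "ideal J R" "b \<in> J"
  shows "b [^] (p ^ e) \<in> frobenius_power R p e J"
proof -
  interpret ideal J R by fact
  have "(\<lambda>a. a [^] (p ^ e)) ` J \<subseteq> carrier R" using a_Hcarr by auto
  from genideal_self[OF this] show ?thesis
    unfolding frobenius_power_def using assms(2) by (rule subsetD[OF _ imageI])
qed

section \<open>Local to global\<close>

lemma (in noetherian_ring) exists_maximal_ideal:
  assumes I: "ideal I R" "I \<noteq> carrier R"
  obtains M where "maximalideal M R" "I \<subseteq> M"
proof -
  let ?A = "{K. ideal K R \<and> I \<subseteq> K \<and> K \<noteq> carrier R}"
  have "\<exists>M\<in>?A. \<forall>K\<in>?A. M \<subseteq> K \<longrightarrow> K = M"
  proof (rule subset_Zorn_nonempty)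
    show "?A \<noteq> {}" using I by blast
    fix C assume C: "C \<noteq> {}" "subset.chain ?A C"
    \<comment> \<open>\<open>in place of an upper bound\<close>: see next step.\<close>
    have "subset.chain {K. ideal K R} C" using C(2) by (auto simp: subset_chain_def)
    then have "\<Union>C \<in> C" using C(1) by (rule ideal_chain_is_trivial[rotated])
    moreover have "C \<subseteq> ?A" using C(2) unfolding subset_chain_def by (rule conjunct1)
    ultimately show "\<Union>C \<in> ?A" by (rule rev_subsetD)
  qed
  then obtain M where M: "M \<in> ?A" "\<forall>K\<in>?A. M \<subseteq> K \<longrightarrow> K = M" by (elim bexE)
  have "maximalideal M R"
  proof (rule maximalidealI)
    fix K assume K: "ideal K R" "M \<subseteq> K" "K \<subseteq> carrier R"
    then show "K = M \<or> K = carrier R" using M by blast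
  qed (use M in auto)
  then show thesis using that M(1) by blast
qed

text \<open>The multipliers that carry c into K form an ideal. It lies in no maximal ideal, so it
  contains 1.\<close>

lemma (in cring) ideal_membership_local:
  assumes "noetherian_ring R" and K: "ideal K R" and c: "c \<in> carrier R"
    and loc: "\<And>M. maximalideal M R \<Longrightarrow> \<exists>w\<in>carrier R - M. w \<otimes> c \<in> K"
  shows "c \<in> K"
proof (rule ccontr)
  assume "c \<notin> K"
  interpret K: ideal K R by (rule K)
  let ?I = "{w \<in> carrier R. w \<otimes> c \<in> K}"
  have "ideal ?I R"
  proof (rule idealI)
    show "ring R" by unfold_locales
    show "subgroup ?I (add_monoid R)"
    proof (rule add.subgroupI)
      have "\<zero> \<in> ?I" using c by simp
      then show "?I \<noteq> {}" by blast
    qed (use c in \<open>auto simp: l_distr l_minus\<close>)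
  next
    fix w x assume w: "w \<in> ?I" and x: "x \<in> carrier R"
    have "x \<otimes> (w \<otimes> c) \<in> K" using w x K.I_l_closed by simp
    then show "x \<otimes> w \<in> ?I" using w x c by (simp add: m_assoc)
    then show "w \<otimes> x \<in> ?I" using w x by (simp add: m_comm)
  qed
  moreover have "?I \<noteq> carrier R" using \<open>c \<notin> K\<close> c by (metis (no_types, lifting) l_one mem_Collect_eq one_closed)
  ultimately obtain M where "maximalideal M R" "?I \<subseteq> M"
    by (rule noetherian_ring.exists_maximal_ideal[OF assms(1)])
  then show False using loc by blast
qed

section \<open>Characteristic p\<close>

lemma poly_mapping_of_nat:
  "of_nat n = (Poly_Mapping.single 0 (of_nat n) :: ('v::monoid_add \<Rightarrow>\<^sub>0 'k::semiring_1))"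
  by (induction n) (simp_all add: single_add)

text \<open>The polynomial ring has the characteristic of its field, so the p-th power is additive
  there; the surjection carries this identity to S.\<close>

lemma additive_power_polynomial_quotient:
  fixes \<phi> :: "(('v \<Rightarrow>\<^sub>0 nat) \<Rightarrow>\<^sub>0 'k::field) \<Rightarrow> 'a"
  assumes char_k: "CHAR('k) = p" "p > 0" and S: "cring S"
    and \<phi>: "\<phi> \<in> ring_hom polynomial_ring S" "\<phi> ` carrier polynomial_ring = carrier S"
  shows "additive_power S p" "p \<ge> 2"
proof -
  interpret cring S by (rule S)
  have "Factorial_Ring.prime p" using char_k prime_CHAR_semidom[where ?'a = 'k] by simp
  then show "p \<ge> 2" by (rule prime_ge_2_nat)
  \<comment> \<open>Natural numbers are constant polynomials, so they vanish in the polynomial ring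
    exactly when they vanish in the field.\<close>
  have "CHAR(('v \<Rightarrow>\<^sub>0 nat) \<Rightarrow>\<^sub>0 'k) = p"
  proof (rule CHAR_eqI)
    have "of_nat p = (0 :: 'k)" using of_nat_CHAR[where ?'a = 'k] unfolding char_k(1) .
    then show "of_nat p = (0 :: ('v \<Rightarrow>\<^sub>0 nat) \<Rightarrow>\<^sub>0 'k)"
      unfolding poly_mapping_of_nat by simp
    fix x assume "of_nat x = (0 :: ('v \<Rightarrow>\<^sub>0 nat) \<Rightarrow>\<^sub>0 'k)"
    then have "of_nat x = (0 :: 'k)" unfolding poly_mapping_of_nat by (metis single_zero lookup_single_eq lookup_zero)
    then show "p dvd x" using char_k(1) by (simp add: of_nat_eq_0_iff_char_dvd)
  qed
  then have dream: "(u + v) ^ p = u ^ p + v ^ p" for u v :: "('v \<Rightarrow>\<^sub>0 nat) \<Rightarrow>\<^sub>0 'k"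
    using \<open>Factorial_Ring.prime p\<close> by (intro freshmans_dream) simp_all
  have closed: "\<phi> u \<in> carrier S" for u
    using \<phi>(2) by (auto simp: ring_of_type_algebra_def)
  have add: "\<phi> (u + v) = \<phi> u \<oplus>\<^bsub>S\<^esub> \<phi> v" for u v
    using ring_hom_add[OF \<phi>(1), of u v] by (simp add: ring_of_type_algebra_def)
  have mult: "\<phi> (u * v) = \<phi> u \<otimes>\<^bsub>S\<^esub> \<phi> v" for u v
    using ring_hom_mult[OF \<phi>(1), of u v] by (simp add: ring_of_type_algebra_def)
  have one: "\<phi> 1 = \<one>\<^bsub>S\<^esub>"
    using ring_hom_one[OF \<phi>(1)] by (simp add: ring_of_type_algebra_def)
  have pow: "\<phi> (u ^ n) = \<phi> u [^]\<^bsub>S\<^esub> n" for u n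
    by (induction n) (simp_all add: one mult closed m_comm)
  have "(x \<oplus>\<^bsub>S\<^esub> y) [^]\<^bsub>S\<^esub> p = x [^]\<^bsub>S\<^esub> p \<oplus>\<^bsub>S\<^esub> y [^]\<^bsub>S\<^esub> p"
    if xy: "x \<in> carrier S" "y \<in> carrier S" for x y
  proof -
    obtain u v where "x = \<phi> u" "y = \<phi> v" using xy \<phi>(2) by (metis imageE)
    then show ?thesis using arg_cong[OF dream[of u v], of \<phi>] by (simp add: add pow)
  qed
  then show "additive_power S p" using char_k(2) by (simp add: additive_power_def)
qed

section \<open>Frobenius closures of parameter ideals\<close>

lemma (in cring) kcocycle_cong:
  assumes w: "\<And>j. w j \<in> carrier R" and ww: "\<And>j. j \<in> I \<Longrightarrow> w j = w' j"
    and f: "\<And>A. f A \<in> carrier R" and ff: "\<And>A. A \<subseteq> I \<Longrightarrow> f A = f' A"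
    and w': "\<And>j. w' j \<in> carrier R" and cyc: "kcocycle R w \<aa> I i f"
  shows "kcocycle R w' \<aa> I i f'"
  unfolding kcocycle_def
proof (intro allI impI)
  fix B assume B: "B \<subseteq> I" "card B = Suc i"
  have "kdiff R w f B = kdiff R w' f B"
    using B(1) by (intro kdiff_cong_coeff[OF w f] ww) auto
  also have "\<dots> = kdiff R w' f' B"
    using B(1) by (intro kdiff_cong[OF w' f] ff) auto
  finally have "kdiff R w f B = kdiff R w' f' B" .
  moreover have "kdiff R w f B \<in> \<aa>" using cyc B by (simp add: kcocycle_def)
  ultimately show "kdiff R w' f' B \<in> \<aa>" by simp
qed

text \<open>The Frobenius power of J is generated by the powers of all its elements, whereas the
  Koszul argument sees only the powers of the parameters. Both give the same ideal after localising,
  as the powers of any generating set generate the Frobenius power; the two conclusions are the two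
  inclusions.\<close>

lemma (in mult_set) ideal_at_power:
  assumes q: "additive_power S q" and J: "ideal J S" and ext: "genideal L (h ` J) = genideal L Y"
    and Y: "Y \<subseteq> carrier L"
  shows "b \<in> genideal S ((\<lambda>b. b [^] q) ` J) \<Longrightarrow> h b \<in> genideal L ((\<lambda>y. y [^]\<^bsub>L\<^esub> q) ` Y)"
    and "genideal L ((\<lambda>y. y [^]\<^bsub>L\<^esub> q) ` Y) \<subseteq> genideal L (h ` genideal S ((\<lambda>b. b [^] q) ` J))"
proof -
  interpret J: ideal J S by (rule J)
  have qL: "additive_power L q" using q by (rule additive_power_loc)
  have Jc: "J \<subseteq> carrier S" "(\<lambda>b. b [^] q) ` J \<subseteq> carrier S" using J.a_Hcarr by auto
  have hJ: "h ` J \<subseteq> carrier L" using Jc by auto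
  have Yq: "(\<lambda>y. y [^]\<^bsub>L\<^esub> q) ` Y \<subseteq> carrier L" using Y by auto
  have idY: "ideal (genideal L ((\<lambda>y. y [^]\<^bsub>L\<^esub> q) ` Y)) L" using Yq by (rule loc.genideal_ideal)
  let ?JQ = "genideal S ((\<lambda>b. b [^] q) ` J)"
  have hJQ: "h ` ?JQ \<subseteq> carrier L" using ideal.Icarr[OF genideal_ideal[OF Jc(2)]] by auto
  have idJ: "ideal (genideal L (h ` ?JQ)) L" using hJQ by (rule loc.genideal_ideal)
  {
    assume b: "b \<in> ?JQ"
    show "h b \<in> genideal L ((\<lambda>y. y [^]\<^bsub>L\<^esub> q) ` Y)"
    proof (rule h_genideal[OF Jc(2) idY _ b])
      have "h c [^]\<^bsub>L\<^esub> q \<in> genideal L ((\<lambda>y. y [^]\<^bsub>L\<^esub> q) ` Y)" if c: "c \<in> J" for c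
      proof (rule loc.additive_power_genideal[OF qL idY Y])
        show "h c \<in> genideal L Y" using loc.genideal_self[OF hJ] c unfolding ext by blast
        show "y [^]\<^bsub>L\<^esub> q \<in> genideal L ((\<lambda>y. y [^]\<^bsub>L\<^esub> q) ` Y)" if "y \<in> Y" for y
          using loc.genideal_self[OF Yq] that by blast
      qed
      then show "h ` (\<lambda>b. b [^] q) ` J \<subseteq> genideal L ((\<lambda>y. y [^]\<^bsub>L\<^esub> q) ` Y)"
        using Jc(1) by (auto simp: h_pow subset_iff)
    qed
  next
    show "genideal L ((\<lambda>y. y [^]\<^bsub>L\<^esub> q) ` Y) \<subseteq> genideal L (h ` ?JQ)"
    proof (rule loc.genideal_minimal[OF idJ], rule image_subsetI)
      fix y assume "y \<in> Y"
      then have y: "y \<in> genideal L (h ` J)" using loc.genideal_self[OF Y] unfolding ext by blast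
      show "y [^]\<^bsub>L\<^esub> q \<in> genideal L (h ` ?JQ)"
      proof (rule loc.additive_power_genideal[OF qL idJ hJ _ y])
        fix g assume "g \<in> h ` J"
        then obtain c where c: "c \<in> J" "g = h c" by blast
        have "c [^] q \<in> ?JQ" using genideal_self[OF Jc(2)] c(1) by blast
        then have "h (c [^] q) \<in> genideal L (h ` ?JQ)" using loc.genideal_self[OF hJQ] by blast
        then show "g [^]\<^bsub>L\<^esub> q \<in> genideal L (h ` ?JQ)" using c Jc(1) by (auto simp: h_pow)
      qed
    qed
  }
qed

lemma (in noetherian_ring) ideal_gens_spec:
  assumes "ideal I R"
  shows "set (ideal_gens R I) \<subseteq> carrier R" "genideal R (set (ideal_gens R I)) = I"
proof -
  obtain A where A: "A \<subseteq> carrier R" "finite A" "I = genideal R A" using finetely_gen[OF assms] by blast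
  then obtain xs where "set xs = A" using finite_list by blast
  then have "\<exists>xs. set xs \<subseteq> carrier R \<and> genideal R (set xs) = I" using A by auto
  then have "set (ideal_gens R I) \<subseteq> carrier R \<and> genideal R (set (ideal_gens R I)) = I"
    unfolding ideal_gens_def by (rule someI_ex)
  then show "set (ideal_gens R I) \<subseteq> carrier R" "genideal R (set (ideal_gens R I)) = I" by simp_all
qed

text \<open>Clearing denominators turns a cocycle over the local ring into one over \<open>S\<close> without
  leaving the class up to a unit; only there is the bound on the nilpotency order available.\<close>

lemma (in mult_set) HSL_bound_loc:
  assumes p: "additive_power S p" and xs: "set xs \<subseteq> carrier S"
    and HSL: "HSL (cech_cohomology S xs i) (cech_frobenius S p xs i) \<le> enat \<epsilon>"
    and z: "\<And>j. z j \<in> carrier L" "\<And>j. j < length xs \<Longrightarrow> z j = h (xs ! j)"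
    and f: "\<And>A. f A \<in> carrier L" and cyc: "kcocycle L (\<lambda>j. z j [^]\<^bsub>L\<^esub> k) {\<zero>\<^bsub>L\<^esub>} {..<length xs} i f"
    and bd: "kboundary L (\<lambda>j. z j [^]\<^bsub>L\<^esub> (k * p ^ e)) {\<zero>\<^bsub>L\<^esub>} {..<length xs} i (\<lambda>A. f A [^]\<^bsub>L\<^esub> (p ^ e))"
  shows "\<exists>m. kboundary L (\<lambda>j. z j [^]\<^bsub>L\<^esub> (k * p ^ \<epsilon> + m)) {\<zero>\<^bsub>L\<^esub>} {..<length xs} i
    (\<lambda>A. finprod L (\<lambda>j. z j [^]\<^bsub>L\<^esub> m) A \<otimes>\<^bsub>L\<^esub> f A [^]\<^bsub>L\<^esub> (p ^ \<epsilon>))"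
proof -
  interpret X: cech S xs by unfold_locales (rule xs)
  let ?I = "{..<length xs}"
  let ?v = "\<lambda>n j. X.var j [^] (n::nat)"
  have v: "?v n j \<in> carrier S" for n j by simp
  have zn: "z j [^]\<^bsub>L\<^esub> (n::nat) \<in> carrier L" for n j using z(1) by simp
  have hv: "h (?v n j) = z j [^]\<^bsub>L\<^esub> n" if "j \<in> ?I" for n j
    using that z(2)[of j] X.nth_closed[of j] by (simp add: h_pow X.var_def)
  have hvc: "h (?v n j) \<in> carrier L" for n j by simp
  have finI: "finite ?I" by simp
  obtain s g where g: "s \<in> W" "\<And>A. g A \<in> carrier S" "\<And>A. A \<in> Pow ?I \<Longrightarrow> f A = fr (g A) s"
    by (rule common_denominator[of "Pow ?I" f]) (use f in \<open>simp, blast, blast\<close>)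
  have sc: "s \<in> carrier S" using g(1) by simp
  have hg: "h (g A) = h s \<otimes>\<^bsub>L\<^esub> f A" if A: "A \<subseteq> ?I" for A
    using g(1) g(2)[of A] g(3)[of A] A sc by (simp add: loc_mult) (intro frac_eqI; simp add: m_comm)
  have "kcocycle L (\<lambda>j. z j [^]\<^bsub>L\<^esub> k) {\<zero>\<^bsub>L\<^esub>} ?I i (\<lambda>A. h s \<otimes>\<^bsub>L\<^esub> f A)"
    using loc.zeroideal zn f frac_closed[OF sc one_W] finI cyc by (rule loc.kcocycle_smult)
  then have "kcocycle L (\<lambda>j. h (?v k j)) {\<zero>\<^bsub>L\<^esub>} ?I i (\<lambda>A. h (g A))"
    by (rule loc.kcocycle_cong[OF zn _ _ _ hvc, rotated 3]) (use hv hg f sc in auto)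
  \<comment> \<open>The numerators g of s f form a cocycle only after localising; multiplying by w
    makes them one over S.\<close>
  then obtain w where w: "w \<in> W" "kcocycle S (?v k) {\<zero>} ?I i (\<lambda>A. w \<otimes> g A)"
    by (rule kcocycle_from_loc[OF v g(2) finI]) blast
  have wc: "w \<in> carrier S" using w(1) by simp
  let ?q = "p ^ e" and ?r = "p ^ \<epsilon>"
  have wgq: "(w \<otimes> g A) [^] ?q \<in> carrier S" for A using wc g(2) by simp
  have q: "?q > 0" using additive_power_power[OF p, of e] by (simp add: additive_power_def)
  \<comment> \<open>The factor (w s)^q turns f^q into the image of (w g)^q, a cochain over
    S.\<close>
  have "kboundary L (\<lambda>j. z j [^]\<^bsub>L\<^esub> (k * ?q)) {\<zero>\<^bsub>L\<^esub>} ?I i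
      (\<lambda>A. h ((w \<otimes> s) [^] ?q) \<otimes>\<^bsub>L\<^esub> f A [^]\<^bsub>L\<^esub> ?q)"
    by (rule loc.kboundary_smult[OF zn _ _ finI bd]) (use f wc sc in auto)
  then have "kboundary L (\<lambda>j. h (?v (k * ?q) j)) {\<zero>\<^bsub>L\<^esub>} ?I i (\<lambda>A. h ((w \<otimes> g A) [^] ?q))"
  proof (rule loc.kboundary_cong[OF zn, rotated 2])
    fix A assume A: "A \<subseteq> ?I"
    have "h ((w \<otimes> g A) [^] ?q) = (h w \<otimes>\<^bsub>L\<^esub> (h s \<otimes>\<^bsub>L\<^esub> f A)) [^]\<^bsub>L\<^esub> ?q"
      using wc g(2) by (simp only: h_pow h_mult m_closed hg[OF A])
    also have "\<dots> = h ((w \<otimes> s) [^] ?q) \<otimes>\<^bsub>L\<^esub> f A [^]\<^bsub>L\<^esub> ?q"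
      using wc sc f[of A] by (simp only: h_pow h_mult m_closed) (simp add: loc.nat_pow_distrib loc.m_assoc)
    finally show "h ((w \<otimes> s) [^] ?q) \<otimes>\<^bsub>L\<^esub> f A [^]\<^bsub>L\<^esub> ?q = h ((w \<otimes> g A) [^] ?q)" ..
  qed (simp add: hv)
  then obtain t where t: "t \<in> W" "kboundary S (?v (k * ?q)) {\<zero>} ?I i (\<lambda>A. t \<otimes> (w \<otimes> g A) [^] ?q)"
    by (rule kboundary_from_loc[OF v wgq finI]) blast
  have tc: "t \<in> carrier S" using t(1) by simp
  define g' where "g' A = t \<otimes> (w \<otimes> g A)" for A
  have g': "g' A \<in> carrier S" for A using tc wc g(2) by (simp add: g'_def)
  \<comment> \<open>Descent yields only t times a q-th power. The further factor t^(q-1) makes it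
    the q-th power of g' = t w g, which is what Frobenius iterates of a class require.\<close>
  have "kboundary S (?v (k * ?q)) {\<zero>} ?I i (\<lambda>A. t [^] (?q - 1) \<otimes> (t \<otimes> (w \<otimes> g A) [^] ?q))"
    by (rule kboundary_smult[OF v _ _ finI t(2)]) (use tc wc g(2) in auto)
  moreover have "t [^] (?q - 1) \<otimes> (t \<otimes> (w \<otimes> g A) [^] ?q) = g' A [^] ?q" for A
  proof -
    have "t [^] (?q - 1) \<otimes> t = t [^] ?q" using q nat_pow_Suc[of t "?q - 1"] by simp
    then have "t [^] (?q - 1) \<otimes> (t \<otimes> (w \<otimes> g A) [^] ?q) = t [^] ?q \<otimes> (w \<otimes> g A) [^] ?q"
      using tc wc g(2) by (simp flip: m_assoc)
    also have "\<dots> = g' A [^] ?q" unfolding g'_def using tc wc g(2) by (simp add: nat_pow_distrib)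
    finally show ?thesis .
  qed
  ultimately have bd': "kboundary S (?v (k * ?q)) {\<zero>} ?I i (\<lambda>A. g' A [^] ?q)" by simp
  have cyc': "kcocycle S (?v k) {\<zero>} ?I i g'"
    unfolding g'_def[abs_def]
    by (rule kcocycle_smult[OF zeroideal v _ tc finI w(2)]) (use wc g(2) in auto)
  obtain m where m: "kboundary S (?v (k * ?r + m)) {\<zero>} ?I i (\<lambda>A. X.xpow A m \<otimes> g' A [^] ?r)"
    using X.HSL_bound_cochain[OF p HSL g' cyc' bd'] by blast
  \<comment> \<open>All modifications together multiplied f by t w s. Its r-th power, with r =
    p^\<epsilon>, is a denominator, hence invertible over L, and is divided out again.\<close>
  let ?u = "(t \<otimes> w \<otimes> s) [^] ?r"
  have u: "?u \<in> W" using t(1) w(1) g(1) by simp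
  have uc: "?u \<in> carrier S" using u by simp
  have bdL: "kboundary L (\<lambda>j. h (?v (k * ?r + m) j)) {\<zero>\<^bsub>L\<^esub>} ?I i (\<lambda>A. h (X.xpow A m \<otimes> g' A [^] ?r))"
    by (rule kboundary_to_loc[OF v _ finI m]) (use g' in auto)
  have "kboundary L (\<lambda>j. h (?v (k * ?r + m) j)) {\<zero>\<^bsub>L\<^esub>} ?I i
      (\<lambda>A. fr \<one> ?u \<otimes>\<^bsub>L\<^esub> h (X.xpow A m \<otimes> g' A [^] ?r))"
    by (rule loc.kboundary_smult[OF hvc _ _ finI bdL]) (use g' u in auto)
  then have "kboundary L (\<lambda>j. z j [^]\<^bsub>L\<^esub> (k * ?r + m)) {\<zero>\<^bsub>L\<^esub>} ?I i
      (\<lambda>A. finprod L (\<lambda>j. z j [^]\<^bsub>L\<^esub> m) A \<otimes>\<^bsub>L\<^esub> f A [^]\<^bsub>L\<^esub> ?r)"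
  proof (rule loc.kboundary_cong[OF hvc, rotated 2])
    fix A assume A: "A \<subseteq> ?I"
    have finA: "finite A" using A finite_subset by blast
    have fpc: "finprod L (\<lambda>j. z j [^]\<^bsub>L\<^esub> m) A \<in> carrier L" using zn by (intro loc.finprod_closed) auto
    have "h (X.xpow A m) = finprod L (\<lambda>j. h (?v m j)) A"
      unfolding X.xpow_def using finA by (rule h_finprod) simp
    also have "\<dots> = finprod L (\<lambda>j. z j [^]\<^bsub>L\<^esub> m) A"
      using A zn hv by (intro loc.finprod_cong') auto
    finally have 1: "h (X.xpow A m) = finprod L (\<lambda>j. z j [^]\<^bsub>L\<^esub> m) A" .
    have "h (g' A) = h (t \<otimes> w \<otimes> s) \<otimes>\<^bsub>L\<^esub> f A"
      unfolding g'_def using tc wc g(2) sc f[of A]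
      by (simp only: h_mult m_closed hg[OF A]) (simp add: loc.m_assoc)
    then have 2: "h (g' A [^] ?r) = h ?u \<otimes>\<^bsub>L\<^esub> f A [^]\<^bsub>L\<^esub> ?r"
      using g' tc wc sc f[of A] by (simp only: h_pow m_closed) (simp add: loc.nat_pow_distrib)
    have 3: "fr \<one> ?u \<otimes>\<^bsub>L\<^esub> h ?u = \<one>\<^bsub>L\<^esub>" using u uc by (simp add: loc_mult)
    have "fr \<one> ?u \<otimes>\<^bsub>L\<^esub> h (X.xpow A m \<otimes> g' A [^] ?r)
        = fr \<one> ?u \<otimes>\<^bsub>L\<^esub> (finprod L (\<lambda>j. z j [^]\<^bsub>L\<^esub> m) A \<otimes>\<^bsub>L\<^esub> (h ?u \<otimes>\<^bsub>L\<^esub> f A [^]\<^bsub>L\<^esub> ?r))"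
      using g' by (simp only: h_mult X.xpow_closed nat_pow_closed 1 2)
    also have "\<dots> = (fr \<one> ?u \<otimes>\<^bsub>L\<^esub> h ?u) \<otimes>\<^bsub>L\<^esub> (finprod L (\<lambda>j. z j [^]\<^bsub>L\<^esub> m) A \<otimes>\<^bsub>L\<^esub> f A [^]\<^bsub>L\<^esub> ?r)"
    proof -
      have "fr \<one> ?u \<in> carrier L" "h ?u \<in> carrier L" "f A [^]\<^bsub>L\<^esub> ?r \<in> carrier L"
        using u uc f by simp_all
      then show ?thesis using fpc by (simp only: loc.m_ac loc.m_closed)
    qed
    also have "\<dots> = finprod L (\<lambda>j. z j [^]\<^bsub>L\<^esub> m) A \<otimes>\<^bsub>L\<^esub> f A [^]\<^bsub>L\<^esub> ?r"
      unfolding 3 using fpc f by simp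
    finally show "fr \<one> ?u \<otimes>\<^bsub>L\<^esub> h (X.xpow A m \<otimes> g' A [^] ?r)
        = finprod L (\<lambda>j. z j [^]\<^bsub>L\<^esub> m) A \<otimes>\<^bsub>L\<^esub> f A [^]\<^bsub>L\<^esub> ?r" .
  qed (simp add: hv)
  then show ?thesis ..
qed

lemma (in cring) frobenius_closure_local:
  assumes noeth: "noetherian_ring R" and p: "additive_power R p" "p \<ge> 2"
    and M: "maximalideal M R" and CM: "cohen_macaulay_local (loc_at R M)"
    and J: "ideal J R" and par: "parameter_ideal (loc_at R M) (ideal_at R M J)"
    and HSL: "HSL_top R p M \<le> enat \<epsilon>" and a: "a \<in> frobenius_closure R p J"
  shows "\<exists>w\<in>carrier R - M. w \<otimes> a [^] (p ^ \<epsilon>) \<in> frobenius_power R p \<epsilon> J"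
proof -
  define W where "W = carrier R - M"
  interpret mult_set R W unfolding W_def using M by (rule mult_set_maximal)
  have L: "loc_at R M = L" by (simp add: loc_at_def W_def)
  have pL: "additive_power L p" using p(1) by (rule additive_power_loc)
  let ?xs = "ideal_gens R M"
  have xs: "set ?xs \<subseteq> carrier R" "genideal R (set ?xs) = M"
    using noetherian_ring.ideal_gens_spec[OF noeth maximalideal.axioms(1)[OF M]] by blast+
  have local: "noetherian_local L" and depth: "depth L = krull_dim L"
    using CM unfolding L cohen_macaulay_local_def by blast+
  note mx = the_maximal_loc[OF M W_def local xs]
  obtain ys where ys: "set ys \<subseteq> the_maximal L" "enat (length ys) = krull_dim L"
    "radical_of L (genideal L (set ys)) = the_maximal L" "ideal_at R M J = genideal L (set ys)"
    using par unfolding L parameter_ideal_def system_of_parameters_def by blast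
  have mc: "the_maximal L \<subseteq> carrier L"
    using mx(1) by (meson ideal.Icarr maximalideal.axioms(1) subsetI)
  have ysc: "set ys \<subseteq> carrier L" using ys(1) mc by (rule order_trans)
  have ext: "genideal L (h ` J) = genideal L (set ys)"
    using ys(4) unfolding ideal_at_def L by (simp add: W_def)
  \<comment> \<open>Needed for rings of dimension 0, where the regular sequence is empty and has to
    generate a proper ideal.\<close>
  have nz: "carrier L \<noteq> {\<zero>\<^bsub>L\<^esub>}"
  proof
    assume trivial: "carrier L = {\<zero>\<^bsub>L\<^esub>}"
    have "\<zero>\<^bsub>L\<^esub> \<in> the_maximal L"
      using mx(1) by (meson additive_subgroup.zero_closed ideal.axioms(1) maximalideal.axioms(1))
    then have "carrier L \<subseteq> the_maximal L" unfolding trivial by (rule insert_subsetI) simp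
    with mc have "the_maximal L = carrier L" by (rule subset_antisym)
    then show False using maximalideal.I_notcarr[OF mx(1)] by simp
  qed
  have dep: "depth L = enat (length ys)" using depth ys(2) by simp
  obtain as where as: "regular_sequence L as" "set as \<subseteq> the_maximal L" "length as = length ys"
    using dep nz by (rule loc.depth_attained)
  let ?n = "length ?xs" and ?d = "length ys"
  \<comment> \<open>Generators of M first, parameters after them, and 1 as a default in the carrier;
    V and Y are the two index ranges.\<close>
  define z where "z j = (if j < ?n then h (?xs ! j) else if j < ?n + ?d then ys ! (j - ?n) else \<one>\<^bsub>L\<^esub>)" for j
  have nthx: "?xs ! j \<in> carrier R" if "j < ?n" for j using xs(1) nth_mem[OF that] by blast
  have nthy: "ys ! j \<in> carrier L" if "j < ?d" for j using ysc nth_mem[OF that] by blast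
  have z: "z j \<in> carrier L" for j using nthx nthy by (simp add: z_def)
  let ?V = "{..<?n}" and ?Y = "{?n..<?n + ?d}"
  have zV: "z ` ?V = h ` set ?xs"
  proof -
    have "z ` ?V = (\<lambda>j. h (?xs ! j)) ` ?V" by (intro image_cong) (auto simp: z_def)
    also have "\<dots> = h ` (!) ?xs ` ?V" by (simp add: image_image)
    also have "(!) ?xs ` ?V = set ?xs" by (auto simp: set_conv_nth)
    finally show ?thesis .
  qed
  have zY: "z ` ?Y = set ys"
  proof -
    have "z ` ?Y = z ` (\<lambda>j. ?n + j) ` {..<?d}"
      by (simp add: lessThan_atLeast0 image_add_atLeastLessThan add.commute)
    also have "\<dots> = (\<lambda>j. ys ! j) ` {..<?d}" unfolding image_image by (intro image_cong) (auto simp: z_def)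
    also have "\<dots> = set ys" by (auto simp: set_conv_nth)
    finally show ?thesis .
  qed
  have zYq: "(\<lambda>j. z j [^]\<^bsub>L\<^esub> (q::nat)) ` ?Y = (\<lambda>y. y [^]\<^bsub>L\<^esub> q) ` set ys" for q
    unfolding zY[symmetric] image_image ..
  have radY: "\<exists>n::nat. b [^]\<^bsub>L\<^esub> n \<in> genideal L (z ` ?Y)" if "b \<in> the_maximal L" for b
    using that unfolding zY ys(3)[symmetric] radical_of_def by blast
  \<comment> \<open>Exponent 1 suffices, since the images of the generators of M generate the
    maximal ideal of the local ring itself.\<close>
  have radV: "\<exists>n::nat. b [^]\<^bsub>L\<^esub> n \<in> genideal L (z ` ?V)" if b: "b \<in> the_maximal L" for b
  proof (intro exI)
    have "b [^]\<^bsub>L\<^esub> (1::nat) = b" using subsetD[OF mc b] by simp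
    then show "b [^]\<^bsub>L\<^esub> (1::nat) \<in> genideal L (z ` ?V)" using subsetD[OF mx(3) b] by (simp add: zV)
  qed
  have zmax: "z j \<in> the_maximal L" if "j \<in> ?V" for j
    using imageI[OF that, of z] unfolding zV by (rule subsetD[OF mx(2)])
  obtain e where e: "a \<in> carrier R" "a [^] (p ^ e) \<in> frobenius_power R p e J"
    using a by (auto simp: frobenius_closure_def)
  have cY: "card ?Y = ?d" by simp
  obtain N :: nat and f where f: "\<And>A. f A \<in> carrier L"
    "kcocycle L (\<lambda>j. z j [^]\<^bsub>L\<^esub> N) {\<zero>\<^bsub>L\<^esub>} ?V ?d f"
    "\<And>q. \<lbrakk>additive_power L q; h a [^]\<^bsub>L\<^esub> q \<in> genideal L ((\<lambda>j. z j [^]\<^bsub>L\<^esub> q) ` ?Y)\<rbrakk>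
      \<Longrightarrow> kboundary L (\<lambda>j. z j [^]\<^bsub>L\<^esub> (N * q)) {\<zero>\<^bsub>L\<^esub>} ?V ?d (\<lambda>A. f A [^]\<^bsub>L\<^esub> q)"
    "\<And>q m. \<lbrakk>additive_power L q;
        kboundary L (\<lambda>j. z j [^]\<^bsub>L\<^esub> (N * q + m)) {\<zero>\<^bsub>L\<^esub>} ?V ?d
          (\<lambda>A. finprod L (\<lambda>j. z j [^]\<^bsub>L\<^esub> m) A \<otimes>\<^bsub>L\<^esub> f A [^]\<^bsub>L\<^esub> q)\<rbrakk>
      \<Longrightarrow> h a [^]\<^bsub>L\<^esub> q \<in> genideal L ((\<lambda>j. z j [^]\<^bsub>L\<^esub> q) ` ?Y)"
  proof (rule loc.parameter_cocycle[of p z ?V ?Y as "h a", unfolded cY])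
    show "\<exists>n::nat. b [^]\<^bsub>L\<^esub> n \<in> genideal L (z ` ?V)" if "b \<in> set as" for b
      using radV as(2) that by blast
    show "\<exists>n::nat. b [^]\<^bsub>L\<^esub> n \<in> genideal L (z ` ?Y)" if "b \<in> set as" for b
      using radY as(2) that by blast
    show "\<exists>n::nat. z j [^]\<^bsub>L\<^esub> n \<in> genideal L (z ` ?Y)" if "j \<in> ?V" for j
      using zmax[OF that] by (rule radY)
  qed (use pL p(2) z as(1,3) e(1) in auto)
  \<comment> \<open>Membership of a in the Frobenius closure, read in the local ring with the powers
    of the parameters as generators; it makes the class attached to f nilpotent.\<close>
  have "h (a [^] (p ^ e)) \<in> genideal L ((\<lambda>y. y [^]\<^bsub>L\<^esub> (p ^ e)) ` set ys)"
    using e(2) unfolding frobenius_power_def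
    by (rule ideal_at_power(1)[OF additive_power_power[OF p(1)] J ext ysc])
  then have "kboundary L (\<lambda>j. z j [^]\<^bsub>L\<^esub> (N * p ^ e)) {\<zero>\<^bsub>L\<^esub>} ?V ?d (\<lambda>A. f A [^]\<^bsub>L\<^esub> (p ^ e))"
    using e(1) by (intro f(3) loc.additive_power_power[OF pL]) (simp add: zYq h_pow)
  moreover have "HSL (cech_cohomology R ?xs ?d) (cech_frobenius R p ?xs ?d) \<le> enat \<epsilon>"
  proof -
    \<comment> \<open>The number of parameters is the dimension, so the cohomological degree in
      \<open>HSL_top\<close> is the top degree of the Koszul complex on the parameters.\<close>
    have "the_enat (krull_dim (loc_at R M)) = ?d" unfolding L ys(2)[symmetric] by simp
    then show ?thesis
      using HSL unfolding HSL_top_def Let_def local_cohomology_def local_cohomology_frobenius_def[abs_def] by simp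
  qed
  ultimately obtain m where "kboundary L (\<lambda>j. z j [^]\<^bsub>L\<^esub> (N * p ^ \<epsilon> + m)) {\<zero>\<^bsub>L\<^esub>} ?V ?d
      (\<lambda>A. finprod L (\<lambda>j. z j [^]\<^bsub>L\<^esub> m) A \<otimes>\<^bsub>L\<^esub> f A [^]\<^bsub>L\<^esub> (p ^ \<epsilon>))"
    using HSL_bound_loc[OF p(1) xs(1) _ z _ f(1,2)] by (auto simp: z_def)
  then have "h a [^]\<^bsub>L\<^esub> (p ^ \<epsilon>) \<in> genideal L ((\<lambda>j. z j [^]\<^bsub>L\<^esub> (p ^ \<epsilon>)) ` ?Y)"
    by (rule f(4)[OF loc.additive_power_power[OF pL]])
  then have "h (a [^] (p ^ \<epsilon>)) \<in> genideal L ((\<lambda>y. y [^]\<^bsub>L\<^esub> (p ^ \<epsilon>)) ` set ys)"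
    using e(1) by (simp add: zYq h_pow)
  also have "\<dots> \<subseteq> genideal L (h ` frobenius_power R p \<epsilon> J)"
    unfolding frobenius_power_def
    by (rule ideal_at_power(2)[OF additive_power_power[OF p(1)] J ext ysc])
  finally have "h (a [^] (p ^ \<epsilon>)) \<in> genideal L (h ` frobenius_power R p \<epsilon> J)" .
  \<comment> \<open>The multiplier w outside M is the price of returning from the local ring to the
    global ideal.\<close>
  then obtain w where "w \<in> W" "w \<otimes> a [^] (p ^ \<epsilon>) \<in> frobenius_power R p \<epsilon> J"
    by (rule ideal_from_loc[OF frobenius_power_ideal[OF J] nat_pow_closed[OF e(1)]])
  then show ?thesis unfolding W_def by blast
qed

theorem corollary24:
  fixes S :: "'a ring"
    and \<phi> :: "(('v::finite \<Rightarrow>\<^sub>0 nat) \<Rightarrow>\<^sub>0 'k::field) \<Rightarrow> 'a"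
    and J :: "'a set"
    and p \<epsilon> :: nat
  assumes char_k: "CHAR('k) = p" "p > 0"
    and perfect_k: "surj (\<lambda>c::'k. c ^ p)"
    and S_cring: "cring S"
    and S_quotient: "\<phi> \<in> ring_hom polynomial_ring S" "\<phi> ` carrier polynomial_ring = carrier S"
    and S_CM: "cohen_macaulay S"
    and S_gen_gor: "generically_gorenstein S"
    and HSL_bound: "\<forall>h \<in> {HSL_top S p M | M. maximalideal M S}. h \<le> enat \<epsilon>"
    and J_ideal: "ideal J S"
    and J_param: "\<forall>M. maximalideal M S \<and> J \<subseteq> M \<longrightarrow> parameter_ideal (loc_at S M) (ideal_at S M J)"
  shows "frobenius_power S p \<epsilon> (frobenius_closure S p J) = frobenius_power S p \<epsilon> J"
proof -
  interpret cring S by (rule S_cring)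
  interpret J: ideal J S by (rule J_ideal)
  note p = additive_power_polynomial_quotient[OF char_k S_cring S_quotient]
  have noeth: "noetherian_ring S" using S_CM by (simp add: cohen_macaulay_def)
  have idJ: "ideal (frobenius_power S p \<epsilon> J) S" using J_ideal by (rule frobenius_power_ideal)
  have closure: "frobenius_closure S p J \<subseteq> carrier S" by (auto simp: frobenius_closure_def)
  have mem: "a [^]\<^bsub>S\<^esub> (p ^ \<epsilon>) \<in> frobenius_power S p \<epsilon> J" if a: "a \<in> frobenius_closure S p J" for a
  proof (rule ideal_membership_local[OF noeth idJ])
    have ac: "a \<in> carrier S" using a closure by blast
    then show "a [^]\<^bsub>S\<^esub> (p ^ \<epsilon>) \<in> carrier S" by simp
    fix M assume M: "maximalideal M S"
    show "\<exists>w\<in>carrier S - M. w \<otimes>\<^bsub>S\<^esub> a [^]\<^bsub>S\<^esub> (p ^ \<epsilon>) \<in> frobenius_power S p \<epsilon> J"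
    proof (cases "J \<subseteq> M")
      case True
      show ?thesis
      proof (rule frobenius_closure_local[OF noeth p M _ J_ideal _ _ a])
        show "cohen_macaulay_local (loc_at S M)" using S_CM M by (simp add: cohen_macaulay_def)
        show "parameter_ideal (loc_at S M) (ideal_at S M J)" using J_param M True by blast
        show "HSL_top S p M \<le> enat \<epsilon>" using HSL_bound M by blast
      qed
    next
      case False
      then obtain b where b: "b \<in> J" "b \<notin> M" by blast
      interpret W: mult_set S "carrier S - M" using M by (rule mult_set_maximal)
      \<comment> \<open>At a maximal ideal that does not contain J the Frobenius power is the unit
        ideal locally: the power of b lies in it and outside M, so it serves as the
        multiplier.\<close>
      have "b [^]\<^bsub>S\<^esub> (p ^ \<epsilon>) \<in> carrier S - M" using b J.a_Hcarr by (intro W.pow_W) blast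
      moreover have "b [^]\<^bsub>S\<^esub> (p ^ \<epsilon>) \<in> frobenius_power S p \<epsilon> J"
        using J_ideal b(1) by (rule frobenius_power_mem)
      then have "b [^]\<^bsub>S\<^esub> (p ^ \<epsilon>) \<otimes>\<^bsub>S\<^esub> a [^]\<^bsub>S\<^esub> (p ^ \<epsilon>) \<in> frobenius_power S p \<epsilon> J"
        using ac by (intro ideal.I_r_closed[OF idJ]) simp_all
      ultimately show ?thesis by blast
    qed
  qed
  \<comment> \<open>The exponent 1 is used because the Frobenius closure admits only positive
    exponents.\<close>
  have sub: "J \<subseteq> frobenius_closure S p J"
  proof
    fix a assume "a \<in> J"
    then have "a [^]\<^bsub>S\<^esub> (p ^ 1) \<in> frobenius_power S p 1 J" "a \<in> carrier S"
      using frobenius_power_mem[OF J_ideal] J.a_Hcarr by blast+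
    then show "a \<in> frobenius_closure S p J"
      unfolding frobenius_closure_def by (intro CollectI conjI exI[of _ 1]) simp_all
  qed
  have powc: "(\<lambda>a. a [^]\<^bsub>S\<^esub> (p ^ \<epsilon>)) ` frobenius_closure S p J \<subseteq> carrier S" using closure by auto
  show ?thesis
  proof
    show "frobenius_power S p \<epsilon> (frobenius_closure S p J) \<subseteq> frobenius_power S p \<epsilon> J"
      unfolding frobenius_power_def[of S p \<epsilon> "frobenius_closure S p J"]
      by (rule genideal_minimal[OF idJ]) (use mem in blast)
    show "frobenius_power S p \<epsilon> J \<subseteq> frobenius_power S p \<epsilon> (frobenius_closure S p J)"
      unfolding frobenius_power_def
      by (rule genideal_minimal[OF genideal_ideal[OF powc]])
        (use genideal_self[OF powc] sub in blast)
  qed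
qed

end
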